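(* Let $\Gamma\subset\mathrm{PSL}_2(\mathbb{R})$ be a Fuchsian group of the first kind and let $\Gamma_1$ be a finite index subgroup of $\Gamma$. The Ax-Lindemann-Weierstrass Theorem holds for $\Gamma$ if and only if it holds for $\Gamma_1$.
   Context: For a Fuchsian group $\Gamma$ of the first kind, let $j_\Gamma$ be a uniformizing function for $\Gamma$: a nonconstant meromorphic function on the upper half plane $\mathbb{H}$, automorphic for $\Gamma$ (and meromorphic at the cusps). $\mathrm{Comm}(\Gamma)=\{g\in\mathrm{PSL}_2(\mathbb{R}): g\Gamma g^{-1}\cap\Gamma$ has finite index in both $g\Gamma g^{-1}$ and $\Gamma\}$. Functions $t_1,\ldots,t_n$ are $\Gamma$-geodesically independent if each $t_i$ is nonconstant and there are no relations $t_i=\gamma t_j$ with $i\ne j$ and $\gamma\in\mathrm{Comm}(\Gamma)$ (acting by linear fractional transformations). The Ax-Lindemann-Weierstrass Theorem holds for $\Gamma$ if: for every irreducible algebraic variety $V\subset\mathbb{A}^N$ over $\mathbb{C}$ with function field $\mathbb{C}(V)$, and all $\Gamma$-geodesically independent $t_1,\ldots,t_n\in\mathbb{C}(V)$ taking values in $\mathbb{H}$ at some $P\in V$, the $3n$ functions $j_\Gamma(t_1),j_\Gamma'(t_1),j_\Gamma''(t_1),\ldots,j_\Gamma(t_n),j_\Gamma'(t_n),j_\Gamma''(t_n)$ (considered as functions on $V(\mathbb{C})$ locally near $P$) are algebraically independent over $\mathbb{C}(V)$. *)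

theory Defs
  imports
    "HOL-Complex_Analysis.Complex_Analysis"
    "HOL-Algebra.Algebra"
    "HOL-Library.Poly_Mapping"
begin

no_notation fps_nth (infixl \<open>$\<close> 75)

section \<open>The group $PSL_2(R)$ and its action\<close>

definition SL2R :: "(real^2^2) monoid" where
  "SL2R = \<lparr>carrier = {A. det A = 1}, monoid.mult = (**), one = mat 1\<rparr>"

text \<open>Elements of $PSL_2(R)$ are the cosets $\{A, -A\}$.  Hence for a subset \<open>\<Gamma>\<close> of
  $PSL_2(R)$ the set \<open>\<Union>\<Gamma>\<close> is its preimage in $SL_2(R)$.\<close>

definition PSL2R :: "(real^2^2) set monoid" where
  "PSL2R = SL2R Mod {mat 1, - mat 1}"

definition upper_half_plane :: "complex set" where
  "upper_half_plane = {z. Im z > 0}"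

definition mobius :: "real^2^2 \<Rightarrow> complex \<Rightarrow> complex" where
  "mobius A z = (of_real (A$1$1) * z + of_real (A$1$2)) / (of_real (A$2$1) * z + of_real (A$2$2))"

text \<open>The same action on the Riemann sphere, where \<open>None\<close> is the point at infinity.\<close>

definition mobius_ext :: "real^2^2 \<Rightarrow> complex option \<Rightarrow> complex option" where
  "mobius_ext A x =
    (case x of
       None \<Rightarrow> if A$2$1 = 0 then None else Some (of_real (A$1$1 / A$2$1))
     | Some z \<Rightarrow> if of_real (A$2$1) * z + of_real (A$2$2) = 0 then None else Some (mobius A z))"

lemma group_SL2R: "group SL2R"
proof (rule groupI)
  fix A assume A: "A \<in> carrier SL2R"
  then have "invertible A"
    by (simp add: SL2R_def invertible_det_nz)
  then obtain B where B: "A ** B = mat 1" "B ** A = mat 1"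
    unfolding invertible_def by blast
  have "det B * det A = 1"
    using B(2) by (metis det_I det_mul)
  with A B show "\<exists>B\<in>carrier SL2R. B \<otimes>\<^bsub>SL2R\<^esub> A = \<one>\<^bsub>SL2R\<^esub>"
    by (intro bexI[of _ B]) (auto simp: SL2R_def)
qed (auto simp: SL2R_def det_mul matrix_mul_assoc)

lemma normal_center_SL2R: "{mat 1, - mat 1} \<lhd> SL2R"
proof -
  interpret group SL2R by (rule group_SL2R)
  have m: "- mat 1 \<in> carrier SL2R" "\<one>\<^bsub>SL2R\<^esub> = mat 1"
    by (auto simp: SL2R_def det_2 mat_def)
  have minus: "(-1) *\<^sub>R (mat 1 :: real^2^2) = - mat 1"
    by simp
  have neg: "(- mat 1) ** (A::real^2^2) = - A" "A ** (- mat 1) = - A" for A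
    by (metis minus scalar_matrix_assoc matrix_mul_lid scaleR_minus1_left)
       (metis minus matrix_scalar_ac matrix_mul_rid scaleR_minus1_left)
  have mm: "- mat 1 \<otimes>\<^bsub>SL2R\<^esub> - mat 1 = \<one>\<^bsub>SL2R\<^esub>"
    by (simp add: SL2R_def neg)
  have inv_m: "inv\<^bsub>SL2R\<^esub> (- mat 1) = - mat 1"
    using inv_equality[OF mm m(1) m(1)] .
  have "subgroup {mat 1, - mat 1} SL2R"
  proof (rule subgroupI)
    show "{mat 1, - mat 1} \<subseteq> carrier SL2R" using m one_closed by auto
    show "inv\<^bsub>SL2R\<^esub> a \<in> {mat 1, - mat 1}" if "a \<in> {mat 1, - mat 1}" for a
      using that inv_m inv_one unfolding m(2) by auto
    show "a \<otimes>\<^bsub>SL2R\<^esub> b \<in> {mat 1, - mat 1}"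
      if "a \<in> {mat 1, - mat 1}" "b \<in> {mat 1, - mat 1}" for a b
      using that by (auto simp: SL2R_def neg)
  qed auto
  then show ?thesis
    by (rule normalI) (auto simp: r_coset_def l_coset_def SL2R_def neg)
qed

lemma group_PSL2R: "group PSL2R"
  unfolding PSL2R_def by (rule normal.factorgroup_is_group[OF normal_center_SL2R])


section \<open>Fuchsian groups of the first kind\<close>

definition fuchsian :: "(real^2^2) set set \<Rightarrow> bool" where
  "fuchsian \<Gamma> \<longleftrightarrow> subgroup \<Gamma> PSL2R \<and> discrete (\<Union>\<Gamma>)"

definition cusps :: "(real^2^2) set set \<Rightarrow> complex option set" where
  "cusps \<Gamma> = {s \<in> insert None (Some ` \<real>).
     \<exists>A\<in>\<Union>\<Gamma>. A \<noteq> mat 1 \<and> A \<noteq> - mat 1 \<and> \<bar>trace A\<bar> = 2 \<and> mobius_ext A s = s}"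

definition extended_plane :: "(real^2^2) set set \<Rightarrow> complex option set" where
  "extended_plane \<Gamma> = Some ` upper_half_plane \<union> cusps \<Gamma>"

text \<open>Open half planes above a horizontal line, respectively open discs tangent to the
  real line at \<open>x\<close>.\<close>

definition horoball :: "complex option \<Rightarrow> real \<Rightarrow> complex set" where
  "horoball s r =
    (case s of None \<Rightarrow> {z. Im z > r} | Some x \<Rightarrow> ball (x + of_real r * \<i>) r)"

definition extended_plane_topology :: "(real^2^2) set set \<Rightarrow> complex option topology" where
  "extended_plane_topology \<Gamma> = topology (\<lambda>U. U \<subseteq> extended_plane \<Gamma> \<and>
     open {z \<in> upper_half_plane. Some z \<in> U} \<and>
     (\<forall>s \<in> U \<inter> cusps \<Gamma>. \<exists>r>0. Some ` horoball s r \<subseteq> U))"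

lemma horoball_antimono:
  assumes "s \<in> insert None (Some ` \<real>)" "r > 0" "r' > 0"
  shows "\<exists>r''>0. horoball s r'' \<subseteq> horoball s r \<and> horoball s r'' \<subseteq> horoball s r'"
proof (cases s)
  case None
  then show ?thesis using assms
    by (intro exI[of _ "max r r'"]) (auto simp: horoball_def)
next
  case (Some x)
  have *: "ball (x + of_real a * \<i>) a \<subseteq> ball (x + of_real b * \<i>) b"
    if "0 < a" "a \<le> b" for a b :: real
  proof
    fix z assume "z \<in> ball (x + of_real a * \<i>) a"
    then have z: "dist (x + of_real a * \<i>) z < a" by simp
    have "(x + of_real b * \<i>) - (x + of_real a * \<i>) = of_real (b - a) * \<i>"
      by (simp add: algebra_simps)
    then have "dist (x + of_real b * \<i>) (x + of_real a * \<i>) = b - a"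
      using that by (simp only: dist_norm norm_mult norm_of_real) simp
    with z dist_triangle[of "x + of_real b * \<i>" z "x + of_real a * \<i>"]
    show "z \<in> ball (x + of_real b * \<i>) b" by (simp only: mem_ball)
  qed
  have "0 < min r r'" using assms by simp
  moreover have "ball (x + of_real (min r r') * \<i>) (min r r') \<subseteq> ball (x + of_real r * \<i>) r"
    "ball (x + of_real (min r r') * \<i>) (min r r') \<subseteq> ball (x + of_real r' * \<i>) r'"
    using assms by (intro *; simp)+
  ultimately show ?thesis
    unfolding Some horoball_def option.case by blast
qed

lemma istopology_extended_plane:
  "istopology (\<lambda>U. U \<subseteq> extended_plane \<Gamma> \<and>
     open {z \<in> upper_half_plane. Some z \<in> U} \<and>
     (\<forall>s \<in> U \<inter> cusps \<Gamma>. \<exists>r>0. Some ` horoball s r \<subseteq> U))" (is "istopology ?P")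
  unfolding istopology_def
proof (intro conjI allI impI)
  fix S T assume S: "?P S" and T: "?P T"
  show "S \<inter> T \<subseteq> extended_plane \<Gamma>" using S by blast
  have "{z \<in> upper_half_plane. Some z \<in> S \<inter> T} =
    {z \<in> upper_half_plane. Some z \<in> S} \<inter> {z \<in> upper_half_plane. Some z \<in> T}" by auto
  then show "open {z \<in> upper_half_plane. Some z \<in> S \<inter> T}" using S T by auto
  show "\<forall>s \<in> (S \<inter> T) \<inter> cusps \<Gamma>. \<exists>r>0. Some ` horoball s r \<subseteq> S \<inter> T"
  proof
    fix s assume s: "s \<in> (S \<inter> T) \<inter> cusps \<Gamma>"
    then obtain r r' where "r > 0" "Some ` horoball s r \<subseteq> S" "r' > 0" "Some ` horoball s r' \<subseteq> T"
      using S T by blast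
    moreover from s have "s \<in> insert None (Some ` \<real>)" by (auto simp: cusps_def)
    ultimately show "\<exists>r>0. Some ` horoball s r \<subseteq> S \<inter> T"
      using horoball_antimono[of s r r'] by blast
  qed
next
  fix \<K> assume K: "\<forall>K\<in>\<K>. ?P K"
  show "\<Union>\<K> \<subseteq> extended_plane \<Gamma>" using K by blast
  have "{z \<in> upper_half_plane. Some z \<in> \<Union>\<K>} = (\<Union>K\<in>\<K>. {z \<in> upper_half_plane. Some z \<in> K})"
    by auto
  moreover have "open (\<Union>K\<in>\<K>. {z \<in> upper_half_plane. Some z \<in> K})"
    using K by (intro open_UN) blast
  ultimately show "open {z \<in> upper_half_plane. Some z \<in> \<Union>\<K>}" by simp
  show "\<forall>s \<in> \<Union>\<K> \<inter> cusps \<Gamma>. \<exists>r>0. Some ` horoball s r \<subseteq> \<Union>\<K>"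
  proof
    fix s assume "s \<in> \<Union>\<K> \<inter> cusps \<Gamma>"
    then obtain K' where K': "K' \<in> \<K>" "s \<in> K' \<inter> cusps \<Gamma>" by auto
    with K obtain r where "r > 0" "Some ` horoball s r \<subseteq> K'" by meson
    with K'(1) show "\<exists>r>0. Some ` horoball s r \<subseteq> \<Union>\<K>" by (meson Union_upper order_trans)
  qed
qed

definition orbit_of :: "(real^2^2) set set \<Rightarrow> complex option \<Rightarrow> complex option set" where
  "orbit_of \<Gamma> x = (\<lambda>A. mobius_ext A x) ` \<Union>\<Gamma>"

definition orbit_space :: "(real^2^2) set set \<Rightarrow> complex option set topology" where
  "orbit_space \<Gamma> = topology (\<lambda>W. W \<subseteq> orbit_of \<Gamma> ` extended_plane \<Gamma> \<and>
     openin (extended_plane_topology \<Gamma>) {x \<in> extended_plane \<Gamma>. orbit_of \<Gamma> x \<in> W})"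

lemma istopology_orbit_space:
  "istopology (\<lambda>W. W \<subseteq> orbit_of \<Gamma> ` extended_plane \<Gamma> \<and>
     openin (extended_plane_topology \<Gamma>) {x \<in> extended_plane \<Gamma>. orbit_of \<Gamma> x \<in> W})"
  unfolding istopology_def
proof (intro conjI allI impI; (elim conjE)?)
  fix S T
  assume "openin (extended_plane_topology \<Gamma>) {x \<in> extended_plane \<Gamma>. orbit_of \<Gamma> x \<in> S}"
    "openin (extended_plane_topology \<Gamma>) {x \<in> extended_plane \<Gamma>. orbit_of \<Gamma> x \<in> T}"
  from openin_Int[OF this]
  show "openin (extended_plane_topology \<Gamma>) {x \<in> extended_plane \<Gamma>. orbit_of \<Gamma> x \<in> S \<inter> T}"
    by (rule back_subst) auto
next
  fix \<K>
  assume K: "\<forall>K\<in>\<K>. K \<subseteq> orbit_of \<Gamma> ` extended_plane \<Gamma> \<and>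
    openin (extended_plane_topology \<Gamma>) {x \<in> extended_plane \<Gamma>. orbit_of \<Gamma> x \<in> K}"
  then have "openin (extended_plane_topology \<Gamma>)
      (\<Union>K\<in>\<K>. {x \<in> extended_plane \<Gamma>. orbit_of \<Gamma> x \<in> K})"
    by (intro openin_Union) auto
  then show "openin (extended_plane_topology \<Gamma>) {x \<in> extended_plane \<Gamma>. orbit_of \<Gamma> x \<in> \<Union>\<K>}"
    by (rule back_subst) auto
  show "\<Union>\<K> \<subseteq> orbit_of \<Gamma> ` extended_plane \<Gamma>" using K by blast
qed blast

text \<open>Shimura's definition: the quotient of the upper half plane extended by the cusps is
  compact.  By a theorem of Siegel this is equivalent to finite covolume.\<close>

definition fuchsian_first_kind :: "(real^2^2) set set \<Rightarrow> bool" where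
  "fuchsian_first_kind \<Gamma> \<longleftrightarrow> fuchsian \<Gamma> \<and> compact_space (orbit_space \<Gamma>)"


section \<open>Uniformizing functions\<close>

definition translation :: "real \<Rightarrow> real^2^2" where
  "translation h = vector [vector [1, h], vector [0, 1]]"

text \<open>If \<open>\<sigma>\<close> moves infinity to a cusp of \<open>\<Gamma>\<close> and \<open>h\<close> is a period of the conjugated group, then
  \<open>f \<circ> \<sigma>\<close> is near infinity a function of $q = e^{2\pi i z/h}$ that is meromorphic at $q = 0$.\<close>

definition meromorphic_at_cusps :: "(real^2^2) set set \<Rightarrow> (complex \<Rightarrow> complex) \<Rightarrow> bool" where
  "meromorphic_at_cusps \<Gamma> f \<longleftrightarrow>
    (\<forall>\<sigma>\<in>carrier SL2R. \<forall>h>0. \<sigma> ** translation h ** inv\<^bsub>SL2R\<^esub> \<sigma> \<in> \<Union>\<Gamma> \<longrightarrow>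
      (\<exists>F c. F meromorphic_on {0} \<and>
        (\<forall>z. Im z > c \<and> Im z > 0 \<longrightarrow> f (mobius \<sigma> z) = F (exp (2 * of_real pi * \<i> * z / of_real h)))))"

text \<open>\<open>nicely_meromorphic_on\<close> fixes the junk values: \<open>0\<close> at a pole, and no removable
  singularities.\<close>

definition uniformizing_function :: "(real^2^2) set set \<Rightarrow> (complex \<Rightarrow> complex) \<Rightarrow> bool" where
  "uniformizing_function \<Gamma> j \<longleftrightarrow>
     j nicely_meromorphic_on upper_half_plane \<and>
     \<not> j constant_on upper_half_plane \<and>
     (\<forall>A\<in>\<Union>\<Gamma>. \<forall>z\<in>upper_half_plane. j (mobius A z) = j z) \<and>
     meromorphic_at_cusps \<Gamma> j"


section \<open>The commensurator\<close>

definition finite_index_subgroup :: "('a, 'b) monoid_scheme \<Rightarrow> 'a set \<Rightarrow> 'a set \<Rightarrow> bool" where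
  "finite_index_subgroup G K H \<longleftrightarrow>
     subgroup K (G\<lparr>carrier := H\<rparr>) \<and> finite (rcosets\<^bsub>G\<lparr>carrier := H\<rparr>\<^esub> K)"

definition commensurator :: "(real^2^2) set set \<Rightarrow> (real^2^2) set set" where
  "commensurator \<Gamma> = {g \<in> carrier PSL2R.
     let \<Gamma>' = (g <#\<^bsub>PSL2R\<^esub> \<Gamma>) #>\<^bsub>PSL2R\<^esub> inv\<^bsub>PSL2R\<^esub> g in
       finite_index_subgroup PSL2R (\<Gamma>' \<inter> \<Gamma>) \<Gamma>' \<and> finite_index_subgroup PSL2R (\<Gamma>' \<inter> \<Gamma>) \<Gamma>}"


section \<open>Affine varieties and their function fields\<close>

text \<open>Polynomials in countably many variables over the complex numbers; affine $N$-space
  consists of the sequences that vanish from index $N$ on, so that the subspace topology is the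
  Euclidean one.\<close>

type_synonym cpoly = "(nat \<Rightarrow>\<^sub>0 nat) \<Rightarrow>\<^sub>0 complex"

definition polys :: "nat \<Rightarrow> cpoly set" where
  "polys N = {p. \<forall>m \<in> Poly_Mapping.keys p. Poly_Mapping.keys m \<subseteq> {..<N}}"

definition eval_poly :: "cpoly \<Rightarrow> (nat \<Rightarrow> complex) \<Rightarrow> complex" where
  "eval_poly p x = (\<Sum>m \<in> Poly_Mapping.keys p.
     Poly_Mapping.lookup p m * (\<Prod>i \<in> Poly_Mapping.keys m. x i ^ Poly_Mapping.lookup m i))"

definition affine_space :: "nat \<Rightarrow> (nat \<Rightarrow> complex) set" where
  "affine_space N = {x. \<forall>i\<ge>N. x i = 0}"

definition algebraic_set :: "nat \<Rightarrow> (nat \<Rightarrow> complex) set \<Rightarrow> bool" where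
  "algebraic_set N V \<longleftrightarrow> (\<exists>S \<subseteq> polys N. V = {x \<in> affine_space N. \<forall>p\<in>S. eval_poly p x = 0})"

definition irreducible_variety :: "nat \<Rightarrow> (nat \<Rightarrow> complex) set \<Rightarrow> bool" where
  "irreducible_variety N V \<longleftrightarrow> algebraic_set N V \<and> V \<noteq> {} \<and>
     (\<forall>A B. algebraic_set N A \<and> algebraic_set N B \<and> V = A \<union> B \<longrightarrow> A = V \<or> B = V)"

text \<open>The function field is the field of fractions of the coordinate ring: its elements are
  classes of fractions \<open>(p, q)\<close> whose denominator is not identically zero on \<open>V\<close>.\<close>

type_synonym ratfun = "(cpoly \<times> cpoly) set"

definition fractions :: "nat \<Rightarrow> (nat \<Rightarrow> complex) set \<Rightarrow> (cpoly \<times> cpoly) set" where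
  "fractions N V = {(p, q). p \<in> polys N \<and> q \<in> polys N \<and> (\<exists>x\<in>V. eval_poly q x \<noteq> 0)}"

definition fraction_rel ::
    "nat \<Rightarrow> (nat \<Rightarrow> complex) set \<Rightarrow> ((cpoly \<times> cpoly) \<times> (cpoly \<times> cpoly)) set" where
  "fraction_rel N V = {((p, q), (p', q')). (p, q) \<in> fractions N V \<and> (p', q') \<in> fractions N V \<and>
     (\<forall>x\<in>V. eval_poly (p * q') x = eval_poly (p' * q) x)}"

definition mk_frac :: "nat \<Rightarrow> (nat \<Rightarrow> complex) set \<Rightarrow> cpoly \<Rightarrow> cpoly \<Rightarrow> ratfun" where
  "mk_frac N V p q = fraction_rel N V `` {(p, q)}"

definition function_field :: "nat \<Rightarrow> (nat \<Rightarrow> complex) set \<Rightarrow> ratfun ring" where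
  "function_field N V =
    \<lparr>carrier = fractions N V // fraction_rel N V,
     monoid.mult = (\<lambda>r s. \<Union>(p, q)\<in>r. \<Union>(p', q')\<in>s. mk_frac N V (p * p') (q * q')),
     one = mk_frac N V 1 1,
     ring.zero = mk_frac N V 0 1,
     ring.add = (\<lambda>r s. \<Union>(p, q)\<in>r. \<Union>(p', q')\<in>s. mk_frac N V (p * q' + p' * q) (q * q'))\<rparr>"

definition const_fun :: "nat \<Rightarrow> (nat \<Rightarrow> complex) set \<Rightarrow> complex \<Rightarrow> ratfun" where
  "const_fun N V c = mk_frac N V (Poly_Mapping.single 0 c) 1"

definition regular_at :: "ratfun \<Rightarrow> (nat \<Rightarrow> complex) \<Rightarrow> bool" where
  "regular_at r x \<longleftrightarrow> (\<exists>(p, q)\<in>r. eval_poly q x \<noteq> 0)"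

definition value_at :: "ratfun \<Rightarrow> (nat \<Rightarrow> complex) \<Rightarrow> complex" where
  "value_at r x = (THE w. \<exists>(p, q)\<in>r. eval_poly q x \<noteq> 0 \<and> w = eval_poly p x / eval_poly q x)"

definition mobius_fun :: "nat \<Rightarrow> (nat \<Rightarrow> complex) set \<Rightarrow> real^2^2 \<Rightarrow> ratfun \<Rightarrow> ratfun" where
  "mobius_fun N V A t =
    (let K = function_field N V; c = (\<lambda>a. const_fun N V (of_real a)) in
      (c (A$1$1) \<otimes>\<^bsub>K\<^esub> t \<oplus>\<^bsub>K\<^esub> c (A$1$2)) \<otimes>\<^bsub>K\<^esub> inv\<^bsub>K\<^esub> (c (A$2$1) \<otimes>\<^bsub>K\<^esub> t \<oplus>\<^bsub>K\<^esub> c (A$2$2)))"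


section \<open>The Ax-Lindemann-Weierstrass property\<close>

definition geodesically_independent ::
    "(real^2^2) set set \<Rightarrow> nat \<Rightarrow> (nat \<Rightarrow> complex) set \<Rightarrow> nat \<Rightarrow> (nat \<Rightarrow> ratfun) \<Rightarrow> bool" where
  "geodesically_independent \<Gamma> N V n t \<longleftrightarrow>
     (\<forall>i<n. t i \<in> carrier (function_field N V) \<and> t i \<notin> range (const_fun N V)) \<and>
     (\<forall>i<n. \<forall>j<n. i \<noteq> j \<longrightarrow> \<not> (\<exists>g\<in>commensurator \<Gamma>. \<exists>A\<in>g. t i = mobius_fun N V A (t j)))"

text \<open>Algebraic independence over $C(V)$ of a family \<open>f\<close> of functions on \<open>V\<close> near \<open>P\<close>: no nonzero
  polynomial over $C(V)$ in indeterminates indexed by \<open>I\<close> becomes identically zero near \<open>P\<close> when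
  \<open>f\<close> is substituted.  \<open>D\<close> is the set of points where the \<open>f i\<close> are defined; a relation is
  only tested where it makes sense, i.e. at points of \<open>D\<close> where the coefficients are regular.\<close>

definition alg_independent_near ::
    "nat \<Rightarrow> (nat \<Rightarrow> complex) set \<Rightarrow> (nat \<Rightarrow> complex) \<Rightarrow> (nat \<Rightarrow> complex) set \<Rightarrow>
     'i set \<Rightarrow> ('i \<Rightarrow> (nat \<Rightarrow> complex) \<Rightarrow> complex) \<Rightarrow> bool" where
  "alg_independent_near N V P D I f \<longleftrightarrow>
    (let K = function_field N V in
      \<not> (\<exists>p \<in> ring.indexed_pset K I (carrier K). p \<noteq> ring.indexed_const K \<zero>\<^bsub>K\<^esub> \<and>
          (\<exists>U. openin (top_of_set V) U \<and> P \<in> U \<and>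
            (\<forall>Q \<in> U \<inter> D. (\<forall>m. regular_at (p m) Q) \<longrightarrow>
              (\<Sum>m | p m \<noteq> \<zero>\<^bsub>K\<^esub>. value_at (p m) Q * (\<Prod>i\<in>#m. f i Q)) = 0))))"

text \<open>The family consists of the functions $j(t_i), j'(t_i), j''(t_i)$, indexed by pairs
  \<open>(i, k)\<close> with \<open>k < 3\<close> the order of the derivative; it is undefined where \<open>t i\<close> hits a pole
  of \<open>j\<close>.  The parameter \<open>j\<close> is the uniformizing function chosen for \<open>\<Gamma>\<close>.\<close>

definition ax_lindemann_weierstrass ::
    "(real^2^2) set set \<Rightarrow> (complex \<Rightarrow> complex) \<Rightarrow> bool" where
  "ax_lindemann_weierstrass \<Gamma> j \<longleftrightarrow>
    (\<forall>N V n t P.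
      irreducible_variety N V \<and> geodesically_independent \<Gamma> N V n t \<and>
      P \<in> V \<and> (\<forall>i<n. regular_at (t i) P \<and> value_at (t i) P \<in> upper_half_plane) \<longrightarrow>
      alg_independent_near N V P
        {Q \<in> V. \<forall>i<n. regular_at (t i) Q \<and> value_at (t i) Q \<in> upper_half_plane \<and>
                       \<not> is_pole j (value_at (t i) Q)}
        ({..<n} \<times> {..<3::nat})
        (\<lambda>(i, k) Q. (deriv ^^ k) j (value_at (t i) Q)))"

end

theory Submission
  imports Defs
begin

text \<open>The commensurators of \<open>\<Gamma>\<close> and \<open>\<Gamma>\<^sub>1\<close> agree, so geodesic independence means the same for both groups.
  The functions \<open>j\<close> and \<open>j\<^sub>1\<close> are automorphic for \<open>\<Gamma>\<^sub>1\<close>, hence algebraically dependent over the complex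
  numbers: among the polynomials in \<open>j, j\<^sub>1\<close> of bidegree at most \<open>(m, m)\<close> there are, for large \<open>m\<close>, more
  coefficients than conditions for the poles in a fundamental domain to cancel, and what remains is a
  holomorphic function attaining its maximum.  Differentiating a relation \<open>F(j, j\<^sub>1) = 0\<close> twice makes the
  derivatives of \<open>j\<close> and of \<open>j\<^sub>1\<close> algebraic over one another.  A relation over the function field among the
  \<open>j(t\<^sub>i), j'(t\<^sub>i), j''(t\<^sub>i)\<close> can therefore be exchanged, one index \<open>i\<close> at a time, for one among the
  \<open>j\<^sub>1(t\<^sub>i), j\<^sub>1'(t\<^sub>i), j\<^sub>1''(t\<^sub>i)\<close>.  That the new relation is nonzero is checked at the generic jet
  \<open>f(z), a f'(z), a\<^sup>2 f''(z) + b f'(z)\<close> with \<open>a\<close> and \<open>b\<close> free, which needs no independence of the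
  derivatives of automorphic functions; that it holds on the variety is a pointwise consequence of
  polynomial identities, which needs no local geometry of the variety.\<close>

section \<open>Commensurators\<close>

text \<open>Eliminating \<open>j\<close> from a relation might produce the zero relation, and
  excluding this at the actual functions would require the independence of j, j', j''. The remedy is
  to reparametrise. Along a curve through z with derivatives a, b the chain rule gives the jet f, a
  f', a^2 f'' + b f', and differentiating F(f, g) = 0 expresses it through the same kind of jet of g
  by formulas in which a and b do not appear separately. Where f' is nonzero, a and b can be solved
  for arbitrary last two slots, so a nonzero polynomial stays nonzero; (a, b) = (1, 0) gives back
  the functions of the theorem. Independence is tested only at points of V where the coefficients
  are regular and no t_i hits a pole of \<open>j\<close>, and V may be singular at P. Relations are
  therefore kept as polynomial functions on V times an affine space and evaluated at points, and
  every side condition becomes a factor that vanishes where the given relation says nothing: the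
  denominators of the coefficients, and the leading coefficient of F, which is zero where the first
  function has a pole and the second has none.\<close>

lemma (in group) cover_of_finite_index:
  assumes "subgroup H G" "finite_index_subgroup G K H"
  shows "subgroup K G" "K \<subseteq> H" "\<exists>R. finite R \<and> R \<subseteq> H \<and> H \<subseteq> K <#> R"
proof -
  interpret H: group "G\<lparr>carrier := H\<rparr>" using assms(1) by (rule subgroup_imp_group)
  have KH: "subgroup K (G\<lparr>carrier := H\<rparr>)" and fin: "finite (rcosets\<^bsub>G\<lparr>carrier := H\<rparr>\<^esub> K)"
    using assms(2) by (auto simp: finite_index_subgroup_def)
  show "subgroup K G" using incl_subgroup[OF assms(1) KH] .
  show "K \<subseteq> H" using subgroup.subset[OF KH] by simp
  have "\<forall>C \<in> rcosets\<^bsub>G\<lparr>carrier := H\<rparr>\<^esub> K. \<exists>r\<in>H. C = K #> r"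
    by (auto simp: RCOSETS_def r_coset_def)
  then obtain r where r: "\<And>C. C \<in> rcosets\<^bsub>G\<lparr>carrier := H\<rparr>\<^esub> K \<Longrightarrow> r C \<in> H \<and> C = K #> r C" by metis
  define R where "R = r ` (rcosets\<^bsub>G\<lparr>carrier := H\<rparr>\<^esub> K)"
  have "h \<in> K <#> R" if h: "h \<in> H" for h
  proof -
    let ?C = "K #> h"
    have C: "?C \<in> rcosets\<^bsub>G\<lparr>carrier := H\<rparr>\<^esub> K" using h by (auto simp: RCOSETS_def r_coset_def)
    have "h \<in> ?C" using h subgroup.one_closed[OF \<open>subgroup K G\<close>] subgroup.subset[OF assms(1)]
      by (force simp: r_coset_def)
    then have "h \<in> K #> r ?C" using r[OF C] by simp
    then show ?thesis using C by (auto simp: R_def r_coset_def set_mult_def)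
  qed
  moreover have "R \<subseteq> H" using r by (auto simp: R_def)
  moreover have "finite R" using fin by (simp add: R_def)
  ultimately show "\<exists>R. finite R \<and> R \<subseteq> H \<and> H \<subseteq> K <#> R" by blast
qed

text \<open>Finite index is handled through a finite set R with H contained in K R. Unlike the set
  of cosets, such a cover does not refer to a modified carrier, and covers can be multiplied,
  intersected and conjugated.\<close>

lemma (in group) finite_index_of_cover:
  assumes "subgroup H G" "subgroup K G" "K \<subseteq> H" "finite R" "R \<subseteq> carrier G" "H \<subseteq> K <#> R"
  shows "finite_index_subgroup G K H"
  unfolding finite_index_subgroup_def
proof
  show "subgroup K (G\<lparr>carrier := H\<rparr>)" using assms subgroup_incl by blast
  have "rcosets\<^bsub>G\<lparr>carrier := H\<rparr>\<^esub> K \<subseteq> (\<lambda>r. K #> r) ` R"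
  proof
    fix C assume "C \<in> rcosets\<^bsub>G\<lparr>carrier := H\<rparr>\<^esub> K"
    then obtain h where h: "h \<in> H" "C = K #> h" by (auto simp: RCOSETS_def r_coset_def)
    then obtain k r where kr: "k \<in> K" "r \<in> R" "h = k \<otimes> r" using assms(6) by (auto simp: set_mult_def)
    then have "h \<in> K #> r" by (auto simp: r_coset_def)
    then have "K #> r = K #> h" using repr_independence assms kr by blast
    with h kr show "C \<in> (\<lambda>r. K #> r) ` R" by blast
  qed
  then show "finite (rcosets\<^bsub>G\<lparr>carrier := H\<rparr>\<^esub> K)" using assms(4) finite_surj by blast
qed

text \<open>Representatives multiply: H inside K R and L inside H S give L inside K (R S).\<close>

lemma (in group) finite_index_trans:
  assumes "subgroup L G" "subgroup H G" "finite_index_subgroup G K H" "finite_index_subgroup G H L"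
  shows "finite_index_subgroup G K L"
proof -
  note K = cover_of_finite_index[OF assms(2,3)] and H = cover_of_finite_index[OF assms(1,4)]
  obtain R S where R: "finite R" "R \<subseteq> H" "H \<subseteq> K <#> R" and S: "finite S" "S \<subseteq> L" "L \<subseteq> H <#> S"
    using K(3) H(3) by blast
  have c: "K \<subseteq> carrier G" "R \<subseteq> carrier G" "S \<subseteq> carrier G"
    using subgroup.subset[OF K(1)] subgroup.subset[OF H(1)] subgroup.subset[OF assms(1)] R S by auto
  have "H <#> S \<subseteq> (K <#> R) <#> S" using R(3) by (rule mono_set_mult) simp
  then have *: "L \<subseteq> K <#> (R <#> S)" using S(3) c by (simp add: set_mult_assoc)
  have "R <#> S = (\<lambda>(r, s). r \<otimes> s) ` (R \<times> S)" by (auto simp: set_mult_def)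
  then have f: "finite (R <#> S)" using R(1) S(1) by simp
  have "R <#> S \<subseteq> carrier G" using c by (auto simp: set_mult_def)
  with finite_index_of_cover[OF assms(1) K(1) _ f _ *] K(2) H(2) show ?thesis by blast
qed

text \<open>Representatives of K in H may lie outside L. Each coset that meets H \<inter> L gets a
  new representative there; two elements of H \<inter> L in one coset differ by an element of K that
  is also in L.\<close>

lemma (in group) finite_index_Int:
  assumes "subgroup H G" "subgroup L G" "finite_index_subgroup G K H"
  shows "finite_index_subgroup G (K \<inter> L) (H \<inter> L)"
proof -
  note K = cover_of_finite_index[OF assms(1,3)]
  obtain R where R: "finite R" "R \<subseteq> H" "H \<subseteq> K <#> R" using K(3) by blast
  have c: "K \<subseteq> carrier G" "H \<subseteq> carrier G"
    using subgroup.subset[OF K(1)] subgroup.subset[OF assms(1)] by auto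
  define S where "S = {r \<in> R. (K #> r) \<inter> (H \<inter> L) \<noteq> {}}"
  have "\<forall>r\<in>S. \<exists>s. s \<in> (K #> r) \<inter> (H \<inter> L)" by (auto simp: S_def)
  then obtain s where s: "\<And>r. r \<in> S \<Longrightarrow> s r \<in> (K #> r) \<inter> (H \<inter> L)" by metis
  have "x \<in> (K \<inter> L) <#> (s ` S)" if x: "x \<in> H \<inter> L" for x
  proof -
    obtain k r where kr: "k \<in> K" "r \<in> R" "x = k \<otimes> r" using x R(3) by (auto simp: set_mult_def)
    then have "x \<in> (K #> r) \<inter> (H \<inter> L)" using x by (auto simp: r_coset_def)
    then have rS: "r \<in> S" using kr by (auto simp: S_def)
    then obtain k' where k': "k' \<in> K" "s r = k' \<otimes> r" "s r \<in> H" "s r \<in> L"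
      using s[OF rS] by (auto simp: r_coset_def)
    have cc: "k \<in> carrier G" "k' \<in> carrier G" "r \<in> carrier G" using kr k' c R by auto
    have e: "x \<otimes> inv (s r) = k \<otimes> inv k'"
      using cc by (simp add: kr k' inv_mult_group m_assoc) (simp add: m_assoc[symmetric])
    have "k \<otimes> inv k' \<in> K"
      using kr k' K(1) by (simp add: subgroup.m_closed subgroup.m_inv_closed)
    moreover have "x \<otimes> inv (s r) \<in> L"
      using x k' assms(2) by (simp add: subgroup.m_closed subgroup.m_inv_closed)
    moreover have "x = (x \<otimes> inv (s r)) \<otimes> s r"
      using x k' c by (auto simp: m_assoc subset_iff)
    ultimately show ?thesis using rS e by (auto simp: set_mult_def)
  qed
  moreover have "s ` S \<subseteq> carrier G" using s c by blast
  moreover have "finite (s ` S)" using R(1) by (simp add: S_def)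
  ultimately show ?thesis
    using finite_index_of_cover[of "H \<inter> L" "K \<inter> L" "s ` S"] K assms
    by (blast intro: subgroups_Inter_pair)
qed

text \<open>Intersecting with H turns the finite index of K in L into that of K in H;
  representatives for K also serve for the larger group H.\<close>

lemma (in group) finite_index_intermediate:
  assumes "subgroup L G" "subgroup H G" "K \<subseteq> H" "H \<subseteq> L" "finite_index_subgroup G K L"
  shows "finite_index_subgroup G K H" "finite_index_subgroup G H L"
proof -
  note K = cover_of_finite_index[OF assms(1,5)]
  obtain R where R: "finite R" "R \<subseteq> L" "L \<subseteq> K <#> R" using K(3) by blast
  have "finite_index_subgroup G (K \<inter> H) (L \<inter> H)" using finite_index_Int assms by blast
  then show "finite_index_subgroup G K H" using assms by (simp add: Int_absorb1 Int_absorb2)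
  have "R \<subseteq> carrier G" using R subgroup.subset[OF assms(1)] by auto
  moreover have "L \<subseteq> H <#> R" using R(3) mono_set_mult[OF assms(3) order.refl] by (rule order.trans)
  ultimately show "finite_index_subgroup G H L" using finite_index_of_cover assms R(1) by blast
qed

lemma (in group) subgroup_conjugate:
  assumes "subgroup H G" "g \<in> carrier G"
  shows "subgroup ((\<lambda>x. g \<otimes> x \<otimes> inv g) ` H) G"
proof -
  interpret H: subgroup H G by (rule assms(1))
  show ?thesis
  proof (rule subgroupI)
    show "(\<lambda>x. g \<otimes> x \<otimes> inv g) ` H \<noteq> {}" using H.one_closed by blast
  next
    fix a assume "a \<in> (\<lambda>x. g \<otimes> x \<otimes> inv g) ` H"
    then obtain x where "x \<in> H" "a = g \<otimes> x \<otimes> inv g" by blast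
    then have "inv a = g \<otimes> inv x \<otimes> inv g" "inv x \<in> H"
      using assms(2) by (simp_all add: inv_mult_group m_assoc)
    then show "inv a \<in> (\<lambda>x. g \<otimes> x \<otimes> inv g) ` H" by blast
  next
    fix a b assume "a \<in> (\<lambda>x. g \<otimes> x \<otimes> inv g) ` H" "b \<in> (\<lambda>x. g \<otimes> x \<otimes> inv g) ` H"
    then obtain x y where xy: "x \<in> H" "y \<in> H" "a = g \<otimes> x \<otimes> inv g" "b = g \<otimes> y \<otimes> inv g" by blast
    have "inv g \<otimes> (g \<otimes> (y \<otimes> inv g)) = y \<otimes> inv g"
      using xy assms(2) by (simp add: m_assoc[symmetric])
    then have "a \<otimes> b = g \<otimes> (x \<otimes> y) \<otimes> inv g"
      using xy assms(2) by (simp add: m_assoc)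
    then show "a \<otimes> b \<in> (\<lambda>x. g \<otimes> x \<otimes> inv g) ` H" using xy by blast
  qed (use assms(2) in auto)
qed

lemma (in group) conjugate_eq:
  "r_coset G (l_coset G g M) (inv g) = (\<lambda>x. g \<otimes> x \<otimes> inv g) ` M"
  by (auto simp: l_coset_def r_coset_def)

lemma (in group) finite_index_conjugate:
  assumes "subgroup H G" "finite_index_subgroup G K H" "g \<in> carrier G"
  shows "finite_index_subgroup G ((\<lambda>x. g \<otimes> x \<otimes> inv g) ` K) ((\<lambda>x. g \<otimes> x \<otimes> inv g) ` H)"
    (is "finite_index_subgroup G (?c ` K) _")
proof -
  note K = cover_of_finite_index[OF assms(1,2)]
  obtain R where R: "finite R" "R \<subseteq> H" "H \<subseteq> K <#> R" using K(3) by blast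
  have c: "K \<subseteq> carrier G" "H \<subseteq> carrier G" 
    using subgroup.subset[OF K(1)] subgroup.subset[OF assms(1)] by auto
  have "?c ` H \<subseteq> ?c ` K <#> ?c ` R"
  proof
    fix x assume "x \<in> ?c ` H"
    then obtain h where h: "h \<in> H" "x = g \<otimes> h \<otimes> inv g" by blast
    then obtain k r where kr: "k \<in> K" "r \<in> R" "h = k \<otimes> r" using R by (auto simp: set_mult_def)
    have cc: "k \<in> carrier G" "r \<in> carrier G" using kr c R by auto
    have "inv g \<otimes> (g \<otimes> (r \<otimes> inv g)) = r \<otimes> inv g"
      using cc assms(3) by (simp add: m_assoc[symmetric])
    then have "x = ?c k \<otimes> ?c r"
      using cc assms(3) by (simp add: h kr m_assoc)
    with kr show "x \<in> ?c ` K <#> ?c ` R" by (auto simp: set_mult_def)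
  qed
  moreover have "?c ` R \<subseteq> carrier G" using c R assms(3) by auto
  moreover have "subgroup (?c ` M) G" if "subgroup M G" for M
    using subgroup_conjugate that assms(3) .
  ultimately show ?thesis
    using finite_index_of_cover[of "?c ` H" "?c ` K" "?c ` R"] K assms R by (simp add: image_mono)
qed

text \<open>Let C be the conjugate of \<Gamma> and C1 that of \<open>\<Gamma>\<^sub>1\<close>. Then
  C1 \<inter> \<open>\<Gamma>\<^sub>1\<close> has finite index in C \<inter> \<Gamma>, so each
  condition passes from one group to the other by transitivity and by comparison with intermediate
  groups.\<close>

lemma commensurator_finite_index:
  assumes \<Gamma>: "subgroup \<Gamma> PSL2R" and fi: "finite_index_subgroup PSL2R \<Gamma>\<^sub>1 \<Gamma>"
  shows "commensurator \<Gamma>\<^sub>1 = commensurator \<Gamma>"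
proof -
  interpret group PSL2R by (rule group_PSL2R)
  note G1 = cover_of_finite_index(1,2)[OF \<Gamma> fi]
  have "finite_index_subgroup PSL2R (C1 \<inter> \<Gamma>\<^sub>1) C1 \<and> finite_index_subgroup PSL2R (C1 \<inter> \<Gamma>\<^sub>1) \<Gamma>\<^sub>1 \<longleftrightarrow>
        finite_index_subgroup PSL2R (C \<inter> \<Gamma>) C \<and> finite_index_subgroup PSL2R (C \<inter> \<Gamma>) \<Gamma>"
    if C: "subgroup C PSL2R" and C1: "finite_index_subgroup PSL2R C1 C" for C C1
  proof -
    note c = cover_of_finite_index(1,2)[OF C C1]
    have s: "subgroup (C \<inter> \<Gamma>) PSL2R" "subgroup (C1 \<inter> \<Gamma>) PSL2R" "subgroup (C1 \<inter> \<Gamma>\<^sub>1) PSL2R"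
      using C c \<Gamma> G1 by (auto intro: subgroups_Inter_pair)
    have 1: "finite_index_subgroup PSL2R (C1 \<inter> \<Gamma>\<^sub>1) (C \<inter> \<Gamma>)"
    proof (rule finite_index_trans[OF s(1,2)])
      show "finite_index_subgroup PSL2R (C1 \<inter> \<Gamma>) (C \<inter> \<Gamma>)" using finite_index_Int C \<Gamma> C1 by blast
      show "finite_index_subgroup PSL2R (C1 \<inter> \<Gamma>\<^sub>1) (C1 \<inter> \<Gamma>)"
        using finite_index_Int[OF \<Gamma> c(1) fi] by (simp add: Int_commute)
    qed
    show ?thesis
    proof safe
      assume a: "finite_index_subgroup PSL2R (C1 \<inter> \<Gamma>\<^sub>1) C1" "finite_index_subgroup PSL2R (C1 \<inter> \<Gamma>\<^sub>1) \<Gamma>\<^sub>1"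
      have "finite_index_subgroup PSL2R (C1 \<inter> \<Gamma>\<^sub>1) C" "finite_index_subgroup PSL2R (C1 \<inter> \<Gamma>\<^sub>1) \<Gamma>"
        using finite_index_trans a C \<Gamma> c G1 C1 fi by blast+
      then show "finite_index_subgroup PSL2R (C \<inter> \<Gamma>) C" "finite_index_subgroup PSL2R (C \<inter> \<Gamma>) \<Gamma>"
        using finite_index_intermediate(2)[of _ "C \<inter> \<Gamma>" "C1 \<inter> \<Gamma>\<^sub>1"] C \<Gamma> s c G1 by blast+
    next
      assume a: "finite_index_subgroup PSL2R (C \<inter> \<Gamma>) C" "finite_index_subgroup PSL2R (C \<inter> \<Gamma>) \<Gamma>"
      have "finite_index_subgroup PSL2R (C1 \<inter> \<Gamma>\<^sub>1) C" "finite_index_subgroup PSL2R (C1 \<inter> \<Gamma>\<^sub>1) \<Gamma>"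
        using finite_index_trans[OF _ s(1) 1] a C \<Gamma> by blast+
      then show "finite_index_subgroup PSL2R (C1 \<inter> \<Gamma>\<^sub>1) C1" "finite_index_subgroup PSL2R (C1 \<inter> \<Gamma>\<^sub>1) \<Gamma>\<^sub>1"
        using finite_index_intermediate(1)[of _ _ "C1 \<inter> \<Gamma>\<^sub>1"] C \<Gamma> c G1 by blast+
    qed
  qed
  moreover have "subgroup (r_coset PSL2R (l_coset PSL2R g \<Gamma>) (inv\<^bsub>PSL2R\<^esub> g)) PSL2R" if "g \<in> carrier PSL2R" for g
    using subgroup_conjugate that \<Gamma> by (simp add: conjugate_eq)
  ultimately show ?thesis
    unfolding commensurator_def Let_def conjugate_eq using finite_index_conjugate[OF \<Gamma> fi] by blast
qed

section \<open>Algebraic elimination\<close>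

text \<open>A ring of functions in which vanishing is tested only on S; the last axiom is the
  absence of zero divisors modulo vanishing on S. Instances are polynomial functions on a variety,
  functions of generic jets, and complex numbers as functions on a single point.\<close>

locale function_domain =
  fixes S :: "'p set" and T :: "('p \<Rightarrow> complex) set"
  assumes const_in: "(\<lambda>_. c) \<in> T"
    and add_in: "f \<in> T \<Longrightarrow> g \<in> T \<Longrightarrow> (\<lambda>x. f x + g x) \<in> T"
    and mult_in: "f \<in> T \<Longrightarrow> g \<in> T \<Longrightarrow> (\<lambda>x. f x * g x) \<in> T"
    and common_nonzero: "f \<in> T \<Longrightarrow> g \<in> T \<Longrightarrow> \<exists>x\<in>S. f x \<noteq> 0 \<Longrightarrow> \<exists>x\<in>S. g x \<noteq> 0 \<Longrightarrow> \<exists>x\<in>S. f x \<noteq> 0 \<and> g x \<noteq> 0"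
begin

lemma uminus_in: "f \<in> T \<Longrightarrow> (\<lambda>x. - f x) \<in> T"
  using mult_in[OF const_in[of "-1"], of f] by simp

lemma sum_in: "(\<And>a. a \<in> A \<Longrightarrow> f a \<in> T) \<Longrightarrow> (\<lambda>x. \<Sum>a\<in>A. f a x) \<in> T"
  by (induction A rule: infinite_finite_induct) (auto intro: const_in add_in)

lemma power_in: "f \<in> T \<Longrightarrow> (\<lambda>x. f x ^ n) \<in> T"
  by (induction n) (auto intro: const_in mult_in)

text \<open>Gaussian elimination without division.\<close>

lemma linear_dependence:
  assumes "finite E" "finite A" "card E < card A"
    and "\<And>a e. a \<in> A \<Longrightarrow> e \<in> E \<Longrightarrow> v a e \<in> T" and "S \<noteq> {}"
  shows "\<exists>c. (\<forall>a\<in>A. c a \<in> T) \<and> (\<exists>a\<in>A. \<exists>x\<in>S. c a x \<noteq> 0) \<and>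
    (\<forall>e\<in>E. \<forall>x\<in>S. (\<Sum>a\<in>A. c a x * v a e x) = 0)"
  using assms(1-4)
proof (induction E arbitrary: A v)
  case empty
  then have "A \<noteq> {}" by auto
  with \<open>S \<noteq> {}\<close> show ?case by (intro exI[of _ "\<lambda>_ _. 1"]) (auto intro: const_in)
next
  case (insert e E)
  show ?case
  proof (cases "\<exists>a\<in>A. \<exists>x\<in>S. v a e x \<noteq> 0")
    case False
    have "card E < card A" using insert by simp
    then obtain c where c: "\<forall>a\<in>A. c a \<in> T" "\<exists>a\<in>A. \<exists>x\<in>S. c a x \<noteq> 0"
      "\<forall>e\<in>E. \<forall>x\<in>S. (\<Sum>a\<in>A. c a x * v a e x) = 0"
      using insert.IH[of A v] insert.prems by blast
    with False show ?thesis by (intro exI[of _ c]) auto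
  next
    case True
    then obtain p where p: "p \<in> A" "\<exists>x\<in>S. v p e x \<noteq> 0" by blast
    \<comment> \<open>The vector a minus a multiple of the pivot vector p, scaled by the pivot entry
      so that no division occurs. Its entry at e is zero.\<close>
    let ?w = "\<lambda>a e' x. v p e x * v a e' x + - (v a e x * v p e' x)"
    have "card E < card (A - {p})" using insert p by simp
    moreover have "?w a e' \<in> T" if "a \<in> A - {p}" "e' \<in> E" for a e'
      using that p insert.prems by (intro add_in uminus_in mult_in) auto
    ultimately obtain c where c: "\<forall>a\<in>A - {p}. c a \<in> T" "\<exists>a\<in>A - {p}. \<exists>x\<in>S. c a x \<noteq> 0"
      "\<forall>e'\<in>E. \<forall>x\<in>S. (\<Sum>a\<in>A - {p}. c a x * ?w a e' x) = 0"
      using insert.IH[of "A - {p}" ?w] insert.prems by auto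
    \<comment> \<open>The coefficient of the pivot is forced by the equation at e. The others are
      multiplied by the pivot entry and stay nonzero because there are no zero divisors.\<close>
    define c' where "c' a = (if a = p then (\<lambda>x. - (\<Sum>a\<in>A - {p}. c a x * v a e x)) else (\<lambda>x. v p e x * c a x))" for a
    have "c' a \<in> T" if "a \<in> A" for a
      using that c insert.prems p by (auto simp: c'_def intro!: uminus_in sum_in mult_in)
    moreover have "\<exists>a\<in>A. \<exists>x\<in>S. c' a x \<noteq> 0"
    proof -
      obtain a where a: "a \<in> A - {p}" "\<exists>x\<in>S. c a x \<noteq> 0" using c by blast
      then obtain x where "x \<in> S" "v p e x \<noteq> 0" "c a x \<noteq> 0"
        using common_nonzero[OF _ _ p(2), of "c a"] c insert.prems p by blast
      with a show ?thesis by (intro bexI[of _ a] bexI[of _ x]) (auto simp: c'_def)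
    qed
    moreover have "(\<Sum>a\<in>A. c' a x * v a e' x) = 0" if "e' \<in> insert e E" "x \<in> S" for e' x
    proof -
      have "(\<Sum>a\<in>A. c' a x * v a e' x) = c' p x * v p e' x + (\<Sum>a\<in>A - {p}. c' a x * v a e' x)"
        using insert.prems p by (simp add: sum.remove)
      also have "(\<Sum>a\<in>A - {p}. c' a x * v a e' x) = (\<Sum>a\<in>A - {p}. v p e x * c a x * v a e' x)"
        by (rule sum.cong) (auto simp: c'_def)
      also have "c' p x * v p e' x + \<dots> = (\<Sum>a\<in>A - {p}. c a x * ?w a e' x)"
        by (simp add: c'_def sum_distrib_right sum_distrib_left sum_negf sum.distrib sum_subtractf algebra_simps)
      finally show ?thesis using c(3) that by (cases "e' = e") (auto simp: algebra_simps)
    qed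
    ultimately show ?thesis by blast
  qed
qed

end

section \<open>Polynomial functions and bivariate polynomials\<close>

inductive_set polyfun :: "(('v \<Rightarrow> complex) \<Rightarrow> complex) set" where
  const: "(\<lambda>_. c) \<in> polyfun"
| var: "(\<lambda>\<rho>. \<rho> v) \<in> polyfun"
| add: "f \<in> polyfun \<Longrightarrow> g \<in> polyfun \<Longrightarrow> (\<lambda>\<rho>. f \<rho> + g \<rho>) \<in> polyfun"
| mult: "f \<in> polyfun \<Longrightarrow> g \<in> polyfun \<Longrightarrow> (\<lambda>\<rho>. f \<rho> * g \<rho>) \<in> polyfun"

lemma polyfun_sum: "(\<And>a. a \<in> A \<Longrightarrow> f a \<in> polyfun) \<Longrightarrow> (\<lambda>\<rho>. \<Sum>a\<in>A. f a \<rho>) \<in> polyfun"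
  by (induction A rule: infinite_finite_induct) (auto intro: polyfun.intros)

lemma polyfun_prod: "(\<And>a. a \<in> A \<Longrightarrow> f a \<in> polyfun) \<Longrightarrow> (\<lambda>\<rho>. \<Prod>a\<in>A. f a \<rho>) \<in> polyfun"
  by (induction A rule: infinite_finite_induct) (auto intro: polyfun.intros)

lemma polyfun_power: "f \<in> polyfun \<Longrightarrow> (\<lambda>\<rho>. f \<rho> ^ n) \<in> polyfun"
  by (induction n) (auto intro: polyfun.intros)

lemma polyfun_uminus: "f \<in> polyfun \<Longrightarrow> (\<lambda>\<rho>. - f \<rho>) \<in> polyfun"
  using polyfun.mult[OF polyfun.const[of "-1"], of f] by simp

lemma polyfun_diff: "f \<in> polyfun \<Longrightarrow> g \<in> polyfun \<Longrightarrow> (\<lambda>\<rho>. f \<rho> - g \<rho>) \<in> polyfun"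
  using polyfun.add[OF _ polyfun_uminus, of f g] by simp

lemma polyfun_poly: "f \<in> polyfun \<Longrightarrow> (\<lambda>\<rho>. poly p (f \<rho>)) \<in> polyfun"
  by (induction p) (auto intro: polyfun.intros)

text \<open>Restriction to a polynomial curve reduces nonvanishing in many variables to polynomials
  in one variable.\<close>

lemma polyfun_line:
  assumes "f \<in> polyfun" "\<And>v. \<exists>p. \<forall>s. \<sigma> s v = poly p s"
  shows "\<exists>p. \<forall>s. f (\<sigma> s) = poly p s"
  using assms(1)
proof induction
  case (const c)
  show ?case by (rule exI[of _ "[:c:]"]) simp
next
  case (add f g)
  then obtain p q where "\<forall>s. f (\<sigma> s) = poly p s" "\<forall>s. g (\<sigma> s) = poly q s" by blast
  then show ?case by (intro exI[of _ "p + q"]) simp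
next
  case (mult f g)
  then obtain p q where "\<forall>s. f (\<sigma> s) = poly p s" "\<forall>s. g (\<sigma> s) = poly q s" by blast
  then show ?case by (intro exI[of _ "p * q"]) simp
qed (rule assms)

lemma poly_common_nonzero:
  fixes p q :: "complex poly"
  assumes "poly p a \<noteq> 0" "poly q b \<noteq> 0"
  shows "\<exists>s. poly p s \<noteq> 0 \<and> poly q s \<noteq> 0"
proof -
  have "p * q \<noteq> 0" using assms by auto
  then have "\<exists>s. poly (p * q) s \<noteq> 0" by (metis poly_all_0_iff_0)
  then show ?thesis by auto
qed

text \<open>By the identity theorem, a g that vanishes on the nonempty open set where f is nonzero
  vanishes on all of S.\<close>

lemma holomorphic_common_nonzero:
  assumes "open S" "connected S" "f holomorphic_on S" "g holomorphic_on S"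
    and "\<exists>z\<in>S. f z \<noteq> 0" "\<exists>z\<in>S. g z \<noteq> 0"
  shows "\<exists>z\<in>S. f z \<noteq> 0 \<and> g z \<noteq> 0"
proof (rule ccontr)
  assume no: "\<not> ?thesis"
  obtain z0 where z0: "z0 \<in> S" "f z0 \<noteq> 0" using assms by blast
  define U where "U = {z\<in>S. f z \<noteq> 0}"
  have "continuous_on S f" using assms(3) holomorphic_on_imp_continuous_on by blast
  then have "open (S \<inter> f -` (- {0}))" using assms(1) by (intro continuous_open_preimage) auto
  moreover have "S \<inter> f -` (- {0}) = U" by (auto simp: U_def)
  ultimately have "open U" by simp
  have "g z = 0" if "z \<in> S" for z
    using analytic_continuation_open[of U S g "\<lambda>_. 0" z] \<open>open U\<close> assms that z0 no by (auto simp: U_def)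
  with assms show False by blast
qed

text \<open>Bivariate polynomials $F(x, y)$ are polynomials in $x$ with coefficients in $C[y]$.\<close>

definition eval2 :: "complex poly poly \<Rightarrow> complex \<Rightarrow> complex \<Rightarrow> complex" where
  "eval2 F x y = poly (poly F [:x:]) y"

text \<open>The outer variable is x, so \<open>pderiv\<close> is already the derivative in x; the
  one in y acts on the coefficients.\<close>

definition pderiv_y :: "complex poly poly \<Rightarrow> complex poly poly" where
  "pderiv_y F = map_poly pderiv F"

lemma eval2_pCons [simp]: "eval2 (pCons c F) x y = poly c y + x * eval2 F x y"
  and eval2_0 [simp]: "eval2 0 x y = 0"
  and eval2_add [simp]: "eval2 (F + G) x y = eval2 F x y + eval2 G x y"
  by (simp_all add: eval2_def)

lemma eval2_altdef: "eval2 F x y = (\<Sum>k\<le>Polynomial.degree F. poly (Polynomial.coeff F k) y * x ^ k)"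
proof -
  have "poly F [:x:] = (\<Sum>k\<le>Polynomial.degree F. Polynomial.coeff F k * [:x:] ^ k)"
    by (rule poly_altdef)
  then show ?thesis by (simp add: eval2_def poly_sum poly_power)
qed

lemma pderiv_y_simps [simp]: "pderiv_y 0 = 0" "pderiv_y (pCons c F) = pCons (pderiv c) (pderiv_y F)"
  by (simp_all add: pderiv_y_def map_poly_pCons)

lemma has_field_derivative_eval2:
  assumes "(f has_field_derivative f') (at z)" "(g has_field_derivative g') (at z)"
  shows "((\<lambda>z. eval2 F (f z) (g z)) has_field_derivative
    eval2 (pderiv F) (f z) (g z) * f' + eval2 (pderiv_y F) (f z) (g z) * g') (at z)"
proof (induction F)
  case (pCons c F)
  have "((\<lambda>z. poly c (g z)) has_field_derivative poly (pderiv c) (g z) * g') (at z)"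
    using DERIV_chain2[OF poly_DERIV assms(2)] .
  from DERIV_add[OF this DERIV_mult[OF assms(1) pCons.IH]]
  show ?case by (simp add: pderiv_pCons algebra_simps)
qed simp

text \<open>The product of V with an affine space: the slots \<open>Inl\<close> are the coordinates
  of a point of V, the slots \<open>Inr\<close> are free unknowns into which jets are
  substituted.\<close>

definition "points V = {\<rho>. (\<lambda>i. \<rho> (Inl i)) \<in> V}"

abbreviation "nonzero_on V h \<equiv> \<exists>\<rho>\<in>points V. h \<rho> \<noteq> 0"

lemma points_upd [simp]: "\<rho>(Inr v := c) \<in> points V \<longleftrightarrow> \<rho> \<in> points V"
  by (simp add: points_def)

text \<open>Irreducibility in the form in which elimination uses it: polynomial functions modulo
  vanishing on V have no zero divisors.\<close>

locale irreducible_points =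
  fixes V :: "(nat \<Rightarrow> complex) set"
  assumes nonempty: "V \<noteq> {}"
    and irred: "p \<in> polyfun \<Longrightarrow> q \<in> polyfun \<Longrightarrow> \<exists>x\<in>V. p x \<noteq> 0 \<Longrightarrow> \<exists>x\<in>V. q x \<noteq> 0 \<Longrightarrow>
      \<exists>x\<in>V. p x \<noteq> 0 \<and> q x \<noteq> 0"

text \<open>A point of the generic jet space consists of an assignment together with a point \<open>z\<close> of the
  domain of the functions and the first two derivatives \<open>a\<close>, \<open>b\<close> of a curve through \<open>z\<close>.\<close>

inductive_set jetfun :: "complex set \<Rightarrow> (('v \<Rightarrow> complex) \<times> complex \<times> complex \<times> complex \<Rightarrow> complex) set"
  for H :: "complex set" where
  const: "(\<lambda>_. c) \<in> jetfun H"
| var: "(\<lambda>(\<rho>, z, a, b). \<rho> v) \<in> jetfun H"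
| hol: "\<phi> holomorphic_on H \<Longrightarrow> (\<lambda>(\<rho>, z, a, b). \<phi> z) \<in> jetfun H"
| fst: "(\<lambda>(\<rho>, z, a, b). a) \<in> jetfun H"
| snd: "(\<lambda>(\<rho>, z, a, b). b) \<in> jetfun H"
| add: "f \<in> jetfun H \<Longrightarrow> g \<in> jetfun H \<Longrightarrow> (\<lambda>m. f m + g m) \<in> jetfun H"
| mult: "f \<in> jetfun H \<Longrightarrow> g \<in> jetfun H \<Longrightarrow> (\<lambda>m. f m * g m) \<in> jetfun H"

lemma jetfun_holomorphic: "r \<in> jetfun H \<Longrightarrow> (\<lambda>z. r (\<rho>, z, a, b)) holomorphic_on H"
  by (induction rule: jetfun.induct) (auto intro!: holomorphic_intros)

lemma jetfun_polyfun: "r \<in> jetfun H \<Longrightarrow> (\<lambda>x. r (case_sum x Y, z, a, b)) \<in> polyfun"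
proof (induction rule: jetfun.induct)
  case (var v)
  show ?case by (cases v) (auto intro: polyfun.intros)
qed (auto intro: polyfun.intros)

lemma jetfun_line:
  assumes "r \<in> jetfun H" "\<And>v. \<exists>p. \<forall>s. \<rho> s v = poly p s"
    "\<exists>p. \<forall>s. a s = poly p s" "\<exists>p. \<forall>s. b s = poly p s"
  shows "\<exists>p. \<forall>s. r (\<rho> s, z, a s, b s) = poly p s"
  using assms(1)
proof induction
  case (const c)
  show ?case by (rule exI[of _ "[:c:]"]) simp
next
  case (hol \<phi>)
  show ?case by (rule exI[of _ "[:\<phi> z:]"]) simp
next
  case (add f g)
  then obtain p q where "\<forall>s. f (\<rho> s, z, a s, b s) = poly p s" "\<forall>s. g (\<rho> s, z, a s, b s) = poly q s" by blast
  then show ?case by (intro exI[of _ "p + q"]) simp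
next
  case (mult f g)
  then obtain p q where "\<forall>s. f (\<rho> s, z, a s, b s) = poly p s" "\<forall>s. g (\<rho> s, z, a s, b s) = poly q s" by blast
  then show ?case by (intro exI[of _ "p * q"]) simp
qed (use assms in auto)

lemma jetfun_polyfun_compose:
  assumes "h \<in> polyfun" "\<And>v. (\<lambda>m. \<sigma> m v) \<in> jetfun H"
  shows "(\<lambda>m. h (\<sigma> m)) \<in> jetfun H"
  using assms(1) by induction (auto intro: jetfun.intros assms)

lemma poly_line: "\<exists>p. \<forall>s. u + s * (v - u) = poly p (s :: complex)"
  by (rule exI[of _ "[:u, v - u:]"]) simp

context irreducible_points
begin

text \<open>Two nonvanishing points are moved towards each other one group of coordinates at a time.\<close>

lemma function_domain_jetfun:
  assumes H: "open H" "connected H"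
  shows "function_domain {(\<rho>, z, a, b). \<rho> \<in> points V \<and> z \<in> H} (jetfun H :: (((nat + 'i) \<Rightarrow> complex) \<times> _ \<Rightarrow> _) set)"
    (is "function_domain ?M _")
proof
  fix r1 r2 :: "((nat + 'i) \<Rightarrow> complex) \<times> complex \<times> complex \<times> complex \<Rightarrow> complex"
  assume r: "r1 \<in> jetfun H" "r2 \<in> jetfun H"
  assume "\<exists>m\<in>?M. r1 m \<noteq> 0" "\<exists>m\<in>?M. r2 m \<noteq> 0"
  then obtain \<rho>1 z1 a1 b1 \<rho>2 z2 a2 b2 where
    m: "\<rho>1 \<in> points V" "z1 \<in> H" "r1 (\<rho>1, z1, a1, b1) \<noteq> 0" "\<rho>2 \<in> points V" "z2 \<in> H" "r2 (\<rho>2, z2, a2, b2) \<noteq> 0"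
    by auto
  define Y1 where "Y1 = (\<lambda>i. \<rho>1 (Inr i))"
  define Y2 where "Y2 = (\<lambda>i. \<rho>2 (Inr i))"
  have e: "\<rho>1 = case_sum (\<lambda>i. \<rho>1 (Inl i)) Y1" "\<rho>2 = case_sum (\<lambda>i. \<rho>2 (Inl i)) Y2"
    by (auto simp: Y1_def Y2_def fun_eq_iff split: sum.split)
  have "\<exists>x\<in>V. r1 (case_sum x Y1, z1, a1, b1) \<noteq> 0"
    using e(1) m(1,3) unfolding points_def by (intro bexI[of _ "\<lambda>i. \<rho>1 (Inl i)"]) auto
  moreover have "\<exists>x\<in>V. r2 (case_sum x Y2, z2, a2, b2) \<noteq> 0"
    using e(2) m(4,6) unfolding points_def by (intro bexI[of _ "\<lambda>i. \<rho>2 (Inl i)"]) auto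
  ultimately obtain x where x: "x \<in> V" "r1 (case_sum x Y1, z1, a1, b1) \<noteq> 0" "r2 (case_sum x Y2, z2, a2, b2) \<noteq> 0"
    using irred[OF jetfun_polyfun[OF r(1)] jetfun_polyfun[OF r(2)], of Y1 z1 a1 b1 Y2 z2 a2 b2] by blast
  obtain z where z: "z \<in> H" "r1 (case_sum x Y1, z, a1, b1) \<noteq> 0" "r2 (case_sum x Y2, z, a2, b2) \<noteq> 0"
    using holomorphic_common_nonzero[OF H jetfun_holomorphic[OF r(1)] jetfun_holomorphic[OF r(2)],
      of "case_sum x Y1" a1 b1 "case_sum x Y2" a2 b2] x m by blast
  \<comment> \<open>The unknowns and a, b run along the line through the two points; at s = 0 the
    function \<open>r1\<close> is nonzero, at s = 1 the function \<open>r2\<close>.\<close>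
  let ?\<rho> = "\<lambda>s. case_sum x (\<lambda>i. Y1 i + s * (Y2 i - Y1 i))" and ?a = "\<lambda>s. a1 + s * (a2 - a1)"
    and ?b = "\<lambda>s. b1 + s * (b2 - b1)"
  have l: "\<exists>p. \<forall>s. ?\<rho> s v = poly p s" for v
  proof (cases v)
    case (Inl i)
    then show ?thesis by (intro exI[of _ "[:x i:]"]) simp
  next
    case (Inr i)
    then show ?thesis using poly_line by simp
  qed
  obtain p1 p2 where p: "\<forall>s. r1 (?\<rho> s, z, ?a s, ?b s) = poly p1 s" "\<forall>s. r2 (?\<rho> s, z, ?a s, ?b s) = poly p2 s"
    using jetfun_line[OF r(1) l poly_line poly_line] jetfun_line[OF r(2) l poly_line poly_line] by meson
  have "poly p1 0 \<noteq> 0" "poly p2 1 \<noteq> 0" using p[THEN spec, of 0] p[THEN spec, of 1] z by simp_all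
  then obtain s where "poly p1 s \<noteq> 0" "poly p2 s \<noteq> 0" using poly_common_nonzero by blast
  then have "r1 (?\<rho> s, z, ?a s, ?b s) \<noteq> 0" "r2 (?\<rho> s, z, ?a s, ?b s) \<noteq> 0" using p by simp_all
  moreover have "?\<rho> s \<in> points V" using x by (simp add: points_def)
  ultimately show "\<exists>m\<in>?M. r1 m \<noteq> 0 \<and> r2 m \<noteq> 0" using z by (intro bexI[of _ "(?\<rho> s, z, ?a s, ?b s)"]) auto
qed (auto intro: jetfun.intros)

text \<open>Polynomial functions are functions of generic jets over the whole plane that ignore z, a
  and b.\<close>

lemma function_domain_polyfun:
  "function_domain (points V) (polyfun :: (((nat + 'i) \<Rightarrow> complex) \<Rightarrow> _) set)"
proof
  interpret jet: function_domain "{(\<rho>, z, a, b). \<rho> \<in> points V \<and> z \<in> UNIV}"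
      "jetfun UNIV :: (((nat + 'i) \<Rightarrow> complex) \<times> _ \<Rightarrow> _) set"
    by (rule function_domain_jetfun) auto
  fix f g :: "((nat + 'i) \<Rightarrow> complex) \<Rightarrow> complex"
  assume fg: "f \<in> polyfun" "g \<in> polyfun" and nz: "nonzero_on V f" "nonzero_on V g"
  have "(\<lambda>m. fst m v) \<in> jetfun UNIV" for v :: "nat + 'i"
    using jetfun.var[of v UNIV] by (simp add: case_prod_unfold)
  then have "(\<lambda>m. f (fst m)) \<in> jetfun UNIV" "(\<lambda>m. g (fst m)) \<in> jetfun UNIV"
    using jetfun_polyfun_compose fg by blast+
  from jet.common_nonzero[OF this] nz show "\<exists>\<rho>\<in>points V. f \<rho> \<noteq> 0 \<and> g \<rho> \<noteq> 0" by auto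
qed (auto intro: polyfun.intros)

end

text \<open>Polynomials in x modulo F, localised at the leading coefficient of F, with the value of
  slot v as second argument of F. The reduction to degree below that of F is stated pointwise at the
  roots x, so that x = f z can be inserted.\<close>

definition reducible_mod :: "complex poly poly \<Rightarrow> 'v \<Rightarrow> (('v \<Rightarrow> complex) \<Rightarrow> complex \<Rightarrow> complex) set" where
  "reducible_mod F v = {w. \<exists>D \<beta>. (\<forall>c. \<beta> c \<in> polyfun) \<and> (\<forall>\<rho> x. eval2 F x (\<rho> v) = 0 \<longrightarrow>
     poly (Polynomial.lead_coeff F) (\<rho> v) ^ D * w \<rho> x = (\<Sum>c<Polynomial.degree F. \<beta> c \<rho> * x ^ c))}"

context
  fixes F :: "complex poly poly" and v :: 'v and d l R
  assumes d: "Polynomial.degree F > 0"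
  defines "d \<equiv> Polynomial.degree F" and "l \<equiv> Polynomial.lead_coeff F" and "R \<equiv> reducible_mod F v"
begin

lemma reducible_modI:
  assumes "\<And>c. \<beta> c \<in> polyfun"
    and "\<And>\<rho> x. eval2 F x (\<rho> v) = 0 \<Longrightarrow> poly l (\<rho> v) ^ D * w \<rho> x = (\<Sum>c<d. \<beta> c \<rho> * x ^ c)"
  shows "w \<in> R"
  using assms unfolding R_def reducible_mod_def d_def l_def by blast

lemma reducible_modE:
  assumes "w \<in> R"
  obtains D \<beta> where "\<And>c. \<beta> c \<in> polyfun"
    "\<And>\<rho> x. eval2 F x (\<rho> v) = 0 \<Longrightarrow> poly l (\<rho> v) ^ D * w \<rho> x = (\<Sum>c<d. \<beta> c \<rho> * x ^ c)"
  using assms unfolding R_def reducible_mod_def d_def l_def by blast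

lemma d_pos: "0 < d"
  using d by (simp add: d_def)

lemma reducible_polyfun:
  assumes "p \<in> polyfun"
  shows "(\<lambda>\<rho> x. p \<rho>) \<in> R"
proof (rule reducible_modI[of "\<lambda>c. if c = 0 then p else (\<lambda>_. 0)" 0])
  show "(if c = 0 then p else (\<lambda>_. 0)) \<in> polyfun" for c :: nat
    using assms by (auto intro: polyfun.intros)
  fix \<rho> x
  have "(\<Sum>c<d. (if c = 0 then p else (\<lambda>_. 0)) \<rho> * x ^ c) = (\<Sum>c<d. if c = 0 then p \<rho> else 0)"
    by (rule sum.cong) auto
  then show "poly l (\<rho> v) ^ 0 * p \<rho> = (\<Sum>c<d. (if c = 0 then p else (\<lambda>_. 0)) \<rho> * x ^ c)"
    using d_pos by simp
qed

lemma reducible_add: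
  assumes "w1 \<in> R" "w2 \<in> R"
  shows "(\<lambda>\<rho> x. w1 \<rho> x + w2 \<rho> x) \<in> R"
proof -
  obtain D1 \<beta>1 where 1: "\<And>c. \<beta>1 c \<in> polyfun"
    "\<And>\<rho> x. eval2 F x (\<rho> v) = 0 \<Longrightarrow> poly l (\<rho> v) ^ D1 * w1 \<rho> x = (\<Sum>c<d. \<beta>1 c \<rho> * x ^ c)"
    using reducible_modE[OF assms(1)] by metis
  obtain D2 \<beta>2 where 2: "\<And>c. \<beta>2 c \<in> polyfun"
    "\<And>\<rho> x. eval2 F x (\<rho> v) = 0 \<Longrightarrow> poly l (\<rho> v) ^ D2 * w2 \<rho> x = (\<Sum>c<d. \<beta>2 c \<rho> * x ^ c)"
    using reducible_modE[OF assms(2)] by metis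
  show ?thesis
  proof (rule reducible_modI[of "\<lambda>c \<rho>. poly l (\<rho> v) ^ D2 * \<beta>1 c \<rho> + poly l (\<rho> v) ^ D1 * \<beta>2 c \<rho>" "D1 + D2"])
    show "(\<lambda>\<rho>. poly l (\<rho> v) ^ D2 * \<beta>1 c \<rho> + poly l (\<rho> v) ^ D1 * \<beta>2 c \<rho>) \<in> polyfun" for c
      using 1 2 by (auto intro!: polyfun.add polyfun.mult polyfun_power polyfun_poly polyfun.var)
    fix \<rho> x assume r: "eval2 F x (\<rho> v) = 0"
    have "poly l (\<rho> v) ^ (D1 + D2) * (w1 \<rho> x + w2 \<rho> x) =
      poly l (\<rho> v) ^ D2 * (poly l (\<rho> v) ^ D1 * w1 \<rho> x) + poly l (\<rho> v) ^ D1 * (poly l (\<rho> v) ^ D2 * w2 \<rho> x)"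
      by (simp add: power_add algebra_simps)
    also have "\<dots> = (\<Sum>c<d. (poly l (\<rho> v) ^ D2 * \<beta>1 c \<rho> + poly l (\<rho> v) ^ D1 * \<beta>2 c \<rho>) * x ^ c)"
      unfolding 1(2)[of x \<rho>, OF r] 2(2)[of x \<rho>, OF r] sum_distrib_left sum.distrib[symmetric]
      by (simp add: algebra_simps)
    finally show "poly l (\<rho> v) ^ (D1 + D2) * (w1 \<rho> x + w2 \<rho> x) = \<dots>" .
  qed
qed

lemma reducible_mult_polyfun:
  assumes "w \<in> R" "p \<in> polyfun"
  shows "(\<lambda>\<rho> x. p \<rho> * w \<rho> x) \<in> R"
proof -
  obtain D \<beta> where 1: "\<And>c. \<beta> c \<in> polyfun"
    "\<And>\<rho> x. eval2 F x (\<rho> v) = 0 \<Longrightarrow> poly l (\<rho> v) ^ D * w \<rho> x = (\<Sum>c<d. \<beta> c \<rho> * x ^ c)"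
    using reducible_modE[OF assms(1)] by metis
  show ?thesis
  proof (rule reducible_modI[of "\<lambda>c \<rho>. p \<rho> * \<beta> c \<rho>" D])
    fix \<rho> x assume r: "eval2 F x (\<rho> v) = 0"
    have "poly l (\<rho> v) ^ D * (p \<rho> * w \<rho> x) = p \<rho> * (poly l (\<rho> v) ^ D * w \<rho> x)" by simp
    also have "\<dots> = (\<Sum>c<d. p \<rho> * \<beta> c \<rho> * x ^ c)"
      unfolding 1(2)[of x \<rho>, OF r] sum_distrib_left by (simp add: mult.assoc)
    finally show "poly l (\<rho> v) ^ D * (p \<rho> * w \<rho> x) = \<dots>" .
  qed (use 1 assms in \<open>auto intro: polyfun.intros\<close>)
qed

lemma reducible_cancel:
  assumes "w \<in> R" "\<And>\<rho> x. eval2 F x (\<rho> v) = 0 \<Longrightarrow> poly l (\<rho> v) ^ E * u \<rho> x = w \<rho> x"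
  shows "u \<in> R"
proof -
  obtain D \<beta> where 1: "\<And>c. \<beta> c \<in> polyfun"
    "\<And>\<rho> x. eval2 F x (\<rho> v) = 0 \<Longrightarrow> poly l (\<rho> v) ^ D * w \<rho> x = (\<Sum>c<d. \<beta> c \<rho> * x ^ c)"
    using reducible_modE[OF assms(1)] by metis
  show ?thesis
    by (rule reducible_modI[of \<beta> "D + E"]) (use 1 assms in \<open>auto simp: power_add mult.assoc\<close>)
qed

text \<open>Multiplication by x moves the coefficient of x^(d-1) to x^d; there the equation F = 0
  replaces l x^d by lower powers, at the cost of one more factor l.\<close>

lemma reducible_mult_x:
  assumes "w \<in> R"
  shows "(\<lambda>\<rho> x. x * w \<rho> x) \<in> R"
proof -
  obtain D \<beta> where 1: "\<And>c. \<beta> c \<in> polyfun"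
    "\<And>\<rho> x. eval2 F x (\<rho> v) = 0 \<Longrightarrow> poly l (\<rho> v) ^ D * w \<rho> x = (\<Sum>c<d. \<beta> c \<rho> * x ^ c)"
    using reducible_modE[OF assms(1)] by metis
  obtain e where e: "d = Suc e" using d_pos by (cases d) auto
  let ?F = "\<lambda>c \<rho>. poly (Polynomial.coeff F c) (\<rho> v)"
  let ?\<beta> = "\<lambda>c \<rho>. poly l (\<rho> v) * (if c = 0 then 0 else \<beta> (c - 1) \<rho>) - \<beta> e \<rho> * ?F c \<rho>"
  show ?thesis
  proof (rule reducible_modI[of ?\<beta> "Suc D"])
    show "?\<beta> c \<in> polyfun" for c
      using 1(1) by (cases c) (auto intro!: polyfun_diff polyfun_uminus polyfun.mult polyfun_poly polyfun.var)
    fix \<rho> x assume r: "eval2 F x (\<rho> v) = 0"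
    have "(\<Sum>c<d. ?F c \<rho> * x ^ c) + poly l (\<rho> v) * x ^ d = 0"
      using r by (simp add: eval2_altdef d_def[symmetric] lessThan_Suc_atMost[symmetric] l_def)
    then have top: "poly l (\<rho> v) * x ^ d = - (\<Sum>c<d. ?F c \<rho> * x ^ c)" by (simp add: eq_neg_iff_add_eq_0 add.commute)
    have "poly l (\<rho> v) ^ Suc D * (x * w \<rho> x) = poly l (\<rho> v) * x * (poly l (\<rho> v) ^ D * w \<rho> x)"
      by simp
    also have "\<dots> = poly l (\<rho> v) * x * (\<Sum>c<d. \<beta> c \<rho> * x ^ c)" using 1(2) r by simp
    also have "\<dots> = (\<Sum>c<e. poly l (\<rho> v) * \<beta> c \<rho> * x ^ Suc c) + \<beta> e \<rho> * (poly l (\<rho> v) * x ^ d)"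
      by (simp add: e sum_distrib_left algebra_simps)
    also have "(\<Sum>c<e. poly l (\<rho> v) * \<beta> c \<rho> * x ^ Suc c) =
      (\<Sum>c<d. poly l (\<rho> v) * (if c = 0 then 0 else \<beta> (c - 1) \<rho>) * x ^ c)"
      unfolding e sum.lessThan_Suc_shift by simp
    finally show "poly l (\<rho> v) ^ Suc D * (x * w \<rho> x) = (\<Sum>c<d. ?\<beta> c \<rho> * x ^ c)"
      unfolding top by (simp add: sum_distrib_left sum_negf[symmetric] sum_subtractf[symmetric] sum.distrib[symmetric] algebra_simps)
  qed
qed

lemma reducible_sum: "(\<And>a. a \<in> A \<Longrightarrow> w a \<in> R) \<Longrightarrow> (\<lambda>\<rho> x. \<Sum>a\<in>A. w a \<rho> x) \<in> R"
  by (induction A rule: infinite_finite_induct)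
    (auto intro: reducible_add reducible_polyfun[OF polyfun.const[of 0]])

text \<open>Up to a power of l the first factor is a combination of powers of x, and multiplication
  by x stays in R; the power of l is cancelled afterwards.\<close>

lemma reducible_mult:
  assumes "w1 \<in> R" "w2 \<in> R"
  shows "(\<lambda>\<rho> x. w1 \<rho> x * w2 \<rho> x) \<in> R"
proof -
  obtain D \<beta> where 1: "\<And>c. \<beta> c \<in> polyfun"
    "\<And>\<rho> x. eval2 F x (\<rho> v) = 0 \<Longrightarrow> poly l (\<rho> v) ^ D * w1 \<rho> x = (\<Sum>c<d. \<beta> c \<rho> * x ^ c)"
    using reducible_modE[OF assms(1)] by metis
  have "(\<lambda>\<rho> x. x ^ c * w2 \<rho> x) \<in> R" for c
    by (induction c) (use assms reducible_mult_x in \<open>auto simp: mult.assoc\<close>)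
  then have "(\<lambda>\<rho> x. \<Sum>c<d. \<beta> c \<rho> * (x ^ c * w2 \<rho> x)) \<in> R"
    by (intro reducible_sum reducible_mult_polyfun 1)
  then show ?thesis
    by (rule reducible_cancel[of _ D]) (simp add: 1(2)[symmetric] mult.assoc[symmetric] sum_distrib_right[symmetric])
qed

lemma reducible_power: "w \<in> R \<Longrightarrow> (\<lambda>\<rho> x. w \<rho> x ^ n) \<in> R"
  by (induction n) (auto intro: reducible_mult reducible_polyfun[OF polyfun.const[of 1]])

lemma reducible_x: "(\<lambda>\<rho> x. x) \<in> R"
  using reducible_mult_x[OF reducible_polyfun[OF polyfun.const[of 1]]] by simp

lemma reducible_eval2: "(\<lambda>\<rho> x. eval2 G x (\<rho> v)) \<in> R"
proof (induction G)
  case 0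
  show ?case using reducible_polyfun[OF polyfun.const[of 0]] by simp
next
  case (pCons c G)
  have "(\<lambda>\<rho>. poly c (\<rho> v)) \<in> polyfun" by (intro polyfun_poly polyfun.var)
  with pCons show ?case by (auto intro: reducible_add reducible_mult_x reducible_polyfun)
qed

end

text \<open>The powers w^0, ..., w^d, reduced modulo F, are d + 1 vectors with d entries, hence
  linearly dependent over the polynomial functions. The dependence is an algebraic equation for w
  whose coefficients absorb the powers of the leading coefficient spent on the reductions.\<close>

lemma (in irreducible_points) reducible_mod_algebraic:
  fixes v :: "nat + 'i"
  assumes d: "Polynomial.degree F > 0" and w: "w \<in> reducible_mod F v" and l: "nonzero_on V (\<lambda>\<rho>. poly (Polynomial.lead_coeff F) (\<rho> v))"
  shows "\<exists>n c. (\<forall>k\<le>n. c k \<in> polyfun) \<and> (\<exists>k\<le>n. nonzero_on V (c k)) \<and>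
    (\<forall>\<rho>\<in>points V. \<forall>x. eval2 F x (\<rho> v) = 0 \<longrightarrow> (\<Sum>k\<le>n. c k \<rho> * w \<rho> x ^ k) = 0)"
proof -
  interpret function_domain "points V" "polyfun :: ((nat + 'i \<Rightarrow> complex) \<Rightarrow> complex) set"
    by (rule function_domain_polyfun)
  let ?d = "Polynomial.degree F" and ?l = "\<lambda>\<rho>. poly (Polynomial.lead_coeff F) (\<rho> v)"
  let ?P = "\<lambda>k D \<beta>. (\<forall>e. \<beta> e \<in> polyfun) \<and> (\<forall>\<rho> x. eval2 F x (\<rho> v) = 0 \<longrightarrow>
      ?l \<rho> ^ D * w \<rho> x ^ k = (\<Sum>e<?d. \<beta> e \<rho> * x ^ e))"
  have "\<forall>k. \<exists>D \<beta>. ?P k D \<beta>"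
    using reducible_power[OF d w] unfolding reducible_mod_def by blast
  from choice[OF this] obtain D where "\<forall>k. \<exists>\<beta>. ?P k (D k) \<beta>" by blast
  from choice[OF this] obtain \<beta> where \<beta>: "\<And>k e. \<beta> k e \<in> polyfun" "\<And>k \<rho> x. eval2 F x (\<rho> v) = 0 \<Longrightarrow>
      ?l \<rho> ^ D k * w \<rho> x ^ k = (\<Sum>e<?d. \<beta> k e \<rho> * x ^ e)" by blast
  have "points V \<noteq> ({} :: (nat + 'i \<Rightarrow> complex) set)" using l by blast
  from linear_dependence[of "{..<?d}" "{..?d}" \<beta>, OF _ _ _ \<beta>(1) this]
  obtain c where c: "\<forall>k\<in>{..?d}. c k \<in> polyfun" "\<exists>k\<in>{..?d}. nonzero_on V (c k)"
    "\<forall>e\<in>{..<?d}. \<forall>\<rho>\<in>points V. (\<Sum>k\<in>{..?d}. c k \<rho> * \<beta> k e \<rho>) = 0" by auto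
  have lp: "(\<lambda>\<rho>. ?l \<rho> ^ k) \<in> polyfun" for k by (intro polyfun_power polyfun_poly polyfun.var)
  show ?thesis
  proof (rule exI[of _ ?d], rule exI[of _ "\<lambda>k \<rho>. c k \<rho> * ?l \<rho> ^ D k"], intro conjI allI impI ballI)
    show "(\<lambda>\<rho>. c k \<rho> * ?l \<rho> ^ D k) \<in> polyfun" if "k \<le> ?d" for k
      using c(1) that by (intro polyfun.mult lp) simp
    obtain k where k: "k \<le> ?d" "nonzero_on V (c k)" using c(2) by auto
    from l have "\<exists>\<rho>\<in>points V. ?l \<rho> ^ D k \<noteq> 0" by (metis power_not_zero)
    moreover have "c k \<in> polyfun" using k c(1) by simp
    ultimately have "\<exists>\<rho>\<in>points V. c k \<rho> \<noteq> 0 \<and> ?l \<rho> ^ D k \<noteq> 0"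
      using k lp by (intro common_nonzero) 
    with k show "\<exists>k\<le>?d. nonzero_on V (\<lambda>\<rho>. c k \<rho> * ?l \<rho> ^ D k)" by auto
    fix \<rho> x assume \<rho>: "\<rho> \<in> points V" "eval2 F x (\<rho> v) = 0"
    have "(\<Sum>k\<le>?d. c k \<rho> * ?l \<rho> ^ D k * w \<rho> x ^ k) = (\<Sum>k\<le>?d. c k \<rho> * (\<Sum>e<?d. \<beta> k e \<rho> * x ^ e))"
      using \<beta>(2)[of x \<rho>, OF \<rho>(2)] by (simp add: mult.assoc)
    also have "\<dots> = (\<Sum>e<?d. (\<Sum>k\<le>?d. c k \<rho> * \<beta> k e \<rho>) * x ^ e)"
      unfolding sum_distrib_left sum_distrib_right by (subst sum.swap) (simp add: mult.assoc)
    also have "\<dots> = 0" using c(3) \<rho> by simp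
    finally show "(\<Sum>k\<le>?d. c k \<rho> * ?l \<rho> ^ D k * w \<rho> x ^ k) = 0" .
  qed
qed

section \<open>Jets of two algebraically related functions\<close>

definition jet :: "(complex \<Rightarrow> complex) \<Rightarrow> 'i \<Rightarrow> ('v + 'i \<times> nat \<Rightarrow> complex) \<times> complex \<times> complex \<times> complex \<Rightarrow> ('v + 'i \<times> nat \<Rightarrow> complex)" where
  "jet f i = (\<lambda>(\<rho>, z, a, b). \<rho>(Inr (i, 0) := f z, Inr (i, 1) := a * deriv f z,
     Inr (i, 2) := a\<^sup>2 * deriv (deriv f) z + b * deriv f z))"

lemma jet_simps [simp]:
  "jet f i (\<rho>, z, a, b) (Inr (i, 0)) = f z"
  "jet f i (\<rho>, z, a, b) (Inr (i, Suc 0)) = a * deriv f z"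
  "jet f i (\<rho>, z, a, b) (Inr (i, 2)) = a\<^sup>2 * deriv (deriv f) z + b * deriv f z"
  "v \<noteq> Inr (i, 0) \<Longrightarrow> v \<noteq> Inr (i, 1) \<Longrightarrow> v \<noteq> Inr (i, 2) \<Longrightarrow> jet f i (\<rho>, z, a, b) v = \<rho> v"
  by (auto simp: jet_def)

lemma jet_in_points [simp]: "jet f i (\<rho>, z, a, b) \<in> points V \<longleftrightarrow> \<rho> \<in> points V"
  by (simp add: jet_def)

lemma jetfun_jet:
  assumes "open H" "f holomorphic_on H"
  shows "(\<lambda>m. jet f i m v) \<in> jetfun H"
proof -
  have "(\<lambda>m. fst (snd (snd m)) * fst (snd (snd m)) * deriv (deriv f) (fst (snd m)) + snd (snd (snd m)) * deriv f (fst (snd m))) \<in> jetfun H"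
    "(\<lambda>m. fst (snd (snd m)) * deriv f (fst (snd m))) \<in> jetfun H" "(\<lambda>m. f (fst (snd m))) \<in> jetfun H"
    using jetfun.fst[of H] jetfun.snd[of H] jetfun.hol[OF holomorphic_deriv[OF assms(2,1)]]
      jetfun.hol[OF assms(2)] jetfun.hol[OF holomorphic_deriv[OF holomorphic_deriv[OF assms(2,1)] assms(1)]]
    by (auto intro!: jetfun.add jetfun.mult simp: case_prod_unfold)
  moreover have "(\<lambda>m. fst m v) \<in> jetfun H"
    using jetfun.var[of v] by (simp add: case_prod_unfold)
  ultimately show ?thesis
    unfolding jet_def by (cases "v = Inr (i, 2)"; cases "v = Inr (i, 1)"; cases "v = Inr (i, 0)")
      (simp_all add: case_prod_unfold power2_eq_square)
qed

context
  fixes H :: "complex set" and f g :: "complex \<Rightarrow> complex" and F :: "complex poly poly"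
  assumes H: "open H" "connected H" and hol: "f holomorphic_on H" "g holomorphic_on H"
    and F: "\<And>z. z \<in> H \<Longrightarrow> eval2 F (f z) (g z) = 0"
begin

lemma eval2_first_derivative:
  assumes "z \<in> H"
  shows "eval2 (pderiv F) (f z) (g z) * deriv f z + eval2 (pderiv_y F) (f z) (g z) * deriv g z = 0"
proof -
  have d: "(f has_field_derivative deriv f z) (at z)" "(g has_field_derivative deriv g z) (at z)"
    using hol H assms holomorphic_derivI by blast+
  have "((\<lambda>z. eval2 F (f z) (g z)) has_field_derivative 0) (at z)"
    using has_field_derivative_transform_within_open[of "\<lambda>_. 0" 0 z H] H assms F by simp
  with has_field_derivative_eval2[OF d, of F] show ?thesis by (rule DERIV_unique)
qed

lemma eval2_second_derivative:
  assumes "z \<in> H"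
  shows "eval2 (pderiv (pderiv F)) (f z) (g z) * (deriv f z)\<^sup>2
      + (eval2 (pderiv_y (pderiv F)) (f z) (g z) + eval2 (pderiv (pderiv_y F)) (f z) (g z)) * deriv f z * deriv g z
      + eval2 (pderiv_y (pderiv_y F)) (f z) (g z) * (deriv g z)\<^sup>2
      + eval2 (pderiv F) (f z) (g z) * deriv (deriv f) z + eval2 (pderiv_y F) (f z) (g z) * deriv (deriv g) z = 0"
proof -
  have d: "(f has_field_derivative deriv f z) (at z)" "(g has_field_derivative deriv g z) (at z)"
    "(deriv f has_field_derivative deriv (deriv f) z) (at z)" "(deriv g has_field_derivative deriv (deriv g) z) (at z)"
    using hol H assms holomorphic_derivI holomorphic_deriv by blast+
  let ?R = "\<lambda>z. eval2 (pderiv F) (f z) (g z) * deriv f z + eval2 (pderiv_y F) (f z) (g z) * deriv g z"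
  have "(?R has_field_derivative 0) (at z)"
    using has_field_derivative_transform_within_open[of "\<lambda>_. 0" 0 z H] H assms eval2_first_derivative by simp
  from DERIV_unique[OF DERIV_add[OF DERIV_mult[OF has_field_derivative_eval2[OF d(1,2), of "pderiv F"] d(3)]
      DERIV_mult[OF has_field_derivative_eval2[OF d(1,2), of "pderiv_y F"] d(4)]] this]
  show ?thesis by (simp add: power2_eq_square algebra_simps)
qed

lemma first_identity:
  fixes P Q f1 g1 a :: complex
  assumes "P * f1 + Q * g1 = 0"
  shows "P * (a * f1) = - (Q * (a * g1))"
proof -
  have "P * (a * f1) = a * (P * f1)" by simp
  also have "P * f1 = - (Q * g1)" using assms by (simp add: eq_neg_iff_add_eq_0)
  finally show ?thesis by simp
qed

text \<open>P and Q stand for the first derivatives of F, and A, B, C for its second ones. The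
  factor P^2 turns f1^2 and f1 g1 into multiples of g1^2, and f2 comes with one more P. On the
  right, a and b enter only through a g1 and a^2 g2 + b g1, the jet of g.\<close>

lemma second_identity:
  fixes P Q f1 g1 f2 g2 A B C a b :: complex
  assumes "P * f1 + Q * g1 = 0" "A * f1\<^sup>2 + B * f1 * g1 + C * g1\<^sup>2 + P * f2 + Q * g2 = 0"
  shows "P ^ 3 * (a\<^sup>2 * f2 + b * f1) = - (P\<^sup>2 * Q * (a\<^sup>2 * g2 + b * g1) +
    (A * Q\<^sup>2 - B * P * Q + C * P\<^sup>2) * (a * g1)\<^sup>2)" (is "?l = - ?r")
proof -
  have "?l + ?r = a\<^sup>2 * P\<^sup>2 * (A * f1\<^sup>2 + B * f1 * g1 + C * g1\<^sup>2 + P * f2 + Q * g2) +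
    (b * P\<^sup>2 - a\<^sup>2 * A * (P * f1 - Q * g1) - a\<^sup>2 * B * P * g1) * (P * f1 + Q * g1)"
    by (simp add: power2_eq_square power3_eq_cube algebra_simps)
  then have "?l + ?r = 0" unfolding assms by simp
  then show ?thesis by (rule eq_neg_iff_add_eq_0[THEN iffD2])
qed

text \<open>The slots of f are rational in the jet of g and in x = f z, with a power of the
  x-derivative of F as denominator, which s clears. The value f z itself remains, as a root x of
  F(x, g z) = 0.\<close>

lemma jet_transform:
  fixes h :: "('v + 'i \<times> nat \<Rightarrow> complex) \<Rightarrow> complex"
  assumes d: "Polynomial.degree F > 0" and h: "h \<in> polyfun"
  shows "\<exists>s. \<exists>w\<in>reducible_mod F (Inr (i, 0)). \<forall>\<rho> z a b. z \<in> H \<longrightarrow>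
    eval2 (pderiv F) (f z) (g z) ^ s * h (jet f i (\<rho>, z, a, b)) = w (jet g i (\<rho>, z, a, b)) (f z)"
  using h
proof induction
  case (const c)
  show ?case
    using reducible_polyfun[OF d polyfun.const[of c]] by (intro exI[of _ 0] bexI[of _ "\<lambda>_ _. c"]) auto
next
  case (var v)
  let ?R = "reducible_mod F (Inr (i, 0 :: nat) :: 'v + 'i \<times> nat)" and ?y = "\<lambda>\<rho>. \<rho> (Inr (i, 0 :: nat)) :: complex"
  note red = reducible_add[OF d] reducible_mult[OF d] reducible_power[OF d] reducible_eval2[OF d]
    reducible_polyfun[OF d] polyfun.intros
  show ?case
  proof (cases "v \<in> {Inr (i, 0), Inr (i, 1), Inr (i, 2)}")
    case False
    then show ?thesis
      using reducible_polyfun[OF d polyfun.var[of v]] by (intro exI[of _ 0] bexI[of _ "\<lambda>\<rho> _. \<rho> v"]) auto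
  next
    case True
    then consider "v = Inr (i, 0)" | "v = Inr (i, 1)" | "v = Inr (i, 2)" by blast
    then show ?thesis
    proof cases
      case 1
      then show ?thesis
        using reducible_x[OF d] by (intro exI[of _ 0] bexI[of _ "\<lambda>\<rho> x. x"]) auto
    next
      case 2
      let ?w = "\<lambda>\<rho> x. (-1) * (eval2 (pderiv_y F) x (?y \<rho>) * \<rho> (Inr (i, 1)))"
      have "?w \<in> ?R" by (intro red)
      moreover have "eval2 (pderiv F) (f z) (g z) ^ 1 * jet f i (\<rho>, z, a, b) v = ?w (jet g i (\<rho>, z, a, b)) (f z)"
        if "z \<in> H" for \<rho> z a b
        using eval2_first_derivative[OF that] 2 by (simp add: first_identity)
      ultimately show ?thesis by (intro exI[of _ 1] bexI[of _ ?w] allI impI)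
    next
      case 3
      let ?x = "\<lambda>x \<rho>. eval2 (pderiv F) x (?y \<rho>)" and ?Fy = "\<lambda>x \<rho>. eval2 (pderiv_y F) x (?y \<rho>)"
      let ?w = "\<lambda>\<rho> x. (-1) * (?x x \<rho> ^ 2 * ?Fy x \<rho> * \<rho> (Inr (i, 2)) +
        (eval2 (pderiv (pderiv F)) x (?y \<rho>) * ?Fy x \<rho> ^ 2 +
         (-1) * ((eval2 (pderiv_y (pderiv F)) x (?y \<rho>) + eval2 (pderiv (pderiv_y F)) x (?y \<rho>)) * ?x x \<rho> * ?Fy x \<rho>) +
         eval2 (pderiv_y (pderiv_y F)) x (?y \<rho>) * ?x x \<rho> ^ 2) * \<rho> (Inr (i, 1)) ^ 2)"
      have "?w \<in> ?R" by (intro red)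
      moreover have "eval2 (pderiv F) (f z) (g z) ^ 3 * jet f i (\<rho>, z, a, b) v = ?w (jet g i (\<rho>, z, a, b)) (f z)"
        if "z \<in> H" for \<rho> z a b
        using second_identity[OF eval2_first_derivative[OF that] eval2_second_derivative[OF that], of a b] 3 by simp
      ultimately show ?thesis by (intro exI[of _ 3] bexI[of _ ?w] allI impI)
    qed
  qed
next
  case (add h1 h2)
  let ?e = "\<lambda>z. eval2 (pderiv F) (f z) (g z)"
  from add obtain s1 w1 s2 w2 where w: "w1 \<in> reducible_mod F (Inr (i, 0))" "w2 \<in> reducible_mod F (Inr (i, 0))"
    "\<And>\<rho> z a b. z \<in> H \<Longrightarrow> ?e z ^ s1 * h1 (jet f i (\<rho>, z, a, b)) = w1 (jet g i (\<rho>, z, a, b)) (f z)"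
    "\<And>\<rho> z a b. z \<in> H \<Longrightarrow> ?e z ^ s2 * h2 (jet f i (\<rho>, z, a, b)) = w2 (jet g i (\<rho>, z, a, b)) (f z)" by blast
  let ?w = "\<lambda>\<rho> x. eval2 (pderiv F) x (\<rho> (Inr (i, 0))) ^ s2 * w1 \<rho> x + eval2 (pderiv F) x (\<rho> (Inr (i, 0))) ^ s1 * w2 \<rho> x"
  have "?w \<in> reducible_mod F (Inr (i, 0))"
    by (intro reducible_add[OF d] reducible_mult[OF d] reducible_power[OF d] reducible_eval2[OF d] w)
  moreover have "?e z ^ (s1 + s2) * (h1 (jet f i (\<rho>, z, a, b)) + h2 (jet f i (\<rho>, z, a, b))) = ?w (jet g i (\<rho>, z, a, b)) (f z)"
    if "z \<in> H" for \<rho> z a b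
    using w(3,4)[OF that, of \<rho> a b, symmetric] by (simp add: power_add algebra_simps)
  ultimately show ?case by (intro exI[of _ "s1 + s2"] bexI[of _ ?w] allI impI)
next
  case (mult h1 h2)
  let ?e = "\<lambda>z. eval2 (pderiv F) (f z) (g z)"
  from mult obtain s1 w1 s2 w2 where w: "w1 \<in> reducible_mod F (Inr (i, 0))" "w2 \<in> reducible_mod F (Inr (i, 0))"
    "\<And>\<rho> z a b. z \<in> H \<Longrightarrow> ?e z ^ s1 * h1 (jet f i (\<rho>, z, a, b)) = w1 (jet g i (\<rho>, z, a, b)) (f z)"
    "\<And>\<rho> z a b. z \<in> H \<Longrightarrow> ?e z ^ s2 * h2 (jet f i (\<rho>, z, a, b)) = w2 (jet g i (\<rho>, z, a, b)) (f z)" by blast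
  have "(\<lambda>\<rho> x. w1 \<rho> x * w2 \<rho> x) \<in> reducible_mod F (Inr (i, 0))"
    by (intro reducible_mult[OF d] w)
  moreover have "?e z ^ (s1 + s2) * (h1 (jet f i (\<rho>, z, a, b)) * h2 (jet f i (\<rho>, z, a, b)))
      = w1 (jet g i (\<rho>, z, a, b)) (f z) * w2 (jet g i (\<rho>, z, a, b)) (f z)"
    if "z \<in> H" for \<rho> z a b
    using w(3,4)[OF that, of \<rho> a b, symmetric] by (simp add: power_add algebra_simps)
  ultimately show ?case by (intro exI[of _ "s1 + s2"] bexI[of _ "\<lambda>\<rho> x. w1 \<rho> x * w2 \<rho> x"] allI impI)
qed

text \<open>A point where h is nonzero is turned into a jet of f. As a polynomial in slot (i, 0)
  alone h is nonzero there, and f takes infinitely many values, so f z can be inserted; the other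
  two slots are matched by solving for a and b where the derivative of f is nonzero.\<close>

lemma jet_nonzero:
  assumes h: "h \<in> polyfun" "nonzero_on V h" and nc: "\<not> f constant_on H"
  shows "\<exists>m\<in>{(\<rho>, z, a, b). \<rho> \<in> points V \<and> z \<in> H}. h (jet f i m) \<noteq> 0"
proof -
  obtain \<rho> where \<rho>: "\<rho> \<in> points V" "h \<rho> \<noteq> 0" using h by blast
  obtain p where p: "\<And>s. h (\<rho>(Inr (i, 0) := s)) = poly p s"
  proof -
    have "\<exists>p. \<forall>s. (\<rho>(Inr (i, 0) := s)) v = poly p s" for v
    proof (cases "v = Inr (i, 0)")
      case True
      then show ?thesis by (intro exI[of _ "[:0, 1:]"]) simp
    next
      case False
      then show ?thesis by (intro exI[of _ "[:\<rho> v:]"]) simp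
    qed
    from polyfun_line[where \<sigma> = "\<lambda>s. \<rho>(Inr (i, 0) := s)", OF h(1) this] that show ?thesis by blast
  qed
  have "poly p (\<rho> (Inr (i, 0))) \<noteq> 0" using \<rho> by (simp add: p[symmetric])
  then have p0: "p \<noteq> 0" by auto
  have "\<exists>z\<in>H. poly p (f z) \<noteq> 0"
  proof (rule ccontr)
    assume "\<not> ?thesis"
    then have "f ` H \<subseteq> {x. poly p x = 0}" by auto
    then have "finite (f ` H)" using poly_roots_finite[OF p0] finite_subset by blast
    moreover have "connected (f ` H)"
      using H(2) hol(1) by (intro connected_continuous_image holomorphic_on_imp_continuous_on)
    ultimately have "f ` H = {} \<or> (\<exists>x. f ` H = {x})" using connected_finite_iff_sing by blast
    with nc show False by (auto simp: constant_on_def)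
  qed
  moreover have "\<exists>z\<in>H. deriv f z \<noteq> 0"
  proof (rule ccontr)
    assume "\<not> ?thesis"
    then have "(f has_field_derivative 0) (at z)" if "z \<in> H" for z
      using holomorphic_derivI[OF hol(1) H(1) that] that by simp
    then obtain c where "\<And>z. z \<in> H \<Longrightarrow> f z = c"
      using DERIV_zero_connected_constant[OF H(2,1) finite.emptyI holomorphic_on_imp_continuous_on[OF hol(1)]] by blast
    with nc show False by (auto simp: constant_on_def)
  qed
  moreover have "(\<lambda>z. poly p (f z)) holomorphic_on H"
    unfolding poly_altdef by (intro holomorphic_intros hol)
  ultimately obtain z where z: "z \<in> H" "poly p (f z) \<noteq> 0" "deriv f z \<noteq> 0"
    using holomorphic_common_nonzero[OF H, of "\<lambda>z. poly p (f z)" "deriv f"] holomorphic_deriv[OF hol(1) H(1)] by auto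
  define a where "a = \<rho> (Inr (i, 1)) / deriv f z"
  define b where "b = (\<rho> (Inr (i, 2)) - a\<^sup>2 * deriv (deriv f) z) / deriv f z"
  have "jet f i (\<rho>, z, a, b) = \<rho>(Inr (i, 0) := f z)"
    using z(3) by (auto simp: jet_def a_def b_def fun_eq_iff)
  then have "h (jet f i (\<rho>, z, a, b)) \<noteq> 0" using z(2) p by simp
  with \<rho> z show ?thesis by (intro bexI[of _ "(\<rho>, z, a, b)"]) auto
qed

end

text \<open>The relation \<open>h\<close> among the jets of \<open>f\<close> is, up to a power of \<open>F\<^sub>x\<close>, a root \<open>\<omega>\<close> of a polynomial
  over the ring of polynomials in the jets of \<open>g\<close>.  Its lowest nonzero coefficient is divisible by
  \<open>\<omega>\<close> at the generic point, hence vanishes with \<open>h\<close>.  The factor given by the leading coefficient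
  of \<open>F\<close> takes care of the poles of \<open>f\<close>.\<close>

lemma (in irreducible_points) exchange_jets:
  fixes h :: "(nat + 'i \<times> nat \<Rightarrow> complex) \<Rightarrow> complex"
  assumes H: "open H" "connected H" and hol: "f holomorphic_on H" "g holomorphic_on H"
    and F: "\<And>z. z \<in> H \<Longrightarrow> eval2 F (f z) (g z) = 0"
    and d: "Polynomial.degree F > 0" and Fx: "\<exists>z\<in>H. eval2 (pderiv F) (f z) (g z) \<noteq> 0"
    and nc: "\<not> f constant_on H" and h: "h \<in> polyfun" "nonzero_on V h"
  shows "\<exists>h'. h' \<in> polyfun \<and> nonzero_on V h' \<and>
    (\<forall>\<rho>\<in>points V. \<forall>z. (z \<in> H \<and> h (jet f i (\<rho>, z, 1, 0)) = 0) \<or> poly (Polynomial.lead_coeff F) (g z) = 0 \<longrightarrow>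
      h' (jet g i (\<rho>, z, 1, 0)) = 0)"
proof -
  define M :: "((nat + 'i \<times> nat \<Rightarrow> complex) \<times> complex \<times> complex \<times> complex) set"
    where "M = {(\<rho>, z, a, b). \<rho> \<in> points V \<and> z \<in> H}"
  interpret jet: function_domain M "jetfun H"
    unfolding M_def by (rule function_domain_jetfun[OF H])
  interpret pol: function_domain "points V" "polyfun :: ((nat + 'i \<times> nat \<Rightarrow> complex) \<Rightarrow> complex) set"
    by (rule function_domain_polyfun)
  let ?v = "Inr (i, 0) :: nat + 'i \<times> nat"
  let ?l = "\<lambda>\<rho>. poly (Polynomial.lead_coeff F) (\<rho> ?v)"
  have lp: "?l \<in> polyfun" by (intro polyfun_poly polyfun.var)
  have lnz: "nonzero_on V ?l"
  proof -
    have "Polynomial.lead_coeff F \<noteq> 0" using d by auto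
    then obtain y where "poly (Polynomial.lead_coeff F) y \<noteq> 0" by (metis poly_all_0_iff_0)
    moreover obtain x where "x \<in> V" using nonempty by blast
    ultimately show ?thesis by (intro bexI[of _ "case_sum x (\<lambda>_. y)"]) (auto simp: points_def)
  qed
  obtain s w where w: "w \<in> reducible_mod F ?v" "\<And>\<rho> z a b. z \<in> H \<Longrightarrow>
      eval2 (pderiv F) (f z) (g z) ^ s * h (jet f i (\<rho>, z, a, b)) = w (jet g i (\<rho>, z, a, b)) (f z)"
    using jet_transform[OF H hol F d h(1), of i] by blast
  obtain n c where c: "\<forall>k\<le>n. c k \<in> polyfun" "\<exists>k\<le>n. nonzero_on V (c k)"
    "\<forall>\<rho>\<in>points V. \<forall>x. eval2 F x (\<rho> ?v) = 0 \<longrightarrow> (\<Sum>k\<le>n. c k \<rho> * w \<rho> x ^ k) = 0"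
    using reducible_mod_algebraic[OF d w(1) lnz] by blast
  \<comment> \<open>Coefficients below \<open>k0\<close> vanish on V, so the equation for w is
    divisible by the power \<open>k0\<close> of w.\<close>
  define k0 where "k0 = (LEAST k. k \<le> n \<and> nonzero_on V (c k))"
  have k0: "k0 \<le> n" "nonzero_on V (c k0)" using LeastI_ex[OF c(2)] by (auto simp: k0_def)
  have low: "c k \<rho> = 0" if "k < k0" "\<rho> \<in> points V" for k \<rho>
    using not_less_Least[of k "\<lambda>k. k \<le> n \<and> nonzero_on V (c k)"] that k0(1) by (auto simp: k0_def)
  \<comment> \<open>The value of w at a generic jet. Neither of its factors vanishes identically:
    the x-derivative of F by assumption, h because generic jets of f are dense enough to detect
    it.\<close>
  define \<omega> where "\<omega> = (\<lambda>m. eval2 (pderiv F) (f (fst (snd m))) (g (fst (snd m))) ^ s * h (jet f i m))"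
  have holF: "(\<lambda>z. eval2 (pderiv F) (f z) (g z)) holomorphic_on H"
    unfolding eval2_altdef poly_altdef by (intro holomorphic_intros hol)
  have Fj: "(\<lambda>m. eval2 (pderiv F) (f (fst (snd m))) (g (fst (snd m)))) \<in> jetfun H"
    using jetfun.hol[OF holF] by (simp add: case_prod_unfold)
  have hj: "(\<lambda>m. h (jet f i m)) \<in> jetfun H"
    using h(1) jetfun_jet[OF H(1) hol(1)] by (rule jetfun_polyfun_compose)
  have \<omega>: "\<omega> \<in> jetfun H"
    unfolding \<omega>_def by (rule jet.mult_in[OF jet.power_in[OF Fj] hj])
  have \<omega>nz: "\<exists>m\<in>M. \<omega> m \<noteq> 0"
  proof -
    obtain x where "x \<in> V" using nonempty by blast
    then have "case_sum x (\<lambda>_. 0) \<in> points V" by (simp add: points_def)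
    moreover obtain z where "z \<in> H" "eval2 (pderiv F) (f z) (g z) \<noteq> 0" using Fx by blast
    ultimately have "\<exists>m\<in>M. eval2 (pderiv F) (f (fst (snd m))) (g (fst (snd m))) \<noteq> 0"
      unfolding M_def by (intro bexI[of _ "(case_sum x (\<lambda>_. 0), z, 0, 0)"]) auto
    from jet.common_nonzero[OF Fj hj this] jet_nonzero[OF H hol F h nc, of i]
    show ?thesis unfolding M_def \<omega>_def by auto
  qed
  \<comment> \<open>The equation for \<omega> with the factor \<omega>^k0 removed. It still holds,
    since \<omega> is not identically zero and functions of generic jets have no zero
    divisors.\<close>
  define \<theta> where "\<theta> = (\<lambda>m. \<Sum>k=k0..n. c k (jet g i m) * \<omega> m ^ (k - k0))"
  have cj: "(\<lambda>m. c k (jet g i m)) \<in> jetfun H" if "k \<le> n" for k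
    using c(1) that by (intro jetfun_polyfun_compose[OF _ jetfun_jet[OF H(1) hol(2)]]) simp
  have "(\<lambda>m. c k (jet g i m) * \<omega> m ^ (k - k0)) \<in> jetfun H" if "k \<in> {k0..n}" for k
    using jet.mult_in[OF cj jet.power_in[OF \<omega>]] that by simp
  from jet.sum_in[OF this] have \<theta>: "\<theta> \<in> jetfun H" unfolding \<theta>_def .
  have prod0: "\<omega> m ^ k0 * \<theta> m = 0" if "m \<in> M" for m
  proof -
    obtain \<rho> z a b where m: "m = (\<rho>, z, a, b)" "\<rho> \<in> points V" "z \<in> H" using \<open>m \<in> M\<close> by (auto simp: M_def)
    have wm: "\<omega> m = w (jet g i m) (f z)" using w(2)[OF m(3)] by (simp add: \<omega>_def m)
    have "\<omega> m ^ k0 * \<theta> m = (\<Sum>k=k0..n. c k (jet g i m) * \<omega> m ^ k)"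
      unfolding \<theta>_def sum_distrib_left
    proof (rule sum.cong)
      fix k assume "k \<in> {k0..n}"
      then have "\<omega> m ^ k = \<omega> m ^ k0 * \<omega> m ^ (k - k0)" by (simp add: power_add[symmetric])
      then show "\<omega> m ^ k0 * (c k (jet g i m) * \<omega> m ^ (k - k0)) = c k (jet g i m) * \<omega> m ^ k" by simp
    qed simp
    also have "\<dots> = (\<Sum>k\<le>n. c k (jet g i m) * \<omega> m ^ k)"
      using low m by (intro sum.mono_neutral_left) auto
    also have "\<dots> = 0" unfolding wm using c(3) F[OF m(3)] m by simp
    finally show ?thesis .
  qed
  have \<theta>0: "\<theta> m = 0" if "m \<in> M" for m
  proof (rule ccontr)
    assume "\<theta> m \<noteq> 0"
    then have "\<exists>m\<in>M. \<omega> m \<noteq> 0 \<and> \<theta> m \<noteq> 0" using jet.common_nonzero[OF \<omega> \<theta> \<omega>nz] that by blast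
    with prod0 show False by auto
  qed
  \<comment> \<open>At a jet where \<omega> is zero, \<theta> = 0 reduces to the vanishing of the
    lowest coefficient. The second factor depends only on g z, hence also covers points z outside
    H.\<close>
  let ?h = "\<lambda>\<rho>. c k0 \<rho> * ?l \<rho>"
  have "?h (jet g i (\<rho>, z, 1, 0)) = 0"
    if "\<rho> \<in> points V" "z \<in> H \<and> h (jet f i (\<rho>, z, 1, 0)) = 0 \<or> poly (Polynomial.lead_coeff F) (g z) = 0" for \<rho> z
    using that(2)
  proof
    assume z: "z \<in> H \<and> h (jet f i (\<rho>, z, 1, 0)) = 0"
    let ?m = "(\<rho>, z, 1 :: complex, 0 :: complex)"
    have "?m \<in> M" using that z by (simp add: M_def)
    have "\<omega> ?m = 0" using z by (simp add: \<omega>_def)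
    have "0 = \<theta> ?m" using \<theta>0[OF \<open>?m \<in> M\<close>] by simp
    also have "\<dots> = (\<Sum>k=k0..n. if k = k0 then c k (jet g i ?m) else 0)"
      unfolding \<theta>_def \<open>\<omega> ?m = 0\<close> by (rule sum.cong) auto
    also have "\<dots> = c k0 (jet g i ?m)" using k0(1) by simp
    finally show ?thesis by simp
  qed simp
  moreover have "?h \<in> polyfun" using c(1) k0(1) lp by (auto intro: polyfun.mult)
  moreover have "nonzero_on V ?h"
    using pol.common_nonzero[of "c k0" ?l] c(1) k0 lp lnz by auto
  ultimately show ?thesis by (intro exI[of _ ?h]) blast
qed

section \<open>Polynomials and function fields\<close>

subsection \<open>Evaluation of polynomials\<close>

text \<open>One evaluation for two polynomial rings: the coordinate polynomials
  \<open>cpoly\<close>, and polynomials over \<open>cpoly\<close> whose monomials are multisets of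
  unknowns, as in \<open>indexed_pset\<close>.\<close>

definition pm_eval :: "('b::comm_ring_1 \<Rightarrow> complex) \<Rightarrow> ('m \<Rightarrow> complex) \<Rightarrow> ('m::comm_monoid_add \<Rightarrow>\<^sub>0 'b) \<Rightarrow> complex" where
  "pm_eval \<psi> \<phi> p = (\<Sum>m\<in>Poly_Mapping.keys p. \<psi> (Poly_Mapping.lookup p m) * \<phi> m)"

locale evaluation =
  fixes \<psi> :: "'b::comm_ring_1 \<Rightarrow> complex" and \<phi> :: "'m::comm_monoid_add \<Rightarrow> complex"
  assumes \<psi>_add: "\<psi> (a + b) = \<psi> a + \<psi> b" and \<psi>_mult: "\<psi> (a * b) = \<psi> a * \<psi> b"
    and \<phi>_add: "\<phi> (m + m') = \<phi> m * \<phi> m'"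
begin

lemma \<psi>_0: "\<psi> 0 = 0"
  using \<psi>_add[of 0 0] by simp

lemma pm_eval_superset:
  assumes "finite S" "Poly_Mapping.keys p \<subseteq> S"
  shows "pm_eval \<psi> \<phi> p = (\<Sum>m\<in>S. \<psi> (Poly_Mapping.lookup p m) * \<phi> m)"
  unfolding pm_eval_def using assms by (intro sum.mono_neutral_left) (auto simp: in_keys_iff \<psi>_0)

lemma pm_eval_add: "pm_eval \<psi> \<phi> (p + q) = pm_eval \<psi> \<phi> p + pm_eval \<psi> \<phi> q"
proof -
  let ?S = "Poly_Mapping.keys p \<union> Poly_Mapping.keys q"
  have "finite ?S" "Poly_Mapping.keys (p + q) \<subseteq> ?S" by (simp, rule Poly_Mapping.keys_add)
  then show ?thesis
    by (simp add: pm_eval_superset[of ?S] lookup_add \<psi>_add distrib_right sum.distrib)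
qed

lemma pm_eval_0: "pm_eval \<psi> \<phi> 0 = 0"
  by (simp add: pm_eval_def)

lemma pm_eval_single: "pm_eval \<psi> \<phi> (Poly_Mapping.single m c) = \<psi> c * \<phi> m"
  by (simp add: pm_eval_def \<psi>_0)

lemma pm_eval_sum: "pm_eval \<psi> \<phi> (\<Sum>a\<in>A. p a) = (\<Sum>a\<in>A. pm_eval \<psi> \<phi> (p a))"
  by (induction A rule: infinite_finite_induct) (auto simp: pm_eval_add pm_eval_0)

end

lemma poly_mapping_expand: "(\<Sum>m\<in>Poly_Mapping.keys p. Poly_Mapping.single m (Poly_Mapping.lookup p m)) = p"
proof (rule poly_mapping_eqI)
  fix k
  have "Poly_Mapping.lookup (\<Sum>m\<in>Poly_Mapping.keys p. Poly_Mapping.single m (Poly_Mapping.lookup p m)) k =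
    (\<Sum>m\<in>Poly_Mapping.keys p. if m = k then Poly_Mapping.lookup p m else 0)"
    by (simp add: lookup_sum lookup_single when_def)
  also have "\<dots> = Poly_Mapping.lookup p k" by (auto simp: in_keys_iff)
  finally show "Poly_Mapping.lookup (\<Sum>m\<in>Poly_Mapping.keys p. Poly_Mapping.single m (Poly_Mapping.lookup p m)) k =
    Poly_Mapping.lookup p k" .
qed

lemma poly_mapping_mult_expand:
  "(p :: 'm::comm_monoid_add \<Rightarrow>\<^sub>0 'b::comm_ring_1) * q = (\<Sum>m\<in>Poly_Mapping.keys p. \<Sum>m'\<in>Poly_Mapping.keys q.
     Poly_Mapping.single (m + m') (Poly_Mapping.lookup p m * Poly_Mapping.lookup q m'))"
proof -
  have "p * q = (\<Sum>m\<in>Poly_Mapping.keys p. Poly_Mapping.single m (Poly_Mapping.lookup p m)) *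
     (\<Sum>m'\<in>Poly_Mapping.keys q. Poly_Mapping.single m' (Poly_Mapping.lookup q m'))"
    by (simp only: poly_mapping_expand)
  then show ?thesis by (simp add: sum_product mult_single)
qed

lemma (in evaluation) pm_eval_mult: "pm_eval \<psi> \<phi> (p * q) = pm_eval \<psi> \<phi> p * pm_eval \<psi> \<phi> q"
  unfolding poly_mapping_mult_expand[of p q] pm_eval_sum pm_eval_single
  by (simp add: pm_eval_def sum_product \<psi>_mult \<phi>_add mult_ac)

definition monomial_at :: "(nat \<Rightarrow> complex) \<Rightarrow> (nat \<Rightarrow>\<^sub>0 nat) \<Rightarrow> complex" where
  "monomial_at x m = (\<Prod>i\<in>Poly_Mapping.keys m. x i ^ Poly_Mapping.lookup m i)"

lemma eval_poly_eq: "eval_poly p x = pm_eval (\<lambda>c. c) (monomial_at x) p"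
  by (simp add: eval_poly_def pm_eval_def monomial_at_def)

lemma monomial_at_superset:
  assumes "finite S" "Poly_Mapping.keys m \<subseteq> S"
  shows "monomial_at x m = (\<Prod>i\<in>S. x i ^ Poly_Mapping.lookup m i)"
  unfolding monomial_at_def using assms by (intro prod.mono_neutral_left) (auto simp: in_keys_iff)

interpretation eval_poly: evaluation "\<lambda>c :: complex. c" "monomial_at x" for x
proof
  fix m m' :: "nat \<Rightarrow>\<^sub>0 nat"
  let ?S = "Poly_Mapping.keys m \<union> Poly_Mapping.keys m'"
  have "finite ?S" "Poly_Mapping.keys (m + m') \<subseteq> ?S" by (simp, rule Poly_Mapping.keys_add)
  then show "monomial_at x (m + m') = monomial_at x m * monomial_at x m'"
    by (simp add: monomial_at_superset[of ?S] lookup_add power_add prod.distrib)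
qed auto

lemma eval_poly_simps [simp]:
  "eval_poly (p + q) x = eval_poly p x + eval_poly q x"
  "eval_poly (p * q) x = eval_poly p x * eval_poly q x"
  "eval_poly 0 x = 0"
  "eval_poly (Poly_Mapping.single 0 c) x = c"
  "eval_poly 1 x = 1"
  "eval_poly (Poly_Mapping.single (Poly_Mapping.single i (Suc 0)) 1) x = x i"
  by (simp_all add: eval_poly_eq eval_poly.pm_eval_add eval_poly.pm_eval_mult eval_poly.pm_eval_0
      eval_poly.pm_eval_single monomial_at_def flip: single_one)

lemma eval_poly_uminus [simp]: "eval_poly (- p) x = - eval_poly p x"
  using eval_poly_simps(1)[of p "- p" x] by (simp del: eval_poly_simps(1) add: eq_neg_iff_add_eq_0 add.commute)

lemma eval_poly_diff [simp]: "eval_poly (p - q) x = eval_poly p x - eval_poly q x"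
  using eval_poly_simps(1)[of p "- q" x] by (simp del: eval_poly_simps(1))

lemma polys_intros:
  "0 \<in> polys N" "1 \<in> polys N" "Poly_Mapping.single 0 c \<in> polys N"
  "i < N \<Longrightarrow> Poly_Mapping.single (Poly_Mapping.single i (Suc 0)) 1 \<in> polys N"
  "p \<in> polys N \<Longrightarrow> - p \<in> polys N"
  by (auto simp: polys_def in_keys_iff split: if_splits)

lemma polys_add: "p \<in> polys N \<Longrightarrow> q \<in> polys N \<Longrightarrow> p + q \<in> polys N"
  using Poly_Mapping.keys_add[of p q] by (auto simp: polys_def)

lemma polys_diff: "p \<in> polys N \<Longrightarrow> q \<in> polys N \<Longrightarrow> p - q \<in> polys N"
  using polys_add[of p N "- q"] polys_intros(5)[of q N] by simp

lemma polys_mult: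
  assumes "p \<in> polys N" "q \<in> polys N"
  shows "p * q \<in> polys N"
  unfolding polys_def
proof safe
  fix m i assume m: "m \<in> Poly_Mapping.keys (p * q)" "i \<in> Poly_Mapping.keys m"
  then obtain a b where ab: "m = a + b" "a \<in> Poly_Mapping.keys p" "b \<in> Poly_Mapping.keys q"
    using Poly_Mapping.keys_mult[of p q] by blast
  then have "i \<in> Poly_Mapping.keys a \<or> i \<in> Poly_Mapping.keys b" using m Poly_Mapping.keys_add[of a b] by blast
  then show "i < N" using ab assms by (auto simp: polys_def)
qed

lemma polys_sum: "(\<And>a. a \<in> A \<Longrightarrow> p a \<in> polys N) \<Longrightarrow> (\<Sum>a\<in>A. p a) \<in> polys N"
  by (induction A rule: infinite_finite_induct) (auto intro: polys_intros polys_add)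

lemma polyfun_eval_poly: "(\<lambda>\<rho>. eval_poly p (\<lambda>i. \<rho> (\<sigma> i))) \<in> polyfun"
  unfolding eval_poly_def
  by (intro polyfun_sum polyfun.mult polyfun_prod polyfun_power polyfun.const polyfun.var)

text \<open>Coordinates from N on are zero on \<open>affine_space N\<close>, so there they are
  represented by the zero polynomial.\<close>

lemma polyfun_imp_polys:
  assumes "h \<in> polyfun"
  shows "\<exists>p\<in>polys N. \<forall>x\<in>affine_space N. h x = eval_poly p x"
  using assms
proof induction
  case (const c)
  show ?case by (rule bexI[of _ "Poly_Mapping.single 0 c"]) (auto intro: polys_intros)
next
  case (var v)
  show ?case
  proof (cases "v < N")
    case True
    then show ?thesis
      by (intro bexI[of _ "Poly_Mapping.single (Poly_Mapping.single v (Suc 0)) 1"]) (auto intro: polys_intros)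
  next
    case False
    then show ?thesis by (intro bexI[of _ 0]) (auto intro: polys_intros simp: affine_space_def)
  qed
next
  case (add f g)
  then obtain p q where "p \<in> polys N" "q \<in> polys N" "\<forall>x\<in>affine_space N. f x = eval_poly p x"
    "\<forall>x\<in>affine_space N. g x = eval_poly q x" by blast
  then show ?case by (intro bexI[of _ "p + q"]) (auto intro: polys_add)
next
  case (mult f g)
  then obtain p q where "p \<in> polys N" "q \<in> polys N" "\<forall>x\<in>affine_space N. f x = eval_poly p x"
    "\<forall>x\<in>affine_space N. g x = eval_poly q x" by blast
  then show ?case by (intro bexI[of _ "p * q"]) (auto intro: polys_mult)
qed

lemma irreducible_variety_affine: "irreducible_variety N V \<Longrightarrow> V \<subseteq> affine_space N"
  by (auto simp: irreducible_variety_def algebraic_set_def)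

text \<open>Otherwise V would be the union of the zero sets of p and q in V, both algebraic and both
  proper.\<close>

lemma irreducible_variety_polys:
  assumes V: "irreducible_variety N V" and pq: "p \<in> polys N" "q \<in> polys N"
    and nz: "\<exists>x\<in>V. eval_poly p x \<noteq> 0" "\<exists>x\<in>V. eval_poly q x \<noteq> 0"
  shows "\<exists>x\<in>V. eval_poly p x \<noteq> 0 \<and> eval_poly q x \<noteq> 0"
proof (rule ccontr)
  assume no: "\<not> ?thesis"
  obtain S where S: "S \<subseteq> polys N" "V = {x \<in> affine_space N. \<forall>p\<in>S. eval_poly p x = 0}"
    using V by (auto simp: irreducible_variety_def algebraic_set_def)
  have "algebraic_set N {x\<in>V. eval_poly r x = 0}" if "r \<in> polys N" for r
    unfolding algebraic_set_def using S that by (intro exI[of _ "insert r S"]) auto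
  moreover have "V = {x\<in>V. eval_poly p x = 0} \<union> {x\<in>V. eval_poly q x = 0}" using no by auto
  ultimately have "{x\<in>V. eval_poly p x = 0} = V \<or> {x\<in>V. eval_poly q x = 0} = V"
    using V pq unfolding irreducible_variety_def by blast
  with nz show False by blast
qed

lemma irreducible_variety_points:
  assumes V: "irreducible_variety N V"
  shows "irreducible_points V"
proof
  show "V \<noteq> {}" using V by (simp add: irreducible_variety_def)
  fix p q :: "(nat \<Rightarrow> complex) \<Rightarrow> complex"
  assume pq: "p \<in> polyfun" "q \<in> polyfun" and nz: "\<exists>x\<in>V. p x \<noteq> 0" "\<exists>x\<in>V. q x \<noteq> 0"
  obtain p' q' where e: "p' \<in> polys N" "q' \<in> polys N" "\<forall>x\<in>affine_space N. p x = eval_poly p' x"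
    "\<forall>x\<in>affine_space N. q x = eval_poly q' x" using polyfun_imp_polys pq by meson
  have ee: "p x = eval_poly p' x" "q x = eval_poly q' x" if "x \<in> V" for x
    using e that irreducible_variety_affine[OF V] by auto
  with irreducible_variety_polys[OF V e(1,2)] nz show "\<exists>x\<in>V. p x \<noteq> 0 \<and> q x \<noteq> 0" by auto
qed

subsection \<open>The function field\<close>

locale variety =
  fixes N V
  assumes V: "irreducible_variety N V"
begin

abbreviation K where "K \<equiv> function_field N V"

lemma fractions_mult:
  assumes "(p, q) \<in> fractions N V" "(p', q') \<in> fractions N V" "r \<in> polys N"
  shows "(r, q * q') \<in> fractions N V"
  using irreducible_variety_polys[OF V, of q q'] assms by (auto simp: fractions_def intro: polys_mult)

lemma fractions_closed:
  assumes "(p, q) \<in> fractions N V" "(p', q') \<in> fractions N V"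
  shows "(p * p', q * q') \<in> fractions N V" "(p * q' + p' * q, q * q') \<in> fractions N V" "(- p, q) \<in> fractions N V"
proof -
  have "p \<in> polys N" "q \<in> polys N" "p' \<in> polys N" "q' \<in> polys N" using assms by (auto simp: fractions_def)
  then show "(p * p', q * q') \<in> fractions N V" "(p * q' + p' * q, q * q') \<in> fractions N V"
    by (auto intro!: fractions_mult[OF assms] polys_mult polys_add)
  show "(- p, q) \<in> fractions N V" using assms by (auto simp: fractions_def polys_intros)
qed

lemma fraction_rel_iff:
  assumes "(p, q) \<in> fractions N V" "(p', q') \<in> fractions N V"
  shows "((p, q), (p', q')) \<in> fraction_rel N V \<longleftrightarrow> (\<forall>x\<in>V. eval_poly p x * eval_poly q' x = eval_poly p' x * eval_poly q x)"
  using assms by (auto simp: fraction_rel_def)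

lemma equiv_fraction_rel: "equiv (fractions N V) (fraction_rel N V)"
proof (rule equivI)
  show "fraction_rel N V \<subseteq> fractions N V \<times> fractions N V" by (auto simp: fraction_rel_def)
  show "refl_on (fractions N V) (fraction_rel N V)"
    by (auto simp: refl_on_def fraction_rel_def)
  show "sym (fraction_rel N V)" by (auto simp: sym_def fraction_rel_def)
  show "trans (fraction_rel N V)"
  proof (rule transI)
    fix a b c assume ab: "(a, b) \<in> fraction_rel N V" "(b, c) \<in> fraction_rel N V"
    obtain p q p' q' r s where e: "a = (p, q)" "b = (p', q')" "c = (r, s)" by (cases a; cases b; cases c)
    have f: "(p, q) \<in> fractions N V" "(p', q') \<in> fractions N V" "(r, s) \<in> fractions N V"
      using ab by (auto simp: e fraction_rel_def)
    \<comment> \<open>Cross multiplication only shows that \<open>?w\<close> times the middle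
      denominator vanishes on V; irreducibility cancels that denominator.\<close>
    let ?w = "p * s - r * q"
    have z: "eval_poly ?w x * eval_poly q' x = 0" if "x \<in> V" for x
    proof -
      have 1: "eval_poly p x * eval_poly q' x = eval_poly p' x * eval_poly q x"
        "eval_poly p' x * eval_poly s x = eval_poly r x * eval_poly q' x"
        using ab that f by (auto simp: e fraction_rel_iff)
      have "eval_poly ?w x * eval_poly q' x =
        (eval_poly p x * eval_poly q' x) * eval_poly s x - (eval_poly r x * eval_poly q' x) * eval_poly q x"
        by (simp add: algebra_simps)
      also have "\<dots> = 0" unfolding 1(1) 1(2)[symmetric] by simp
      finally show ?thesis .
    qed
    have w: "?w \<in> polys N" "q' \<in> polys N" "\<exists>x\<in>V. eval_poly q' x \<noteq> 0"
      using f by (auto simp: fractions_def intro!: polys_diff polys_mult)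
    have "\<forall>x\<in>V. eval_poly ?w x = 0"
    proof (rule ccontr)
      assume "\<not> ?thesis"
      then obtain x where "x \<in> V" "eval_poly ?w x \<noteq> 0" "eval_poly q' x \<noteq> 0"
        using irreducible_variety_polys[OF V w(1,2) _ w(3)] by blast
      with z[of x] show False by simp
    qed
    then show "(a, c) \<in> fraction_rel N V"
      unfolding e fraction_rel_iff[OF f(1,3)] by simp
  qed
qed

lemma mk_frac_eq_iff:
  assumes "(p, q) \<in> fractions N V" "(p', q') \<in> fractions N V"
  shows "mk_frac N V p q = mk_frac N V p' q' \<longleftrightarrow> (\<forall>x\<in>V. eval_poly p x * eval_poly q' x = eval_poly p' x * eval_poly q x)"
  unfolding mk_frac_def eq_equiv_class_iff[OF equiv_fraction_rel assms] fraction_rel_iff[OF assms] ..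

lemma carrier_K: "r \<in> carrier K \<longleftrightarrow> (\<exists>p q. (p, q) \<in> fractions N V \<and> r = mk_frac N V p q)"
  by (auto simp: function_field_def mk_frac_def quotient_def)

lemma mk_frac_in_carrier: "(p, q) \<in> fractions N V \<Longrightarrow> mk_frac N V p q \<in> carrier K"
  by (auto simp: carrier_K)

lemma mem_mk_frac:
  assumes "(p, q) \<in> fractions N V"
  shows "(p', q') \<in> mk_frac N V p q \<longleftrightarrow> (p', q') \<in> fractions N V \<and> mk_frac N V p q = mk_frac N V p' q'"
proof
  assume "(p', q') \<in> mk_frac N V p q"
  then have r: "((p, q), (p', q')) \<in> fraction_rel N V" by (simp add: mk_frac_def)
  then have "(p', q') \<in> fractions N V" by (simp add: fraction_rel_def)
  moreover have "mk_frac N V p q = mk_frac N V p' q'"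
    unfolding mk_frac_def by (rule equiv_class_eq[OF equiv_fraction_rel r])
  ultimately show "(p', q') \<in> fractions N V \<and> mk_frac N V p q = mk_frac N V p' q'" ..
next
  assume "(p', q') \<in> fractions N V \<and> mk_frac N V p q = mk_frac N V p' q'"
  then show "(p', q') \<in> mk_frac N V p q"
    using equiv_class_self[OF equiv_fraction_rel, of "(p', q')"] by (simp add: mk_frac_def)
qed

lemma mk_frac_self: "(p, q) \<in> fractions N V \<Longrightarrow> (p, q) \<in> mk_frac N V p q"
  by (simp add: mem_mk_frac)

text \<open>\<open>function_field\<close> multiplies classes by a union over all representatives.
  Products of equivalent fractions are equivalent, so the union is a single class.\<close>

lemma K_mult:
  assumes "(p, q) \<in> fractions N V" "(p', q') \<in> fractions N V"
  shows "mk_frac N V p q \<otimes>\<^bsub>K\<^esub> mk_frac N V p' q' = mk_frac N V (p * p') (q * q')"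
proof -
  have "mk_frac N V (a * a') (b * b') = mk_frac N V (p * p') (q * q')"
    if "(a, b) \<in> mk_frac N V p q" "(a', b') \<in> mk_frac N V p' q'" for a b a' b'
  proof -
    have f: "(a, b) \<in> fractions N V" "(a', b') \<in> fractions N V" and
      e: "\<forall>x\<in>V. eval_poly p x * eval_poly b x = eval_poly a x * eval_poly q x"
        "\<forall>x\<in>V. eval_poly p' x * eval_poly b' x = eval_poly a' x * eval_poly q' x"
      using that assms by (auto simp: mem_mk_frac mk_frac_eq_iff)
    have "(a * a', b * b') \<in> fractions N V" "(p * p', q * q') \<in> fractions N V"
      using f assms by (auto intro: fractions_closed)
    moreover have "eval_poly a x * eval_poly a' x * (eval_poly q x * eval_poly q' x)
      = eval_poly p x * eval_poly p' x * (eval_poly b x * eval_poly b' x)" (is "?l = ?r") if "x \<in> V" for x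
    proof -
      have "?l = (eval_poly a x * eval_poly q x) * (eval_poly a' x * eval_poly q' x)" by (simp add: algebra_simps)
      also have "\<dots> = (eval_poly p x * eval_poly b x) * (eval_poly p' x * eval_poly b' x)" using e that by simp
      also have "\<dots> = ?r" by (simp add: algebra_simps)
      finally show ?thesis .
    qed
    ultimately show ?thesis by (simp add: mk_frac_eq_iff)
  qed
  moreover have "(p, q) \<in> mk_frac N V p q" "(p', q') \<in> mk_frac N V p' q'" using assms by (auto intro: mk_frac_self)
  ultimately show ?thesis unfolding function_field_def monoid.simps by fast
qed

lemma K_add:
  assumes "(p, q) \<in> fractions N V" "(p', q') \<in> fractions N V"
  shows "mk_frac N V p q \<oplus>\<^bsub>K\<^esub> mk_frac N V p' q' = mk_frac N V (p * q' + p' * q) (q * q')"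
proof -
  have "mk_frac N V (a * b' + a' * b) (b * b') = mk_frac N V (p * q' + p' * q) (q * q')"
    if "(a, b) \<in> mk_frac N V p q" "(a', b') \<in> mk_frac N V p' q'" for a b a' b'
  proof -
    have f: "(a, b) \<in> fractions N V" "(a', b') \<in> fractions N V" and
      e: "\<forall>x\<in>V. eval_poly p x * eval_poly b x = eval_poly a x * eval_poly q x"
        "\<forall>x\<in>V. eval_poly p' x * eval_poly b' x = eval_poly a' x * eval_poly q' x"
      using that assms by (auto simp: mem_mk_frac mk_frac_eq_iff)
    have "(a * b' + a' * b, b * b') \<in> fractions N V" "(p * q' + p' * q, q * q') \<in> fractions N V"
      using f assms by (auto intro: fractions_closed)
    moreover have "(eval_poly a x * eval_poly b' x + eval_poly a' x * eval_poly b x) * (eval_poly q x * eval_poly q' x)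
      = (eval_poly p x * eval_poly q' x + eval_poly p' x * eval_poly q x) * (eval_poly b x * eval_poly b' x)" (is "?l = ?r") if "x \<in> V" for x
    proof -
      have "?l = (eval_poly a x * eval_poly q x) * eval_poly b' x * eval_poly q' x + (eval_poly a' x * eval_poly q' x) * eval_poly b x * eval_poly q x"
        by (simp add: algebra_simps)
      also have "\<dots> = (eval_poly p x * eval_poly b x) * eval_poly b' x * eval_poly q' x + (eval_poly p' x * eval_poly b' x) * eval_poly b x * eval_poly q x"
        using e that by simp
      also have "\<dots> = ?r" by (simp add: algebra_simps)
      finally show ?thesis .
    qed
    ultimately show ?thesis by (simp add: mk_frac_eq_iff)
  qed
  moreover have "(p, q) \<in> mk_frac N V p q" "(p', q') \<in> mk_frac N V p' q'" using assms by (auto intro: mk_frac_self)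
  ultimately show ?thesis unfolding function_field_def ring.simps by fast
qed

lemma one_fraction: "p \<in> polys N \<Longrightarrow> (p, 1) \<in> fractions N V"
  using V by (auto simp: fractions_def polys_intros irreducible_variety_def)

lemma K_zero: "\<zero>\<^bsub>K\<^esub> = mk_frac N V 0 1" and K_one: "\<one>\<^bsub>K\<^esub> = mk_frac N V 1 1"
  by (simp_all add: function_field_def)

lemma ring_K: "ring K"
proof (rule ringI)
  show "abelian_group K"
  proof (rule abelian_groupI)
    fix x assume "x \<in> carrier K"
    then obtain p q where x: "(p, q) \<in> fractions N V" "x = mk_frac N V p q" by (auto simp: carrier_K)
    have m: "(- p, q) \<in> fractions N V" using fractions_closed(3)[OF x(1) x(1)] .
    have "mk_frac N V (- p * q + p * q) (q * q) = mk_frac N V 0 1"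
      by (subst mk_frac_eq_iff[OF fractions_closed(2)[OF m x(1)] one_fraction]) (auto simp: polys_intros)
    then have "mk_frac N V (- p) q \<oplus>\<^bsub>K\<^esub> x = \<zero>\<^bsub>K\<^esub>"
      unfolding x(2) K_add[OF m x(1)] K_zero .
    with mk_frac_in_carrier[OF m] show "\<exists>y\<in>carrier K. y \<oplus>\<^bsub>K\<^esub> x = \<zero>\<^bsub>K\<^esub>" by blast
  next
    fix x y assume "x \<in> carrier K" "y \<in> carrier K"
    then obtain p q p' q' where "(p, q) \<in> fractions N V" "(p', q') \<in> fractions N V"
      "x = mk_frac N V p q" "y = mk_frac N V p' q'" by (auto simp: carrier_K)
    then show "x \<oplus>\<^bsub>K\<^esub> y \<in> carrier K" "x \<oplus>\<^bsub>K\<^esub> y = y \<oplus>\<^bsub>K\<^esub> x"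
      by (auto simp: K_add fractions_closed mk_frac_eq_iff algebra_simps intro!: mk_frac_in_carrier)
  next
    fix x y z assume "x \<in> carrier K" "y \<in> carrier K" "z \<in> carrier K"
    then show "x \<oplus>\<^bsub>K\<^esub> y \<oplus>\<^bsub>K\<^esub> z = x \<oplus>\<^bsub>K\<^esub> (y \<oplus>\<^bsub>K\<^esub> z)"
      unfolding carrier_K by (auto simp: K_add fractions_closed mk_frac_eq_iff algebra_simps)
  qed (auto simp: carrier_K K_zero K_add mk_frac_eq_iff one_fraction polys_intros fractions_closed intro!: exI)
  show "monoid K"
  proof (rule monoidI)
    fix x y assume "x \<in> carrier K" "y \<in> carrier K"
    then obtain p q p' q' where "(p, q) \<in> fractions N V" "(p', q') \<in> fractions N V"
      "x = mk_frac N V p q" "y = mk_frac N V p' q'" by (auto simp: carrier_K)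
    then show "x \<otimes>\<^bsub>K\<^esub> y \<in> carrier K"
      by (auto simp: K_mult intro!: mk_frac_in_carrier fractions_closed)
  next
    fix x y z assume "x \<in> carrier K" "y \<in> carrier K" "z \<in> carrier K"
    then show "x \<otimes>\<^bsub>K\<^esub> y \<otimes>\<^bsub>K\<^esub> z = x \<otimes>\<^bsub>K\<^esub> (y \<otimes>\<^bsub>K\<^esub> z)"
      unfolding carrier_K by (auto simp: K_mult fractions_closed mk_frac_eq_iff algebra_simps)
  qed (auto simp: carrier_K K_one K_mult mk_frac_eq_iff one_fraction polys_intros fractions_closed intro!: exI)
  fix x y z assume "x \<in> carrier K" "y \<in> carrier K" "z \<in> carrier K"
  then obtain p q p' q' r s where e: "x = mk_frac N V p q" "y = mk_frac N V p' q'" "z = mk_frac N V r s" and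
    f: "(p, q) \<in> fractions N V" "(p', q') \<in> fractions N V" "(r, s) \<in> fractions N V" by (auto simp: carrier_K)
  note c = fractions_closed(1,2)
  show "(x \<oplus>\<^bsub>K\<^esub> y) \<otimes>\<^bsub>K\<^esub> z = x \<otimes>\<^bsub>K\<^esub> z \<oplus>\<^bsub>K\<^esub> y \<otimes>\<^bsub>K\<^esub> z"
    unfolding e K_add[OF f(1,2)] K_mult[OF c(2)[OF f(1,2)] f(3)] K_mult[OF f(1,3)] K_mult[OF f(2,3)]
      K_add[OF c(1)[OF f(1,3)] c(1)[OF f(2,3)]]
      mk_frac_eq_iff[OF c(1)[OF c(2)[OF f(1,2)] f(3)] c(2)[OF c(1)[OF f(1,3)] c(1)[OF f(2,3)]]]
    by simp (simp add: algebra_simps)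
  show "z \<otimes>\<^bsub>K\<^esub> (x \<oplus>\<^bsub>K\<^esub> y) = z \<otimes>\<^bsub>K\<^esub> x \<oplus>\<^bsub>K\<^esub> z \<otimes>\<^bsub>K\<^esub> y"
    unfolding e K_add[OF f(1,2)] K_mult[OF f(3) c(2)[OF f(1,2)]] K_mult[OF f(3,1)] K_mult[OF f(3,2)]
      K_add[OF c(1)[OF f(3,1)] c(1)[OF f(3,2)]]
      mk_frac_eq_iff[OF c(1)[OF f(3) c(2)[OF f(1,2)]] c(2)[OF c(1)[OF f(3,1)] c(1)[OF f(3,2)]]]
    by simp (simp add: algebra_simps)
qed

text \<open>Two fractions in one class with nonzero denominators at x agree there by cross
  multiplication, so the description in \<open>value_at\<close> is unique.\<close>

lemma value_at_mk_frac:
  assumes "(p, q) \<in> fractions N V" "x \<in> V" "eval_poly q x \<noteq> 0"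
  shows "value_at (mk_frac N V p q) x = eval_poly p x / eval_poly q x"
  unfolding value_at_def
proof (rule the_equality)
  show "\<exists>(p', q')\<in>mk_frac N V p q. eval_poly q' x \<noteq> 0 \<and> eval_poly p x / eval_poly q x = eval_poly p' x / eval_poly q' x"
    using assms mk_frac_self by blast
  fix w assume "\<exists>(p', q')\<in>mk_frac N V p q. eval_poly q' x \<noteq> 0 \<and> w = eval_poly p' x / eval_poly q' x"
  then obtain p' q' where "(p', q') \<in> mk_frac N V p q" "eval_poly q' x \<noteq> 0" "w = eval_poly p' x / eval_poly q' x" by blast
  then show "w = eval_poly p x / eval_poly q x"
    using assms by (auto simp: mem_mk_frac mk_frac_eq_iff frac_eq_eq)
qed

lemma regular_at_mk_frac: "(p, q) \<in> fractions N V \<Longrightarrow> eval_poly q x \<noteq> 0 \<Longrightarrow> regular_at (mk_frac N V p q) x"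
  unfolding regular_at_def using mk_frac_self by blast

end

subsection \<open>Algebraic dependence near a point\<close>

text \<open>Induction on the unknowns: the monomials with one fixed power of v, chosen to contain a
  nonzero coefficient, form a nonzero polynomial in the others. At a point where it does not vanish,
  a nonzero polynomial in v remains.\<close>

lemma multiset_polynomial_nonzero:
  fixes c :: "'i multiset \<Rightarrow> complex"
  assumes "finite S" "finite A" "\<And>m. m \<in> A \<Longrightarrow> set_mset m \<subseteq> S" "\<exists>m\<in>A. c m \<noteq> 0"
  shows "\<exists>x. (\<Sum>m\<in>A. c m * (\<Prod>i\<in>#m. x i)) \<noteq> 0"
  using assms
proof (induction S arbitrary: A c)
  case empty
  then have "m = {#}" if "m \<in> A" for m using that by auto
  with empty have "A = {{#}}" "c {#} \<noteq> 0" by auto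
  then show ?case by simp
next
  case (insert v S)
  define rm where "rm = (\<lambda>m. filter_mset (\<lambda>i. i \<noteq> v) m)"
  have split: "(\<Prod>i\<in>#m. x i) = x v ^ count m v * (\<Prod>i\<in>#rm m. x i)" for m and x :: "'i \<Rightarrow> complex"
  proof -
    have "m = filter_mset (\<lambda>i. i = v) m + rm m" unfolding rm_def by (simp add: multiset_partition[symmetric])
    then have "m = replicate_mset (count m v) v + rm m" by (simp add: filter_eq_replicate_mset)
    then have "(\<Prod>i\<in>#m. x i) = (\<Prod>i\<in>#replicate_mset (count m v) v + rm m. x i)" by simp
    then show ?thesis by simp
  qed
  obtain m0 where m0: "m0 \<in> A" "c m0 \<noteq> 0" using insert.prems by blast
  define k0 where "k0 = count m0 v"
  define B where "B = {m\<in>A. count m v = k0}"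
  \<comment> \<open>Once the power of v is fixed, deleting v loses no information.\<close>
  have inj: "inj_on rm B"
  proof (rule inj_onI)
    fix m m' assume "m \<in> B" "m' \<in> B" "rm m = rm m'"
    then show "m = m'" unfolding B_def rm_def
      by (intro multiset_eqI) (metis (mono_tags, lifting) count_filter_mset mem_Collect_eq)
  qed
  define c' where "c' = (\<lambda>m. c (inv_into B rm m))"
  have c': "c' (rm m) = c m" if "m \<in> B" for m using that inj by (simp add: c'_def)
  have "finite (rm ` B)" using insert.prems by (simp add: B_def)
  moreover have "set_mset m \<subseteq> S" if "m \<in> rm ` B" for m
  proof -
    obtain m' where m': "m' \<in> A" "m = rm m'" using \<open>m \<in> rm ` B\<close> by (auto simp: B_def)
    then have "set_mset m' \<subseteq> insert v S" using insert.prems by blast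
    with m' show ?thesis by (auto simp: rm_def)
  qed
  moreover have "\<exists>m\<in>rm ` B. c' m \<noteq> 0" using m0 c' by (auto simp: B_def k0_def)
  ultimately obtain x where x: "(\<Sum>m\<in>rm ` B. c' m * (\<Prod>i\<in>#m. x i)) \<noteq> 0"
    using insert.IH[of "rm ` B" c'] by blast
  have x': "(\<Sum>m\<in>B. c m * (\<Prod>i\<in>#rm m. x i)) \<noteq> 0"
    using x unfolding sum.reindex[OF inj] by (simp add: c' cong: sum.cong)
  define P where "P = (\<Sum>m\<in>A. Polynomial.monom (c m * (\<Prod>i\<in>#rm m. x i)) (count m v))"
  have "Polynomial.coeff P k0 = (\<Sum>m\<in>A. if count m v = k0 then c m * (\<Prod>i\<in>#rm m. x i) else 0)"
    by (simp add: P_def Polynomial.coeff_sum)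
  also have "\<dots> = (\<Sum>m\<in>B. c m * (\<Prod>i\<in>#rm m. x i))"
    unfolding B_def using insert.prems(1) by (simp add: sum.inter_filter)
  finally have "P \<noteq> 0" using x' by auto
  then obtain s where s: "poly P s \<noteq> 0" by (metis poly_all_0_iff_0)
  have "(\<Sum>m\<in>A. c m * (\<Prod>i\<in>#m. (x(v := s)) i)) = poly P s"
    unfolding P_def poly_sum poly_monom
  proof (rule sum.cong)
    fix m
    have "image_mset (x(v := s)) (rm m) = image_mset x (rm m)" by (rule image_mset_cong) (auto simp: rm_def)
    then show "c m * (\<Prod>i\<in>#m. (x(v := s)) i) = c m * (\<Prod>i\<in>#rm m. x i) * s ^ count m v"
      unfolding split[of "x(v := s)" m] \<open>image_mset (x(v := s)) (rm m) = image_mset x (rm m)\<close> by simp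
  qed simp
  with s show ?case by metis
qed

lemma polyfun_mset_prod: "(\<lambda>\<rho>. \<Prod>i\<in>#m. \<rho> (\<sigma> i)) \<in> polyfun"
  by (induction m) (auto intro: polyfun.intros)

text \<open>The relation in \<open>alg_independent_near\<close> is summed over the support of p, and
  this sum has its intended meaning because the support is finite.\<close>

lemma (in ring) indexed_pset_support:
  assumes "p \<in> indexed_pset I (carrier R)"
  shows "(\<forall>m. p m \<in> carrier R) \<and> finite {m. p m \<noteq> \<zero>} \<and> (\<forall>m. p m \<noteq> \<zero> \<longrightarrow> set_mset m \<subseteq> I)"
  using assms
proof induction
  case (indexed_const k)
  have "{m. indexed_const k m \<noteq> \<zero>} \<subseteq> {{#}}" by (auto simp: indexed_const_def)
  with indexed_const show ?case by (auto simp: indexed_const_def intro: finite_subset)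
next
  case (indexed_padd P Q)
  have nz: "P m \<noteq> \<zero> \<or> Q m \<noteq> \<zero>" if "indexed_padd P Q m \<noteq> \<zero>" for m
    using that by (auto simp: indexed_padd_def)
  then have "{m. indexed_padd P Q m \<noteq> \<zero>} \<subseteq> {m. P m \<noteq> \<zero>} \<union> {m. Q m \<noteq> \<zero>}" by blast
  moreover have "finite ({m. P m \<noteq> \<zero>} \<union> {m. Q m \<noteq> \<zero>})" using indexed_padd by simp
  ultimately have "finite {m. indexed_padd P Q m \<noteq> \<zero>}" by (rule finite_subset)
  moreover have "indexed_padd P Q m \<in> carrier R" for m using indexed_padd by (simp add: indexed_padd_def)
  moreover have "set_mset m \<subseteq> I" if "indexed_padd P Q m \<noteq> \<zero>" for m
    using nz[OF that] indexed_padd by blast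
  ultimately show ?case by blast
next
  case (indexed_pmult P i)
  have nz: "i \<in># m \<and> P (m - {#i#}) \<noteq> \<zero>" if "indexed_pmult P i m \<noteq> \<zero>" for m
    using that by (simp add: indexed_pmult_def split: if_splits)
  have "{m. indexed_pmult P i m \<noteq> \<zero>} \<subseteq> add_mset i ` {m. P m \<noteq> \<zero>}"
  proof
    fix m assume "m \<in> {m. indexed_pmult P i m \<noteq> \<zero>}"
    with nz have "m = add_mset i (m - {#i#})" "m - {#i#} \<in> {m. P m \<noteq> \<zero>}" by auto
    then show "m \<in> add_mset i ` {m. P m \<noteq> \<zero>}" by (rule image_eqI)
  qed
  moreover have "finite (add_mset i ` {m. P m \<noteq> \<zero>})" using indexed_pmult by simp
  ultimately have "finite {m. indexed_pmult P i m \<noteq> \<zero>}" by (rule finite_subset)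
  moreover have "indexed_pmult P i m \<in> carrier R" for m using indexed_pmult by (simp add: indexed_pmult_def)
  moreover have "set_mset m \<subseteq> I" if "indexed_pmult P i m \<noteq> \<zero>" for m
  proof -
    have "m = add_mset i (m - {#i#})" using nz[OF that] by simp
    then have "set_mset m = insert i (set_mset (m - {#i#}))" by (metis set_mset_add_mset_insert)
    moreover have "set_mset (m - {#i#}) \<subseteq> I" using nz[OF that] indexed_pmult by blast
    ultimately show ?thesis using indexed_pmult by simp
  qed
  ultimately show ?case by blast
qed

lemma (in ring) indexed_pset_monomial:
  assumes "k \<in> carrier R" "set_mset m \<subseteq> I"
  shows "(\<lambda>m'. if m' = m then k else \<zero>) \<in> indexed_pset I (carrier R)"
  using assms(2)
proof (induction m)
  case empty
  then show ?case using indexed_pset.indexed_const[OF assms(1), of I] by (simp add: indexed_const_def)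
next
  case (add i m)
  then have "indexed_pmult (\<lambda>m'. if m' = m then k else \<zero>) i \<in> indexed_pset I (carrier R)"
    by (intro indexed_pset.indexed_pmult) auto
  moreover have "indexed_pmult (\<lambda>m'. if m' = m then k else \<zero>) i = (\<lambda>m'. if m' = add_mset i m then k else \<zero>)"
    by (auto simp: indexed_pmult_def fun_eq_iff)
  ultimately show ?case by simp
qed

text \<open>Induction on the support: setting one coefficient to zero splits off a monomial.\<close>

lemma (in ring) indexed_psetI:
  assumes "finite S" "\<And>m. m \<notin> S \<Longrightarrow> p m = \<zero>" "\<And>m. p m \<in> carrier R" "\<And>m. m \<in> S \<Longrightarrow> set_mset m \<subseteq> I"
  shows "p \<in> indexed_pset I (carrier R)"
  using assms
proof (induction S arbitrary: p)
  case empty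
  then have "p = indexed_const \<zero>" by (auto simp: indexed_zero_def)
  then show ?case using indexed_pset.indexed_const[OF zero_closed] by simp
next
  case (insert m S)
  let ?q = "p(m := \<zero>)" and ?k = "\<lambda>m'. if m' = m then p m else \<zero>"
  have "?q \<in> indexed_pset I (carrier R)" using insert by (intro insert.IH) auto
  moreover have "?k \<in> indexed_pset I (carrier R)" using insert by (intro indexed_pset_monomial) auto
  moreover have "p = indexed_padd ?q ?k" using insert by (auto simp: indexed_padd_def fun_eq_iff)
  ultimately show ?case using indexed_pset.indexed_padd by metis
qed

context variety
begin

lemma K_carrier_fraction:
  assumes "r \<in> carrier K"
  obtains p q where "(p, q) \<in> fractions N V" "r = mk_frac N V p q"
  using assms carrier_K by blast

text \<open>A relation over the function field is cleared of its denominators.  At the zeros of the common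
  denominator, where the given relation says nothing, the cleared one holds trivially.\<close>

lemma polyfun_relation_of_dependent:
  assumes dep: "\<not> alg_independent_near N V P D I f"
  obtains U h where "openin (top_of_set V) U" "P \<in> U" "h \<in> polyfun" "nonzero_on V h"
    "\<And>\<rho>. (\<lambda>j. \<rho> (Inl j)) \<in> U \<inter> D \<Longrightarrow> (\<And>i. i \<in> I \<Longrightarrow> \<rho> (Inr i) = f i (\<lambda>j. \<rho> (Inl j))) \<Longrightarrow> h \<rho> = 0"
proof -
  interpret K: ring K by (rule ring_K)
  obtain p U where p: "p \<in> K.indexed_pset I (carrier K)" "p \<noteq> K.indexed_const \<zero>\<^bsub>K\<^esub>" and
    U: "openin (top_of_set V) U" "P \<in> U" and
    rel: "\<And>Q. Q \<in> U \<inter> D \<Longrightarrow> (\<forall>m. regular_at (p m) Q) \<Longrightarrow>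
      (\<Sum>m | p m \<noteq> \<zero>\<^bsub>K\<^esub>. value_at (p m) Q * (\<Prod>i\<in>#m. f i Q)) = 0"
    using dep unfolding alg_independent_near_def Let_def by blast
  define S where "S = {m. p m \<noteq> \<zero>\<^bsub>K\<^esub>}"
  have supp: "p m \<in> carrier K" "finite S" "m \<in> S \<Longrightarrow> set_mset m \<subseteq> I" for m
    using K.indexed_pset_support[OF p(1)] by (auto simp: S_def)
  have "\<forall>m. \<exists>c. fst c \<in> polys N \<and> c \<in> fractions N V \<and> p m = mk_frac N V (fst c) (snd c)"
  proof
    fix m
    obtain a b where "(a, b) \<in> fractions N V" "p m = mk_frac N V a b"
      using K_carrier_fraction[OF supp(1)[of m]] by blast
    then show "\<exists>c. fst c \<in> polys N \<and> c \<in> fractions N V \<and> p m = mk_frac N V (fst c) (snd c)"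
      by (intro exI[of _ "(a, b)"]) (auto simp: fractions_def)
  qed
  from choice[OF this] obtain c where c: "\<forall>m. fst (c m) \<in> polys N \<and> c m \<in> fractions N V \<and> p m = mk_frac N V (fst (c m)) (snd (c m))"
    by blast
  define a where "a = (\<lambda>m. fst (c m))"
  define b where "b = (\<lambda>m. snd (c m))"
  have ab: "(a m, b m) \<in> fractions N V" "p m = mk_frac N V (a m) (b m)" for m
    using c by (simp_all add: a_def b_def)
  have ab_polys: "a m \<in> polys N" "b m \<in> polys N" "\<exists>x\<in>V. eval_poly (b m) x \<noteq> 0" for m
    using ab(1)[of m] by (auto simp: fractions_def)
  \<comment> \<open>The common denominator and r are nonzero at a common point: the denominators are
    merged into r one after the other, using irreducibility each time.\<close>
  have prod_nz: "\<exists>x\<in>V. (\<Prod>m\<in>S'. eval_poly (b m) x) \<noteq> 0 \<and> eval_poly r x \<noteq> 0"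
    if "finite S'" "r \<in> polys N" "\<exists>x\<in>V. eval_poly r x \<noteq> 0" for S' r
    using that
  proof (induction S' arbitrary: r)
    case (insert m S')
    have "\<exists>x\<in>V. eval_poly (b m * r) x \<noteq> 0"
      using irreducible_variety_polys[OF V ab_polys(2) insert.prems(1) ab_polys(3) insert.prems(2)] by simp
    with insert.IH[of "b m * r"] insert polys_mult[OF ab_polys(2)[of m] insert.prems(1)] show ?case by auto
  qed simp
  \<comment> \<open>The numerator belonging to m over the common denominator.\<close>
  define e where "e = (\<lambda>m Q. eval_poly (a m) Q * (\<Prod>m'\<in>S - {m}. eval_poly (b m') Q))"
  define h where "h = (\<lambda>\<rho>. (\<Prod>m\<in>S. eval_poly (b m) (\<lambda>j. \<rho> (Inl j))) *
    (\<Sum>m\<in>S. e m (\<lambda>j. \<rho> (Inl j)) * (\<Prod>i\<in>#m. \<rho> (Inr i))))"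
  have "h \<in> polyfun"
    unfolding h_def e_def
    by (intro polyfun.mult polyfun_sum polyfun_prod polyfun_mset_prod polyfun_eval_poly)
  moreover have "nonzero_on V h"
  proof -
    obtain m0 where m0: "m0 \<in> S" using p(2) by (auto simp: S_def K.indexed_zero_def fun_eq_iff)
    have "\<exists>x\<in>V. eval_poly (a m0) x \<noteq> 0"
    proof (rule ccontr)
      assume "\<not> ?thesis"
      then have "mk_frac N V (a m0) (b m0) = mk_frac N V 0 1"
        using ab(1) by (subst mk_frac_eq_iff) (auto intro: one_fraction polys_intros)
      with m0 ab(2)[of m0] show False by (simp add: S_def K_zero)
    qed
    from prod_nz[OF supp(2) ab_polys(1) this] obtain Q where
      Q: "Q \<in> V" "(\<Prod>m\<in>S. eval_poly (b m) Q) \<noteq> 0" "eval_poly (a m0) Q \<noteq> 0" by blast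
    have "eval_poly (b m) Q \<noteq> 0" if "m \<in> S" for m using Q(2) supp(2) that by auto
    then have "e m0 Q \<noteq> 0" using Q(3) supp(2) by (auto simp: e_def)
    then have "\<exists>x. (\<Sum>m\<in>S. e m Q * (\<Prod>i\<in>#m. x i)) \<noteq> 0"
      using m0 supp(2) by (intro multiset_polynomial_nonzero[of "\<Union>m\<in>S. set_mset m"]) auto
    then obtain x where "(\<Sum>m\<in>S. e m Q * (\<Prod>i\<in>#m. x i)) \<noteq> 0" by blast
    with Q show ?thesis by (intro bexI[of _ "case_sum Q x"]) (simp_all add: h_def points_def)
  qed
  moreover have "h \<rho> = 0" if \<rho>: "(\<lambda>j. \<rho> (Inl j)) \<in> U \<inter> D" "\<And>i. i \<in> I \<Longrightarrow> \<rho> (Inr i) = f i (\<lambda>j. \<rho> (Inl j))" for \<rho>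
  proof (cases "\<exists>m\<in>S. eval_poly (b m) (\<lambda>j. \<rho> (Inl j)) = 0")
    case True
    then have "(\<Prod>m\<in>S. eval_poly (b m) (\<lambda>j. \<rho> (Inl j))) = 0" using supp(2) by auto
    then show ?thesis by (simp add: h_def)
  next
    case False
    let ?Q = "\<lambda>j. \<rho> (Inl j)"
    have QV: "?Q \<in> V" using \<rho>(1) openin_imp_subset[OF U(1)] by auto
    \<comment> \<open>The given relation asks for regularity of every coefficient, also of the zero
      ones outside the support, which are represented by 0/1.\<close>
    have "regular_at (p m) ?Q" for m
    proof (cases "m \<in> S")
      case True
      then show ?thesis using False ab regular_at_mk_frac by simp
    next
      case m: False
      then have "p m = mk_frac N V 0 1" by (simp add: S_def K_zero)
      then show ?thesis using regular_at_mk_frac[OF one_fraction[OF polys_intros(1)]] by simp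
    qed
    with rel \<rho>(1) have r: "(\<Sum>m\<in>S. value_at (p m) ?Q * (\<Prod>i\<in>#m. f i ?Q)) = 0" by (simp add: S_def)
    have "(\<Sum>m\<in>S. e m ?Q * (\<Prod>i\<in>#m. \<rho> (Inr i))) =
      (\<Sum>m\<in>S. (\<Prod>m\<in>S. eval_poly (b m) ?Q) * (value_at (p m) ?Q * (\<Prod>i\<in>#m. f i ?Q)))"
    proof (rule sum.cong)
      fix m assume m: "m \<in> S"
      have "(\<Prod>i\<in>#m. \<rho> (Inr i)) = (\<Prod>i\<in>#m. f i ?Q)"
        using supp(3)[OF m] \<rho>(2) by (intro arg_cong[of _ _ prod_mset] image_mset_cong) auto
      moreover have "e m ?Q = (\<Prod>m\<in>S. eval_poly (b m) ?Q) * value_at (p m) ?Q"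
        using m False supp(2) unfolding ab(2)[of m] value_at_mk_frac[OF ab(1) QV False[simplified, rule_format, OF m]]
        by (simp add: e_def prod.remove)
      ultimately show "e m ?Q * (\<Prod>i\<in>#m. \<rho> (Inr i)) = (\<Prod>m\<in>S. eval_poly (b m) ?Q) * (value_at (p m) ?Q * (\<Prod>i\<in>#m. f i ?Q))"
        by simp
    qed simp
    also have "\<dots> = 0" unfolding sum_distrib_left[symmetric] r by simp
    finally show ?thesis by (simp add: h_def)
  qed
  ultimately show ?thesis using that U by blast
qed

text \<open>Unknowns outside I may occur in h but not in an indexed polynomial, so they are frozen
  at constants \<open>y0\<close>. One polynomial R serves all x and y, so its coefficients can be
  read as functions on V.\<close>

lemma polyfun_expand:
  fixes h :: "(nat + 'i \<Rightarrow> complex) \<Rightarrow> complex"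
  assumes "h \<in> polyfun"
  shows "\<exists>R :: 'i multiset \<Rightarrow>\<^sub>0 cpoly. (\<forall>m. Poly_Mapping.lookup R m \<in> polys N) \<and>
    (\<forall>m\<in>Poly_Mapping.keys R. set_mset m \<subseteq> I) \<and> (\<forall>x\<in>affine_space N. \<forall>y.
      h (case_sum x (\<lambda>i. if i \<in> I then y i else y0 i)) = pm_eval (\<lambda>c. eval_poly c x) (\<lambda>m. \<Prod>i\<in>#m. y i) R)"
  using assms
proof induction
  have ev: "evaluation (\<lambda>c. eval_poly c x) (\<lambda>m. \<Prod>i\<in>#m. y i)" for x and y :: "'i \<Rightarrow> complex"
    by standard auto
  note ev_simps = evaluation.pm_eval_single[OF ev] evaluation.pm_eval_add[OF ev] evaluation.pm_eval_mult[OF ev]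
  have single: "Poly_Mapping.lookup (Poly_Mapping.single m' c) m \<in> polys N" if "c \<in> polys N" for m m' :: "'i multiset" and c
    using that by (simp add: lookup_single when_def polys_intros)
  {
    case (const c)
    show ?case
      by (rule exI[of _ "Poly_Mapping.single {#} (Poly_Mapping.single 0 c)"]) (auto simp: ev_simps single polys_intros)
  next
    case (var v)
    show ?case
    proof (cases v)
      case (Inl j)
      obtain p where p: "p \<in> polys N" "\<forall>x\<in>affine_space N. x j = eval_poly p x"
        using polyfun_imp_polys[OF polyfun.var[of j]] by blast
      then show ?thesis
        by (intro exI[of _ "Poly_Mapping.single {#} p"]) (auto simp: Inl ev_simps single)
    next
      case (Inr i)
      show ?thesis
      proof (cases "i \<in> I")
        case True
        then show ?thesis
          by (intro exI[of _ "Poly_Mapping.single {#i#} 1"]) (auto simp: Inr ev_simps single polys_intros)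
      next
        case False
        then show ?thesis
          by (intro exI[of _ "Poly_Mapping.single {#} (Poly_Mapping.single 0 (y0 i))"])
            (auto simp: Inr ev_simps single polys_intros)
      qed
    qed
  next
    case (add f g)
    then obtain R S where RS: "\<forall>m. Poly_Mapping.lookup R m \<in> polys N" "\<forall>m. Poly_Mapping.lookup S m \<in> polys N"
      "\<forall>m\<in>Poly_Mapping.keys R. set_mset m \<subseteq> I" "\<forall>m\<in>Poly_Mapping.keys S. set_mset m \<subseteq> I"
      "\<forall>x\<in>affine_space N. \<forall>y. f (case_sum x (\<lambda>i. if i \<in> I then y i else y0 i)) = pm_eval (\<lambda>c. eval_poly c x) (\<lambda>m. \<Prod>i\<in>#m. y i) R"
      "\<forall>x\<in>affine_space N. \<forall>y. g (case_sum x (\<lambda>i. if i \<in> I then y i else y0 i)) = pm_eval (\<lambda>c. eval_poly c x) (\<lambda>m. \<Prod>i\<in>#m. y i) S"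
      by blast
    have "\<forall>m\<in>Poly_Mapping.keys (R + S). set_mset m \<subseteq> I"
      using RS(3,4) Poly_Mapping.keys_add[of R S] by blast
    with RS(1,2,5,6) show ?case
      by (intro exI[of _ "R + S"]) (simp add: ev_simps lookup_add polys_add)
  next
    case (mult f g)
    then obtain R S where RS: "\<forall>m. Poly_Mapping.lookup R m \<in> polys N" "\<forall>m. Poly_Mapping.lookup S m \<in> polys N"
      "\<forall>m\<in>Poly_Mapping.keys R. set_mset m \<subseteq> I" "\<forall>m\<in>Poly_Mapping.keys S. set_mset m \<subseteq> I"
      "\<forall>x\<in>affine_space N. \<forall>y. f (case_sum x (\<lambda>i. if i \<in> I then y i else y0 i)) = pm_eval (\<lambda>c. eval_poly c x) (\<lambda>m. \<Prod>i\<in>#m. y i) R"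
      "\<forall>x\<in>affine_space N. \<forall>y. g (case_sum x (\<lambda>i. if i \<in> I then y i else y0 i)) = pm_eval (\<lambda>c. eval_poly c x) (\<lambda>m. \<Prod>i\<in>#m. y i) S"
      by blast
    have "\<forall>m. Poly_Mapping.lookup (R * S) m \<in> polys N"
      unfolding poly_mapping_mult_expand[of R S] lookup_sum
      using RS(1,2) by (intro allI polys_sum single polys_mult) auto
    moreover have "set_mset m \<subseteq> I" if m: "m \<in> Poly_Mapping.keys (R * S)" for m
    proof -
      obtain m1 m2 where "m = m1 + m2" "m1 \<in> Poly_Mapping.keys R" "m2 \<in> Poly_Mapping.keys S"
        using m Poly_Mapping.keys_mult[of R S] by blast
      with RS(3,4) show ?thesis by auto
    qed
    ultimately show ?case
      using RS(5,6) by (intro exI[of _ "R * S"]) (simp add: ev_simps)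
  }
qed

text \<open>With denominator 1 the coefficients are regular everywhere. The unknowns outside I are
  frozen at their values at a point where h is nonzero, which keeps the relation nonzero.\<close>

lemma dependent_of_polyfun_relation:
  fixes h :: "(nat + 'i \<Rightarrow> complex) \<Rightarrow> complex"
  assumes U: "openin (top_of_set V) U" "P \<in> U" and h: "h \<in> polyfun" "nonzero_on V h" and
    rel: "\<And>\<rho>. (\<lambda>j. \<rho> (Inl j)) \<in> U \<inter> D \<Longrightarrow> (\<And>i. i \<in> I \<Longrightarrow> \<rho> (Inr i) = f i (\<lambda>j. \<rho> (Inl j))) \<Longrightarrow> h \<rho> = 0"
  shows "\<not> alg_independent_near N V P D I f"
proof -
  interpret K: ring K by (rule ring_K)
  obtain \<rho>0 where \<rho>0: "\<rho>0 \<in> points V" "h \<rho>0 \<noteq> 0" using h by blast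
  define y0 where "y0 = (\<lambda>i. \<rho>0 (Inr i))"
  obtain R where R: "\<And>m. Poly_Mapping.lookup R m \<in> polys N" "\<And>m. m \<in> Poly_Mapping.keys R \<Longrightarrow> set_mset m \<subseteq> I"
    "\<And>x y. x \<in> affine_space N \<Longrightarrow> h (case_sum x (\<lambda>i. if i \<in> I then y i else y0 i)) =
      pm_eval (\<lambda>c. eval_poly c x) (\<lambda>m. \<Prod>i\<in>#m. y i) R" using polyfun_expand[OF h(1), of I y0] by blast
  define p where "p = (\<lambda>m. mk_frac N V (Poly_Mapping.lookup R m) 1)"
  have frac: "(Poly_Mapping.lookup R m, 1) \<in> fractions N V" for m using one_fraction R(1) .
  have p0: "p m = \<zero>\<^bsub>K\<^esub> \<longleftrightarrow> (\<forall>x\<in>V. eval_poly (Poly_Mapping.lookup R m) x = 0)" for m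
    unfolding p_def K_zero mk_frac_eq_iff[OF frac one_fraction[OF polys_intros(1)]] by simp
  have keys: "p m = \<zero>\<^bsub>K\<^esub>" if "m \<notin> Poly_Mapping.keys R" for m
    using that by (auto simp: p0 in_keys_iff)
  have "p \<in> K.indexed_pset I (carrier K)"
    using R(2) keys mk_frac_in_carrier[OF frac] by (intro K.indexed_psetI[of "Poly_Mapping.keys R"]) (auto simp: p_def)
  moreover have "p \<noteq> K.indexed_const \<zero>\<^bsub>K\<^esub>"
  proof
    assume z: "p = K.indexed_const \<zero>\<^bsub>K\<^esub>"
    let ?x = "\<lambda>j. \<rho>0 (Inl j)"
    have x: "?x \<in> V" using \<rho>0 by (simp add: points_def)
    have "eval_poly (Poly_Mapping.lookup R m) ?x = 0" for m
      using z x p0[of m] by (simp add: K.indexed_zero_def)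
    then have "pm_eval (\<lambda>c. eval_poly c ?x) (\<lambda>m. \<Prod>i\<in>#m. y0 i) R = 0" by (simp add: pm_eval_def)
    then have "h (case_sum ?x y0) = 0" using R(3)[of ?x y0] x irreducible_variety_affine[OF V] by auto
    moreover have "case_sum ?x y0 = \<rho>0" by (auto simp: y0_def fun_eq_iff split: sum.split)
    ultimately show False using \<rho>0 by simp
  qed
  moreover have "(\<Sum>m | p m \<noteq> \<zero>\<^bsub>K\<^esub>. value_at (p m) Q * (\<Prod>i\<in>#m. f i Q)) = 0" if Q: "Q \<in> U \<inter> D" for Q
  proof -
    have QV: "Q \<in> V" using Q openin_imp_subset[OF U(1)] by auto
    have v: "value_at (p m) Q = eval_poly (Poly_Mapping.lookup R m) Q" for m
      unfolding p_def using value_at_mk_frac[OF frac QV] by simp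
    \<comment> \<open>Monomials of R whose coefficient vanishes on V are zero over the function
      field and contribute nothing at Q.\<close>
    have "(\<Sum>m | p m \<noteq> \<zero>\<^bsub>K\<^esub>. value_at (p m) Q * (\<Prod>i\<in>#m. f i Q)) =
      (\<Sum>m\<in>Poly_Mapping.keys R. eval_poly (Poly_Mapping.lookup R m) Q * (\<Prod>i\<in>#m. f i Q))"
      unfolding v using keys p0 QV by (intro sum.mono_neutral_left) auto
    also have "\<dots> = h (case_sum Q (\<lambda>i. if i \<in> I then f i Q else y0 i))"
      using R(3)[of Q "\<lambda>i. f i Q"] QV irreducible_variety_affine[OF V] by (auto simp: pm_eval_def)
    also have "\<dots> = 0" using Q by (intro rel) auto
    finally show ?thesis .
  qed
  ultimately show ?thesis
    unfolding alg_independent_near_def Let_def using U by blast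
qed

end

section \<open>Pairs of meromorphic functions on the upper half plane\<close>

lemma upper_half_plane: "open upper_half_plane" "connected upper_half_plane" "convex upper_half_plane" "upper_half_plane \<noteq> {}"
proof -
  show "open upper_half_plane" unfolding upper_half_plane_def by (rule open_halfspace_Im_gt)
  show "convex upper_half_plane" unfolding upper_half_plane_def by (rule convex_halfspace_Im_gt)
  then show "connected upper_half_plane" by (rule convex_connected)
  show "upper_half_plane \<noteq> {}" unfolding upper_half_plane_def by (auto intro: exI[of _ \<i>])
qed

definition regular_points :: "(complex \<Rightarrow> complex) \<Rightarrow> (complex \<Rightarrow> complex) \<Rightarrow> complex set" where
  "regular_points f g = {z \<in> upper_half_plane. \<not> is_pole f z \<and> \<not> is_pole g z}"

locale meromorphic_pair =
  fixes f g :: "complex \<Rightarrow> complex"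
  assumes mero: "f nicely_meromorphic_on upper_half_plane" "g nicely_meromorphic_on upper_half_plane"
    and nonconst: "\<not> f constant_on upper_half_plane" "\<not> g constant_on upper_half_plane"
begin

lemma poles_sparse: "{z. is_pole f z \<or> is_pole g z} sparse_in upper_half_plane"
proof -
  have "eventually (\<lambda>z. \<not> is_pole f z) (cosparse upper_half_plane)" "eventually (\<lambda>z. \<not> is_pole g z) (cosparse upper_half_plane)"
    using mero by (auto simp: nicely_meromorphic_on_def intro!: meromorphic_on_imp_not_pole_cosparse)
  then have "eventually (\<lambda>z. \<not> (is_pole f z \<or> is_pole g z)) (cosparse upper_half_plane)"
    by eventually_elim simp
  then show ?thesis by (simp add: eventually_cosparse)
qed

lemma regular_points_eq: "regular_points f g = upper_half_plane - {z. is_pole f z \<or> is_pole g z}"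
  by (auto simp: regular_points_def)

lemma open_regular: "open (regular_points f g)"
  unfolding regular_points_eq by (intro open_diff_sparse_pts poles_sparse upper_half_plane)

lemma connected_regular: "connected (regular_points f g)"
  unfolding regular_points_eq by (intro sparse_imp_connected poles_sparse upper_half_plane) simp

lemma eventually_regular:
  assumes "z \<in> upper_half_plane"
  shows "eventually (\<lambda>w. w \<in> regular_points f g) (at z)"
proof -
  have "eventually (\<lambda>w. w \<notin> {z. is_pole f z \<or> is_pole g z}) (at z)"
    using poles_sparse assms unfolding sparse_in_eventually_iff[OF upper_half_plane(1)] by blast
  moreover have "eventually (\<lambda>w. w \<in> upper_half_plane) (at z)"
    using eventually_at_in_open'[OF upper_half_plane(1) assms] .
  ultimately show ?thesis by eventually_elim (simp add: regular_points_eq)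
qed

lemma regular_nonempty: "regular_points f g \<noteq> {}"
proof -
  obtain z where "z \<in> upper_half_plane" using upper_half_plane by blast
  from eventually_happens[OF eventually_regular[OF this]] show ?thesis by auto
qed

lemma analytic_regular: "z \<in> regular_points f g \<Longrightarrow> f analytic_on {z}" "z \<in> regular_points f g \<Longrightarrow> g analytic_on {z}"
  using nicely_meromorphic_on_imp_analytic_at mero by (auto simp: regular_points_def)

lemma holomorphic_regular: "f holomorphic_on regular_points f g" "g holomorphic_on regular_points f g"
proof -
  have "f analytic_on regular_points f g" "g analytic_on regular_points f g"
    using analytic_regular analytic_on_analytic_at by blast+
  then show "f holomorphic_on regular_points f g" "g holomorphic_on regular_points f g"
    by (auto intro: analytic_imp_holomorphic)
qed

lemma nonconst_regular: "\<not> f constant_on regular_points f g" "\<not> g constant_on regular_points f g"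
proof -
  have "regular_points f g \<subseteq> upper_half_plane" by (auto simp: regular_points_def)
  then show "\<not> f constant_on regular_points f g" "\<not> g constant_on regular_points f g"
    using constant_on_extend_nicely_meromorphic_on[OF _ _ open_regular upper_half_plane(1,2) regular_nonempty]
      mero nonconst by blast+
qed

lemma infinite_image_regular: "infinite (f ` regular_points f g)" "infinite (g ` regular_points f g)"
proof -
  have "infinite (h ` regular_points f g)" if "h holomorphic_on regular_points f g" "\<not> h constant_on regular_points f g" for h
  proof
    assume "finite (h ` regular_points f g)"
    moreover have "connected (h ` regular_points f g)"
      using connected_regular that(1) by (intro connected_continuous_image holomorphic_on_imp_continuous_on)
    ultimately have "h ` regular_points f g = {} \<or> (\<exists>x. h ` regular_points f g = {x})"
      using connected_finite_iff_sing by blast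
    with that(2) show False by (auto simp: constant_on_def)
  qed
  with holomorphic_regular nonconst_regular
  show "infinite (f ` regular_points f g)" "infinite (g ` regular_points f g)" by blast+
qed

text \<open>A relation of least degree in x is taken. In degree 0 it would be an equation for g
  alone, which takes infinitely many values; and the derivative in x, nonzero and of smaller degree,
  cannot be a relation.\<close>

lemma minimal_relation:
  assumes "F \<noteq> 0" "\<forall>z\<in>regular_points f g. eval2 F (f z) (g z) = 0"
  obtains F where "\<And>z. z \<in> regular_points f g \<Longrightarrow> eval2 F (f z) (g z) = 0"
    "Polynomial.degree F > 0" "\<exists>z\<in>regular_points f g. eval2 (pderiv F) (f z) (g z) \<noteq> 0"
proof -
  let ?P = "\<lambda>F. F \<noteq> 0 \<and> (\<forall>z\<in>regular_points f g. eval2 F (f z) (g z) = 0)"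
  from assms have "?P F" by blast
  from ex_has_least_nat[of ?P, OF this, of Polynomial.degree]
  obtain F where F: "?P F" "\<And>G. ?P G \<Longrightarrow> Polynomial.degree F \<le> Polynomial.degree G" by blast
  have d: "Polynomial.degree F > 0"
  proof (rule ccontr)
    assume "\<not> ?thesis"
    then obtain l where l: "F = [:l:]" by (metis degree_eq_zeroE gr0I)
    then have "l \<noteq> 0" "\<forall>z\<in>regular_points f g. poly l (g z) = 0" using F(1) by auto
    then have "g ` regular_points f g \<subseteq> {y. poly l y = 0}" by auto
    with poly_roots_finite[OF \<open>l \<noteq> 0\<close>] infinite_image_regular(2) finite_subset show False by blast
  qed
  have "\<exists>z\<in>regular_points f g. eval2 (pderiv F) (f z) (g z) \<noteq> 0"
  proof (rule ccontr)
    assume "\<not> ?thesis"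
    moreover have "pderiv F \<noteq> 0" using d by (simp add: pderiv_eq_0_iff)
    ultimately have "Polynomial.degree F \<le> Polynomial.degree (pderiv F)" using F(2) by blast
    with d show False by (simp add: degree_pderiv)
  qed
  with F d that show ?thesis by blast
qed

text \<open>Dividing F(f, g) = 0 by the top power of f and letting the argument tend to the pole
  leaves the leading coefficient.\<close>

lemma lead_coeff_at_pole:
  assumes F: "\<And>z. z \<in> regular_points f g \<Longrightarrow> eval2 F (f z) (g z) = 0"
    and z: "z \<in> upper_half_plane" "is_pole f z" "\<not> is_pole g z"
  shows "poly (Polynomial.lead_coeff F) (g z) = 0"
proof -
  let ?d = "Polynomial.degree F" and ?c = "\<lambda>k w. poly (Polynomial.coeff F k) (g w)"
  have g: "(g \<longlongrightarrow> g z) (at z)"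
    using nicely_meromorphic_on_imp_analytic_at[OF mero(2) z(1,3)] analytic_at_imp_isCont isContD by blast
  have c: "(?c k \<longlongrightarrow> ?c k z) (at z)" for k
    by (intro tendsto_intros g)
  have inv: "((\<lambda>w. inverse (f w)) \<longlongrightarrow> 0) (at z)"
    using z(2) unfolding is_pole_def by (rule tendsto_inverse_0[THEN filterlim_compose])
  have "((\<lambda>w. - (\<Sum>k<?d. ?c k w * inverse (f w) ^ (?d - k))) \<longlongrightarrow> - (\<Sum>k<?d. ?c k z * 0 ^ (?d - k))) (at z)"
    by (intro tendsto_minus tendsto_sum tendsto_mult tendsto_power c inv)
  also have "(\<Sum>k<?d. ?c k z * 0 ^ (?d - k)) = 0" by (rule sum.neutral) auto
  finally have lim: "((\<lambda>w. - (\<Sum>k<?d. ?c k w * inverse (f w) ^ (?d - k))) \<longlongrightarrow> 0) (at z)" by simp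
  have "eventually (\<lambda>w. - (\<Sum>k<?d. ?c k w * inverse (f w) ^ (?d - k)) = ?c ?d w) (at z)"
    using eventually_regular[OF z(1)] non_zero_neighbour_pole[OF z(2)]
  proof eventually_elim
    case (elim w)
    have "(\<Sum>k<?d. ?c k w * inverse (f w) ^ (?d - k)) = (\<Sum>k<?d. ?c k w * f w ^ k) * inverse (f w) ^ ?d"
      unfolding sum_distrib_right
    proof (rule sum.cong)
      fix k assume "k \<in> {..<?d}"
      then have "inverse (f w) ^ ?d = inverse (f w) ^ k * inverse (f w) ^ (?d - k)" by (simp add: power_add[symmetric])
      then show "?c k w * inverse (f w) ^ (?d - k) = ?c k w * f w ^ k * inverse (f w) ^ ?d"
        using elim(2) by (simp add: power_inverse)
    qed simp
    moreover have "(\<Sum>k<?d. ?c k w * f w ^ k) + ?c ?d w * f w ^ ?d = 0"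
      using F[OF elim(1)] by (simp add: eval2_altdef lessThan_Suc_atMost[symmetric])
    then have "(\<Sum>k<?d. ?c k w * f w ^ k) = - (?c ?d w * f w ^ ?d)" by (rule eq_neg_iff_add_eq_0[THEN iffD2])
    ultimately show ?case using elim(2) by (simp add: power_inverse)
  qed
  from tendsto_cong[OF this] lim have "(?c ?d \<longlongrightarrow> 0) (at z)" by simp
  with c[of ?d] show ?thesis using tendsto_unique[of "at z"] by auto
qed

end

text \<open>At a pole of f nothing is known about h, but there the leading coefficient of the
  minimal relation vanishes at g z, and \<open>h'\<close> with it.\<close>

lemma (in irreducible_points) exchange_meromorphic_jets:
  fixes h :: "(nat + 'i \<times> nat \<Rightarrow> complex) \<Rightarrow> complex"
  assumes "meromorphic_pair f g" and F: "F \<noteq> 0" "\<forall>z\<in>regular_points f g. eval2 F (f z) (g z) = 0"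
    and h: "h \<in> polyfun" "nonzero_on V h"
  shows "\<exists>h'. h' \<in> polyfun \<and> nonzero_on V h' \<and>
    (\<forall>\<rho>\<in>points V. \<forall>z\<in>upper_half_plane. \<not> is_pole g z \<longrightarrow>
      (\<not> is_pole f z \<longrightarrow> h (jet f i (\<rho>, z, 1, 0)) = 0) \<longrightarrow> h' (jet g i (\<rho>, z, 1, 0)) = 0)"
proof -
  interpret meromorphic_pair f g by fact
  obtain F where F: "\<And>z. z \<in> regular_points f g \<Longrightarrow> eval2 F (f z) (g z) = 0"
    "Polynomial.degree F > 0" "\<exists>z\<in>regular_points f g. eval2 (pderiv F) (f z) (g z) \<noteq> 0"
    using minimal_relation[OF F] by blast
  obtain h' where h': "h' \<in> polyfun" "nonzero_on V h'" "\<forall>\<rho>\<in>points V. \<forall>z. (z \<in> regular_points f g \<and> h (jet f i (\<rho>, z, 1, 0)) = 0) \<or>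
      poly (Polynomial.lead_coeff F) (g z) = 0 \<longrightarrow> h' (jet g i (\<rho>, z, 1, 0)) = 0"
    using exchange_jets[OF open_regular connected_regular holomorphic_regular F nonconst_regular(1) h, of i] by blast
  have "h' (jet g i (\<rho>, z, 1, 0)) = 0" if "\<rho> \<in> points V" "z \<in> upper_half_plane" "\<not> is_pole g z"
      "\<not> is_pole f z \<longrightarrow> h (jet f i (\<rho>, z, 1, 0)) = 0" for \<rho> z
  proof (cases "is_pole f z")
    case True
    then show ?thesis using h'(3) that lead_coeff_at_pole[OF F(1) that(2) _ that(3)] by blast
  next
    case False
    then have "z \<in> regular_points f g" using that by (simp add: regular_points_def)
    then show ?thesis using h'(3) that False by blast
  qed
  with h' show ?thesis by blast
qed

text \<open>The assignment is compatible with the functions at index i: its slots are those of the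
  jet of f at the value of \<tau> i. Excluding poles records where the family is defined.\<close>

definition jet_slots :: "(nat \<Rightarrow> (nat \<Rightarrow> complex) \<Rightarrow> complex) \<Rightarrow> (complex \<Rightarrow> complex) \<Rightarrow> nat \<Rightarrow> (nat + nat \<times> nat \<Rightarrow> complex) \<Rightarrow> bool" where
  "jet_slots \<tau> f i \<rho> \<longleftrightarrow> (let z = \<tau> i (\<lambda>j. \<rho> (Inl j)) in \<not> is_pole f z \<and> (\<forall>k<3. \<rho> (Inr (i, k)) = (deriv ^^ k) f z))"

lemma jet_Inl [simp]: "jet f i m (Inl j) = fst m (Inl j)"
  by (cases m) (simp add: jet_def)

lemma jet_slots_jet: "jet_slots \<tau> f i (jet f i (\<rho>, \<tau> i (\<lambda>j. \<rho> (Inl j)), 1, 0)) \<longleftrightarrow> \<not> is_pole f (\<tau> i (\<lambda>j. \<rho> (Inl j)))"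
  by (auto simp: jet_slots_def Let_def numeral_3_eq_3 less_Suc_eq jet_def numeral_2_eq_2)

lemma jet_slots_other: "i \<noteq> i' \<Longrightarrow> jet_slots \<tau> f i (jet f' i' (\<rho>, z, a, b)) \<longleftrightarrow> jet_slots \<tau> f i \<rho>"
  by (simp add: jet_slots_def Let_def)

lemma jet_of_jet_slots:
  assumes "jet_slots \<tau> f i \<rho>"
  shows "jet f i (\<rho>, \<tau> i (\<lambda>j. \<rho> (Inl j)), 1, 0) = \<rho>"
proof
  have "\<rho> (Inr (i, k)) = (deriv ^^ k) f (\<tau> i (\<lambda>j. \<rho> (Inl j)))" if "k < 3" for k
    using assms that by (simp add: jet_slots_def Let_def)
  from this[of 0] this[of 1] this[of 2] show "jet f i (\<rho>, \<tau> i (\<lambda>j. \<rho> (Inl j)), 1, 0) v = \<rho> v" for v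
    by (auto simp: jet_def numeral_2_eq_2)
qed

text \<open>The functions \<open>f \<circ> \<tau> i\<close> are replaced by \<open>g \<circ> \<tau> i\<close> one index at a time.\<close>

lemma (in irreducible_points) exchange_all_jets:
  assumes fg: "meromorphic_pair f g" and F: "F \<noteq> 0" "\<forall>z\<in>regular_points f g. eval2 F (f z) (g z) = 0"
    and UV: "U \<subseteq> V" and \<tau>: "\<And>Q i. Q \<in> U \<Longrightarrow> i < n \<Longrightarrow> \<tau> i Q \<in> upper_half_plane"
    and h: "h \<in> polyfun" "nonzero_on V h"
    and rel: "\<And>\<rho>. (\<lambda>j. \<rho> (Inl j)) \<in> U \<Longrightarrow> (\<And>i. i < n \<Longrightarrow> jet_slots \<tau> f i \<rho>) \<Longrightarrow> h \<rho> = 0"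
  shows "\<exists>h'. h' \<in> polyfun \<and> nonzero_on V h' \<and>
    (\<forall>\<rho>. (\<lambda>j. \<rho> (Inl j)) \<in> U \<longrightarrow> (\<forall>i<n. jet_slots \<tau> g i \<rho>) \<longrightarrow> h' \<rho> = 0)"
proof -
  \<comment> \<open>Stage m of the exchange: the indices below m carry jets of g, the others still
    jets of f.\<close>
  have "\<exists>h'. h' \<in> polyfun \<and> nonzero_on V h' \<and> (\<forall>\<rho>. (\<lambda>j. \<rho> (Inl j)) \<in> U \<longrightarrow>
      (\<forall>i<m. jet_slots \<tau> g i \<rho>) \<longrightarrow> (\<forall>i<n. m \<le> i \<longrightarrow> jet_slots \<tau> f i \<rho>) \<longrightarrow> h' \<rho> = 0)" if "m \<le> n" for m
    using that
  proof (induction m)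
    case 0
    have "\<forall>\<rho>. (\<lambda>j. \<rho> (Inl j)) \<in> U \<longrightarrow> (\<forall>i<0. jet_slots \<tau> g i \<rho>) \<longrightarrow> (\<forall>i<n. 0 \<le> i \<longrightarrow> jet_slots \<tau> f i \<rho>) \<longrightarrow> h \<rho> = 0"
      using rel by blast
    with h show ?case by blast
  next
    case (Suc m)
    then obtain h1 where h1: "h1 \<in> polyfun" "nonzero_on V h1" and rel1: "\<forall>\<rho>. (\<lambda>j. \<rho> (Inl j)) \<in> U \<longrightarrow>
      (\<forall>i<m. jet_slots \<tau> g i \<rho>) \<longrightarrow> (\<forall>i<n. m \<le> i \<longrightarrow> jet_slots \<tau> f i \<rho>) \<longrightarrow> h1 \<rho> = 0"
      using Suc_leD by blast
    obtain h2 where h2: "h2 \<in> polyfun" "nonzero_on V h2" and rel2: "\<forall>\<rho>\<in>points V. \<forall>z\<in>upper_half_plane. \<not> is_pole g z \<longrightarrow>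
      (\<not> is_pole f z \<longrightarrow> h1 (jet f m (\<rho>, z, 1, 0)) = 0) \<longrightarrow> h2 (jet g m (\<rho>, z, 1, 0)) = 0"
      using exchange_meromorphic_jets[OF fg F h1, of m] by blast
    have "h2 \<rho> = 0" if \<rho>: "(\<lambda>j. \<rho> (Inl j)) \<in> U" "\<forall>i<Suc m. jet_slots \<tau> g i \<rho>" "\<forall>i<n. Suc m \<le> i \<longrightarrow> jet_slots \<tau> f i \<rho>" for \<rho>
    proof -
      let ?z = "\<tau> m (\<lambda>j. \<rho> (Inl j))"
      have "\<rho> \<in> points V" using \<rho> UV by (auto simp: points_def)
      moreover have "?z \<in> upper_half_plane" using \<tau> \<rho> Suc.prems by auto
      moreover have "\<not> is_pole g ?z" using \<rho>(2) by (simp add: jet_slots_def Let_def)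
      \<comment> \<open>Overwriting the slots of index m by the jet of f gives a point to which the
        previous stage applies; the point itself carries the jet of g there.\<close>
      moreover have "h1 (jet f m (\<rho>, ?z, 1, 0)) = 0" if "\<not> is_pole f ?z"
      proof -
        have "jet_slots \<tau> f m (jet f m (\<rho>, ?z, 1, 0))" using that by (simp add: jet_slots_jet)
        then have "jet_slots \<tau> f i (jet f m (\<rho>, ?z, 1, 0))" if "i < n" "m \<le> i" for i
          using that \<rho>(3) by (cases "i = m") (simp_all add: jet_slots_other)
        moreover have "jet_slots \<tau> g i (jet f m (\<rho>, ?z, 1, 0))" if "i < m" for i
          using that \<rho>(2) by (simp add: jet_slots_other)
        ultimately show ?thesis
          using rel1[rule_format, of "jet f m (\<rho>, ?z, 1, 0)"] \<rho>(1) by simp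
      qed
      ultimately have "h2 (jet g m (\<rho>, ?z, 1, 0)) = 0" using rel2 by blast
      moreover have "jet g m (\<rho>, ?z, 1, 0) = \<rho>" using \<rho>(2) by (intro jet_of_jet_slots) simp
      ultimately show ?thesis by simp
    qed
    with h2 show ?case by blast
  qed
  from this[of n] obtain h' where h': "h' \<in> polyfun" "nonzero_on V h'" "\<forall>\<rho>. (\<lambda>j. \<rho> (Inl j)) \<in> U \<longrightarrow>
      (\<forall>i<n. jet_slots \<tau> g i \<rho>) \<longrightarrow> (\<forall>i<n. n \<le> i \<longrightarrow> jet_slots \<tau> f i \<rho>) \<longrightarrow> h' \<rho> = 0" by auto
  then show ?thesis by (metis leD)
qed

section \<open>Moebius transformations\<close>

lemma matrix_eq_2:
  fixes A B :: "real^2^2"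
  shows "A = B \<longleftrightarrow> A$1$1 = B$1$1 \<and> A$1$2 = B$1$2 \<and> A$2$1 = B$2$1 \<and> A$2$2 = B$2$2"
  by (auto simp: vec_eq_iff forall_2)

lemma matrix_mult_2:
  fixes A B :: "real^2^2"
  shows "(A ** B)$1$1 = A$1$1 * B$1$1 + A$1$2 * B$2$1" "(A ** B)$1$2 = A$1$1 * B$1$2 + A$1$2 * B$2$2"
    "(A ** B)$2$1 = A$2$1 * B$1$1 + A$2$2 * B$2$1" "(A ** B)$2$2 = A$2$1 * B$1$2 + A$2$2 * B$2$2"
  by (simp_all add: matrix_matrix_mult_def sum_2)

lemma mat_2: "(mat 1 :: real^2^2)$1$1 = 1" "(mat 1 :: real^2^2)$1$2 = 0" "(mat 1 :: real^2^2)$2$1 = 0" "(mat 1 :: real^2^2)$2$2 = 1"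
  by (simp_all add: mat_def)

lemma SL2R_simps:
  "A \<in> carrier SL2R \<longleftrightarrow> A$1$1 * A$2$2 - A$1$2 * A$2$1 = 1"
  "A \<otimes>\<^bsub>SL2R\<^esub> B = A ** B" "\<one>\<^bsub>SL2R\<^esub> = mat 1"
  by (simp_all add: SL2R_def det_2)

interpretation SL2R: group SL2R by (rule group_SL2R)

lemma SL2R_inv:
  assumes "A \<in> carrier SL2R"
  shows "A ** inv\<^bsub>SL2R\<^esub> A = mat 1" "inv\<^bsub>SL2R\<^esub> A ** A = mat 1" "inv\<^bsub>SL2R\<^esub> A \<in> carrier SL2R"
  using SL2R.r_inv[OF assms] SL2R.l_inv[OF assms] SL2R.inv_closed[OF assms] by (simp_all add: SL2R_simps(2,3))

lemma SL2R_mult: "A \<in> carrier SL2R \<Longrightarrow> B \<in> carrier SL2R \<Longrightarrow> A ** B \<in> carrier SL2R"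
  using SL2R.m_closed[of A B] by (simp add: SL2R_simps(2))

lemma mobius_denominator_nonzero:
  assumes "A \<in> carrier SL2R" "z \<in> upper_half_plane"
  shows "of_real (A$2$1) * z + of_real (A$2$2) \<noteq> 0"
proof
  assume *: "of_real (A$2$1) * z + of_real (A$2$2) = 0"
  from arg_cong[OF *, of Im] assms(2) have "A$2$1 = 0" by (simp add: upper_half_plane_def)
  moreover from this * have "A$2$2 = 0" by simp
  ultimately show False using assms(1) by (simp add: SL2R_simps)
qed

lemma Im_mobius:
  assumes "A \<in> carrier SL2R" "z \<in> upper_half_plane"
  shows "Im (mobius A z) = Im z / (cmod (of_real (A$2$1) * z + of_real (A$2$2)))\<^sup>2"
proof -
  have "Im (mobius A z) = Im ((of_real (A$1$1) * z + of_real (A$1$2)) * cnj (of_real (A$2$1) * z + of_real (A$2$2)))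
     / (cmod (of_real (A$2$1) * z + of_real (A$2$2)))\<^sup>2"
    unfolding mobius_def complex_div_cnj[of "of_real (A$1$1) * z + of_real (A$1$2)"]
    by (simp only: of_real_power[symmetric] Im_divide_of_real)
  also have "Im ((of_real (A$1$1) * z + of_real (A$1$2)) * cnj (of_real (A$2$1) * z + of_real (A$2$2)))
      = (A$1$1 * A$2$2 - A$1$2 * A$2$1) * Im z"
    by (simp add: algebra_simps)
  finally show ?thesis using assms(1) by (simp add: SL2R_simps)
qed

lemma mobius_in_upper_half_plane:
  "A \<in> carrier SL2R \<Longrightarrow> z \<in> upper_half_plane \<Longrightarrow> mobius A z \<in> upper_half_plane"
  using Im_mobius[of A z] mobius_denominator_nonzero[of A z] by (simp add: upper_half_plane_def)

lemma mobius_mult: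
  assumes "A \<in> carrier SL2R" "B \<in> carrier SL2R" "z \<in> upper_half_plane"
  shows "mobius (A ** B) z = mobius A (mobius B z)"
proof -
  let ?q = "of_real (B$2$1) * z + of_real (B$2$2) :: complex" and ?p = "of_real (B$1$1) * z + of_real (B$1$2) :: complex"
  have q: "?q \<noteq> 0" using mobius_denominator_nonzero assms by blast
  have *: "a * (?p / ?q) + b = (a * ?p + b * ?q) / ?q" for a b using q by (simp add: field_simps)
  have "mobius A (mobius B z) = (of_real (A$1$1) * ?p + of_real (A$1$2) * ?q) / (of_real (A$2$1) * ?p + of_real (A$2$2) * ?q)"
    unfolding mobius_def * using q by simp
  also have "\<dots> = mobius (A ** B) z"
    unfolding mobius_def by (simp add: matrix_mult_2 algebra_simps)
  finally show ?thesis by simp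
qed

lemma mobius_one [simp]: "mobius (mat 1) z = z"
  by (simp add: mobius_def mat_2)

lemma mobius_inv:
  assumes "A \<in> carrier SL2R" "z \<in> upper_half_plane"
  shows "mobius (inv\<^bsub>SL2R\<^esub> A) (mobius A z) = z" "mobius A (mobius (inv\<^bsub>SL2R\<^esub> A) z) = z"
  using mobius_mult[of "inv\<^bsub>SL2R\<^esub> A" A z] mobius_mult[of A "inv\<^bsub>SL2R\<^esub> A" z] assms SL2R_inv[OF assms(1)] by simp_all

lemma holomorphic_mobius: "A \<in> carrier SL2R \<Longrightarrow> mobius A holomorphic_on upper_half_plane"
  unfolding mobius_def[abs_def] using mobius_denominator_nonzero by (intro holomorphic_intros) blast+

lemma isCont_mobius:
  assumes "A \<in> carrier SL2R" "z \<in> upper_half_plane"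
  shows "isCont (mobius A) z"
  using holomorphic_on_imp_continuous_on[OF holomorphic_mobius[OF assms(1)]] upper_half_plane(1) assms(2)
  by (simp add: continuous_on_eq_continuous_at)

text \<open>Injectivity keeps punctured neighbourhoods punctured, so limits at poles can be
  transported.\<close>

lemma filterlim_mobius:
  assumes "A \<in> carrier SL2R" "z \<in> upper_half_plane"
  shows "filterlim (mobius A) (at (mobius A z)) (at z)"
proof (rule filterlim_atI)
  show "(mobius A \<longlongrightarrow> mobius A z) (at z)" using isCont_mobius[OF assms] by (simp add: isCont_def)
  have "eventually (\<lambda>w. w \<in> upper_half_plane) (at z)"
    using eventually_at_in_open'[OF upper_half_plane(1) assms(2)] .
  moreover have "eventually (\<lambda>w. w \<noteq> z) (at z)" by (simp add: eventually_at_filter)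
  ultimately show "eventually (\<lambda>w. mobius A w \<noteq> mobius A z) (at z)"
    by eventually_elim (metis assms mobius_inv(1))
qed

subsection \<open>The action on the boundary\<close>

text \<open>Homogeneous coordinates (p, q) of the boundary point p / q, on which matrices act
  linearly.\<close>

fun boundary_vector :: "complex option \<Rightarrow> real \<times> real" where
  "boundary_vector None = (1, 0)"
| "boundary_vector (Some x) = (Re x, 1)"

text \<open>The function whose superlevel sets are the horoballs at p / q, equal to the imaginary
  part for the vector (1, 0). Scaling the vector by l divides it by l^2.\<close>

definition height :: "real \<times> real \<Rightarrow> complex \<Rightarrow> real" where
  "height v z = Im z / (cmod (of_real (snd v) * z - of_real (fst v)))\<^sup>2"

text \<open>The disc of radius r tangent to the real line at x is the set where Im z / |z - x|^2
  exceeds 1 / (2 r).\<close>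

fun horoball_height :: "complex option \<Rightarrow> real \<Rightarrow> real" where
  "horoball_height None r = r"
| "horoball_height (Some x) r = 1 / (2 * r)"

lemma horoball_iff:
  assumes "s \<in> insert None (Some ` \<real>)" "r > 0"
  shows "z \<in> horoball s r \<longleftrightarrow> z \<in> upper_half_plane \<and> height (boundary_vector s) z > horoball_height s r"
proof (cases s)
  case None
  then show ?thesis using assms by (auto simp: horoball_def height_def upper_half_plane_def)
next
  case (Some x)
  with assms obtain t where t: "x = of_real t" by (auto elim: Reals_cases)
  have "dist (x + of_real r * \<i>) z < r \<longleftrightarrow> (dist (x + of_real r * \<i>) z)\<^sup>2 < r\<^sup>2"
    using assms(2) power_strict_mono[of "dist (x + of_real r * \<i>) z" r 2] power_less_imp_less_base[of _ 2 r] by fastforce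
  also have "(dist (x + of_real r * \<i>) z)\<^sup>2 = (t - Re z)\<^sup>2 + (r - Im z)\<^sup>2"
    by (simp add: dist_norm t cmod_power2)
  also have "\<dots> < r\<^sup>2 \<longleftrightarrow> (Re z - t)\<^sup>2 + (Im z)\<^sup>2 < 2 * r * Im z"
    by (simp add: power2_eq_square algebra_simps)
  also have "\<dots> \<longleftrightarrow> Im z > 0 \<and> (Re z - t)\<^sup>2 + (Im z)\<^sup>2 < 2 * r * Im z"
  proof -
    have "Im z > 0" if "(Re z - t)\<^sup>2 + (Im z)\<^sup>2 < 2 * r * Im z"
    proof -
      have "0 < 2 * r * Im z" using that by (rule le_less_trans[rotated]) simp
      then show ?thesis using assms(2) by (simp add: zero_less_mult_iff)
    qed
    then show ?thesis by blast
  qed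
  also have "\<dots> \<longleftrightarrow> Im z > 0 \<and> 1 / (2 * r) < Im z / ((Re z - t)\<^sup>2 + (Im z)\<^sup>2)"
  proof (rule conj_cong)
    assume "0 < Im z"
    then have "0 < (Re z - t)\<^sup>2 + (Im z)\<^sup>2" by (simp add: add_nonneg_pos)
    then show "((Re z - t)\<^sup>2 + (Im z)\<^sup>2 < 2 * r * Im z) \<longleftrightarrow> 1 / (2 * r) < Im z / ((Re z - t)\<^sup>2 + (Im z)\<^sup>2)"
      using assms(2) by (simp add: field_simps)
  qed simp
  also have "(Re z - t)\<^sup>2 + (Im z)\<^sup>2 = (cmod (z - of_real t))\<^sup>2" by (simp add: cmod_power2)
  finally show ?thesis
    by (simp add: Some horoball_def height_def upper_half_plane_def t)
qed

text \<open>The matrix acts linearly on homogeneous coordinates; the factor l is the cost of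
  normalising the image vector.\<close>

lemma mobius_ext_boundary:
  assumes A: "A \<in> carrier SL2R" and s: "s \<in> insert None (Some ` \<real>)"
  obtains l where "l \<noteq> 0" "mobius_ext A s \<in> insert None (Some ` \<real>)"
    "A$1$1 * fst (boundary_vector s) + A$1$2 * snd (boundary_vector s) = l * fst (boundary_vector (mobius_ext A s))"
    "A$2$1 * fst (boundary_vector s) + A$2$2 * snd (boundary_vector s) = l * snd (boundary_vector (mobius_ext A s))"
proof (cases s)
  case None
  show ?thesis
  proof (cases "A$2$1 = 0")
    case True
    moreover have "A$1$1 \<noteq> 0" using A True by (auto simp: SL2R_simps)
    ultimately show ?thesis using that[of "A$1$1"] None by (auto simp: mobius_ext_def)
  next
    case False
    then show ?thesis using that[of "A$2$1"] None by (auto simp: mobius_ext_def)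
  qed
next
  case (Some x)
  with s obtain t where t: "x = of_real t" by (auto elim: Reals_cases)
  have e: "of_real (A$2$1) * x + of_real (A$2$2) = complex_of_real (A$2$1 * t + A$2$2)"
    "of_real (A$1$1) * x + of_real (A$1$2) = complex_of_real (A$1$1 * t + A$1$2)" by (simp_all add: t)
  show ?thesis
  proof (cases "A$2$1 * t + A$2$2 = 0")
    case True
    have "A$1$1 * t + A$1$2 \<noteq> 0"
    proof
      assume "A$1$1 * t + A$1$2 = 0"
      then have "A$1$2 = - A$1$1 * t" "A$2$2 = - A$2$1 * t" using True by simp_all
      with A show False by (simp add: SL2R_simps)
    qed
    with True show ?thesis using that[of "A$1$1 * t + A$1$2"] Some
      unfolding mobius_ext_def option.case Some e by (simp add: t)
  next
    case False
    have m: "mobius A x = of_real ((A$1$1 * t + A$1$2) / (A$2$1 * t + A$2$2))"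
      unfolding mobius_def e by simp
    have "mobius_ext A s = Some (of_real ((A$1$1 * t + A$1$2) / (A$2$1 * t + A$2$2)))"
      unfolding mobius_ext_def Some option.case e m by (simp only: of_real_eq_0_iff False if_False)
    with False show ?thesis using that[of "A$2$1 * t + A$2$2"] by (simp add: Some t)
  qed
qed

text \<open>As the determinant is 1, the imaginary part and the squared distance in the denominator
  both pick up the factor |c z + d|^(-2).\<close>

lemma height_mobius:
  assumes "A \<in> carrier SL2R" "z \<in> upper_half_plane"
  shows "height (A$1$1 * p + A$1$2 * q, A$2$1 * p + A$2$2 * q) (mobius A z) = height (p, q) z"
proof -
  let ?d = "of_real (A$2$1) * z + of_real (A$2$2) :: complex"
  have d: "?d \<noteq> 0" using mobius_denominator_nonzero assms by blast
  have "(of_real (A$2$1 * p + A$2$2 * q) * mobius A z - of_real (A$1$1 * p + A$1$2 * q)) * ?d =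
     of_real (A$2$1 * p + A$2$2 * q) * (of_real (A$1$1) * z + of_real (A$1$2)) - of_real (A$1$1 * p + A$1$2 * q) * ?d"
    using d by (simp add: mobius_def left_diff_distrib)
  also have "\<dots> = of_real (A$1$1 * A$2$2 - A$1$2 * A$2$1) * (of_real q * z - of_real p)"
    by (simp add: algebra_simps)
  also have "\<dots> = of_real q * z - of_real p" using assms(1) by (simp add: SL2R_simps)
  finally have e: "of_real (A$2$1 * p + A$2$2 * q) * mobius A z - of_real (A$1$1 * p + A$1$2 * q) = (of_real q * z - of_real p) / ?d"
    using d by (simp add: field_simps)
  show ?thesis
    unfolding height_def fst_conv snd_conv e Im_mobius[OF assms] using d by (simp add: norm_divide power_divide)
qed

lemma horoball_mobius_ext:
  assumes A: "A \<in> carrier SL2R" and s: "s \<in> insert None (Some ` \<real>)" and r: "r > 0"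
  shows "\<exists>r'>0. horoball (mobius_ext A s) r' \<subseteq> mobius A ` horoball s r"
proof -
  obtain l where l: "l \<noteq> 0" and s': "mobius_ext A s \<in> insert None (Some ` \<real>)" and
    v: "A$1$1 * fst (boundary_vector s) + A$1$2 * snd (boundary_vector s) = l * fst (boundary_vector (mobius_ext A s))"
    "A$2$1 * fst (boundary_vector s) + A$2$2 * snd (boundary_vector s) = l * snd (boundary_vector (mobius_ext A s))"
    using mobius_ext_boundary[OF A s] by blast
  \<comment> \<open>The image vector is l times the normalised one, which divides heights by l^2;
    \<kappa> is the resulting level at the image point.\<close>
  define \<kappa> where "\<kappa> = l\<^sup>2 * horoball_height s r"
  have \<kappa>: "\<kappa> > 0" unfolding \<kappa>_def using l r by (cases s) auto
  obtain r' where r': "r' > 0" "horoball_height (mobius_ext A s) r' = \<kappa>"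
  proof (cases "mobius_ext A s")
    case None
    then show ?thesis using \<kappa> that[of \<kappa>] by simp
  next
    case (Some x)
    then show ?thesis using \<kappa> that[of "1 / (2 * \<kappa>)"] by simp
  qed
  have "z \<in> mobius A ` horoball s r" if "z \<in> horoball (mobius_ext A s) r'" for z
  proof -
    have z: "z \<in> upper_half_plane" "height (boundary_vector (mobius_ext A s)) z > \<kappa>"
      using that horoball_iff[OF s' r'(1)] r'(2) by auto
    define w where "w = mobius (inv\<^bsub>SL2R\<^esub> A) z"
    have w: "w \<in> upper_half_plane" "mobius A w = z"
      using mobius_in_upper_half_plane[OF SL2R_inv(3)[OF A] z(1)] mobius_inv(2)[OF A z(1)] by (simp_all add: w_def)
    have "height (boundary_vector s) w = height (l * fst (boundary_vector (mobius_ext A s)), l * snd (boundary_vector (mobius_ext A s))) z"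
      using height_mobius[OF A w(1), of "fst (boundary_vector s)" "snd (boundary_vector s)"] by (simp add: v w(2))
    also have "\<dots> = height (boundary_vector (mobius_ext A s)) z / l\<^sup>2"
    proof -
      have "of_real (l * q) * z - of_real (l * p) = of_real l * (of_real q * z - complex_of_real p)" for p q
        by (simp add: algebra_simps)
      then show ?thesis by (simp add: height_def norm_mult power_mult_distrib del: of_real_mult)
    qed
    also have "\<dots> > horoball_height s r" using z(2) l by (simp add: \<kappa>_def field_simps)
    finally have "w \<in> horoball s r" using horoball_iff[OF s r] w(1) by simp
    with w(2) show ?thesis by blast
  qed
  with r'(1) show ?thesis by blast
qed

subsection \<open>Matrix groups of subgroups of \<open>PSL\<^sub>2(R)\<close>\<close>

lemma PSL2R_coset:
  assumes "A \<in> g" "g \<in> carrier PSL2R"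
  shows "g = {A, - A}" "A \<in> carrier SL2R"
proof -
  obtain B where B: "B \<in> carrier SL2R" "g = r_coset SL2R {mat 1, - mat 1} B"
    using assms(2) by (auto simp: PSL2R_def FactGroup_def RCOSETS_def)
  have neg: "(- mat 1) ** B = - B" by (simp add: matrix_eq_2 matrix_mult_2 mat_2)
  have g: "g = {B, - B}" using neg by (auto simp: B(2) r_coset_def SL2R_simps)
  show "g = {A, - A}" using assms(1) unfolding g by auto
  show "A \<in> carrier SL2R" using assms(1) B(1) unfolding g by (auto simp: SL2R_simps)
qed

lemma PSL2R_mult: "g \<in> carrier PSL2R \<Longrightarrow> g' \<in> carrier PSL2R \<Longrightarrow> A \<in> g \<Longrightarrow> B \<in> g' \<Longrightarrow> A ** B \<in> g \<otimes>\<^bsub>PSL2R\<^esub> g'"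
  by (auto simp: PSL2R_def FactGroup_def set_mult_def SL2R_simps)

lemma PSL2R_carrier_nonempty: "g \<in> carrier PSL2R \<Longrightarrow> g \<noteq> {}"
  by (auto simp: PSL2R_def FactGroup_def RCOSETS_def r_coset_def)

text \<open>An element of the inverse coset multiplies A to 1 or -1, and the sign is absorbed
  because the union is closed under negation.\<close>

lemma subgroup_Union_PSL2R:
  assumes "subgroup \<Gamma> PSL2R"
  shows "subgroup (\<Union>\<Gamma>) SL2R" "\<And>A. A \<in> \<Union>\<Gamma> \<Longrightarrow> - A \<in> \<Union>\<Gamma>"
proof -
  interpret \<Gamma>: subgroup \<Gamma> PSL2R by fact
  interpret P: group PSL2R by (rule group_PSL2R)
  have mem: "g \<in> carrier PSL2R" if "g \<in> \<Gamma>" for g using that \<Gamma>.subset by blast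
  have one: "\<one>\<^bsub>PSL2R\<^esub> = {mat 1, - mat 1}" by (simp add: PSL2R_def FactGroup_def)
  show neg: "- A \<in> \<Union>\<Gamma>" if "A \<in> \<Union>\<Gamma>" for A
  proof -
    obtain g where g: "g \<in> \<Gamma>" "A \<in> g" using \<open>A \<in> \<Union>\<Gamma>\<close> by blast
    then have "g = {A, - A}" using PSL2R_coset(1) mem by blast
    with g show ?thesis by blast
  qed
  have mult: "A ** B \<in> \<Union>\<Gamma>" if "A \<in> \<Union>\<Gamma>" "B \<in> \<Union>\<Gamma>" for A B
    using that PSL2R_mult mem \<Gamma>.m_closed by (meson UnionE UnionI)
  show "subgroup (\<Union>\<Gamma>) SL2R"
  proof (rule SL2R.subgroupI)
    show "\<Union>\<Gamma> \<subseteq> carrier SL2R" using PSL2R_coset(2) mem by blast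
    show "\<Union>\<Gamma> \<noteq> {}" using \<Gamma>.one_closed one by blast
    fix A assume A: "A \<in> \<Union>\<Gamma>"
    then obtain g where g: "g \<in> \<Gamma>" "A \<in> g" by blast
    obtain B where B: "B \<in> inv\<^bsub>PSL2R\<^esub> g" using PSL2R_carrier_nonempty[of "inv\<^bsub>PSL2R\<^esub> g"] mem g by auto
    have Bc: "B \<in> carrier SL2R" using PSL2R_coset(2)[OF B] g mem by simp
    have Ac: "A \<in> carrier SL2R" using PSL2R_coset(2) g mem by blast
    have B\<Gamma>: "B \<in> \<Union>\<Gamma>" using B g by blast
    have "B ** A \<in> inv\<^bsub>PSL2R\<^esub> g \<otimes>\<^bsub>PSL2R\<^esub> g" using PSL2R_mult[of "inv\<^bsub>PSL2R\<^esub> g" g B A] B g mem by simp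
    then have "B ** A = mat 1 \<or> B ** A = - mat 1" using one g mem by simp
    then show "inv\<^bsub>SL2R\<^esub> A \<in> \<Union>\<Gamma>"
    proof
      assume "B ** A = mat 1"
      then have "inv\<^bsub>SL2R\<^esub> A = B" using SL2R.inv_equality[OF _ Ac Bc] by (simp add: SL2R_simps)
      then show ?thesis using B\<Gamma> by simp
    next
      assume "B ** A = - mat 1"
      then have "(- B) ** A = mat 1" by (simp add: matrix_eq_2 matrix_mult_2 mat_2)
      moreover have "- B \<in> carrier SL2R" using Bc by (simp add: SL2R_simps)
      ultimately have "inv\<^bsub>SL2R\<^esub> A = - B" using SL2R.inv_equality[OF _ Ac] by (simp add: SL2R_simps(2,3))
      then show ?thesis using neg[OF B\<Gamma>] by simp
    qed
  qed (use mult in \<open>simp add: SL2R_simps(2)\<close>)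
qed

text \<open>Each coset consists of at most two matrices, so finitely many cosets give finitely many
  representatives.\<close>

lemma finite_index_matrices:
  assumes \<Gamma>: "subgroup \<Gamma> PSL2R" and fi: "finite_index_subgroup PSL2R \<Gamma>\<^sub>1 \<Gamma>"
  shows "\<exists>R. finite R \<and> R \<subseteq> \<Union>\<Gamma> \<and> (\<forall>A\<in>\<Union>\<Gamma>. \<exists>B\<in>\<Union>\<Gamma>\<^sub>1. \<exists>C\<in>R. A = B ** C)"
proof -
  interpret P: group PSL2R by (rule group_PSL2R)
  note G1 = P.cover_of_finite_index[OF \<Gamma> fi]
  obtain R where R: "finite R" "R \<subseteq> \<Gamma>" "\<Gamma> \<subseteq> \<Gamma>\<^sub>1 <#>\<^bsub>PSL2R\<^esub> R" using G1(3) by blast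
  have car: "g \<in> carrier PSL2R" if "g \<in> \<Gamma>" for g using that subgroup.subset[OF \<Gamma>] by blast
  have "\<exists>B\<in>\<Union>\<Gamma>\<^sub>1. \<exists>C\<in>\<Union>R. A = B ** C" if "A \<in> \<Union>\<Gamma>" for A
  proof -
    obtain g where g: "g \<in> \<Gamma>" "A \<in> g" using \<open>A \<in> \<Union>\<Gamma>\<close> by blast
    then obtain k r where kr: "k \<in> \<Gamma>\<^sub>1" "r \<in> R" "g = k \<otimes>\<^bsub>PSL2R\<^esub> r" using R(3) by (auto simp: set_mult_def)
    then have "A \<in> k <#>\<^bsub>SL2R\<^esub> r" using g by (simp add: PSL2R_def FactGroup_def)
    then show ?thesis using kr by (auto simp: set_mult_def SL2R_simps(2))
  qed
  moreover have "finite (\<Union>R)"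
  proof (rule finite_Union)
    fix g assume "g \<in> R"
    then have "g \<in> carrier PSL2R" using R(2) car by blast
    then obtain A where "A \<in> g" using PSL2R_carrier_nonempty by blast
    have "finite {A, - A}" by simp
    then show "finite g" by (simp only: PSL2R_coset(1)[OF \<open>A \<in> g\<close> \<open>g \<in> carrier PSL2R\<close>, symmetric])
  qed (rule R(1))
  moreover have "\<Union>R \<subseteq> \<Union>\<Gamma>" using R(2) by (rule Union_mono)
  ultimately show ?thesis by (intro exI[of _ "\<Union>R"] conjI ballI)
qed

subsection \<open>Compactness\<close>

lemma mobius_ext_upper_half_plane:
  assumes "A \<in> carrier SL2R" "z \<in> upper_half_plane"
  shows "mobius_ext A (Some z) = Some (mobius A z)"
  using mobius_denominator_nonzero[OF assms] by (simp add: mobius_ext_def)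

lemma horoball_upper_half_plane:
  "s \<in> insert None (Some ` \<real>) \<Longrightarrow> r > 0 \<Longrightarrow> horoball s r \<subseteq> upper_half_plane"
  by (simp add: subset_iff horoball_iff)

lemma cusps_boundary: "cusps \<Gamma> \<subseteq> insert None (Some ` \<real>)"
  by (auto simp: cusps_def)

lemma boundary_not_upper_half_plane: "z \<in> upper_half_plane \<Longrightarrow> Some z \<notin> insert None (Some ` \<real>)"
  by (auto simp: upper_half_plane_def elim: Reals_cases)

lemma mobius_ext_one: "mobius_ext (mat 1) x = x"
  by (cases x) (auto simp: mobius_ext_def mat_2 mobius_def)

lemma orbit_of_upper_half_plane:
  assumes "subgroup \<Gamma> PSL2R" "A \<in> \<Union>\<Gamma>" "z \<in> upper_half_plane"
  shows "orbit_of \<Gamma> (Some (mobius A z)) = orbit_of \<Gamma> (Some z)"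
proof -
  interpret G: subgroup "\<Union>\<Gamma>" SL2R using subgroup_Union_PSL2R(1)[OF assms(1)] .
  have "orbit_of \<Gamma> (Some (mobius A z)) \<subseteq> orbit_of \<Gamma> (Some z)" if "A \<in> \<Union>\<Gamma>" "z \<in> upper_half_plane" for A z
  proof
    fix y assume "y \<in> orbit_of \<Gamma> (Some (mobius A z))"
    then obtain B where B: "B \<in> \<Union>\<Gamma>" "y = mobius_ext B (Some (mobius A z))" by (auto simp: orbit_of_def)
    have "y = mobius_ext (B ** A) (Some z)"
      using B that G.mem_carrier by (simp add: mobius_ext_upper_half_plane mobius_in_upper_half_plane mobius_mult SL2R_mult)
    moreover have "B ** A \<in> \<Union>\<Gamma>" using G.m_closed[OF B(1) that(1)] by (simp add: SL2R_simps(2))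
    ultimately show "y \<in> orbit_of \<Gamma> (Some z)" unfolding orbit_of_def by blast
  qed
  from this[OF assms(2,3)] this[OF G.m_inv_closed[OF assms(2)] mobius_in_upper_half_plane[OF G.mem_carrier[OF assms(2)] assms(3)]]
  show ?thesis using mobius_inv(1)[OF G.mem_carrier[OF assms(2)] assms(3)] by auto
qed

lemma orbit_ofD:
  assumes "subgroup \<Gamma> PSL2R" "orbit_of \<Gamma> y = orbit_of \<Gamma> x"
  shows "\<exists>A\<in>\<Union>\<Gamma>. y = mobius_ext A x"
proof -
  interpret G: subgroup "\<Union>\<Gamma>" SL2R using subgroup_Union_PSL2R(1)[OF assms(1)] .
  have "mat 1 \<in> \<Union>\<Gamma>" using G.one_closed by (simp only: SL2R_simps(3))
  then have "y \<in> orbit_of \<Gamma> y" unfolding orbit_of_def using mobius_ext_one[of y] by (metis imageI)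
  then have "y \<in> orbit_of \<Gamma> x" by (simp only: assms(2))
  then show ?thesis unfolding orbit_of_def by blast
qed

text \<open>The points whose orbit meets S or U form, inside the upper half plane, a union of
  preimages of U; at a cusp A s a horoball is obtained by moving the one at s by A.\<close>

lemma openin_orbit_space:
  assumes \<Gamma>: "subgroup \<Gamma> PSL2R" and U: "open U" "U \<subseteq> upper_half_plane" and S: "S \<subseteq> cusps \<Gamma>"
    and horo: "\<And>s. s \<in> S \<Longrightarrow> \<exists>r>0. horoball s r \<subseteq> U"
  shows "openin (orbit_space \<Gamma>) (orbit_of \<Gamma> ` (S \<union> Some ` U))"
proof -
  interpret G: subgroup "\<Union>\<Gamma>" SL2R using subgroup_Union_PSL2R(1)[OF \<Gamma>] .
  let ?W = "orbit_of \<Gamma> ` (S \<union> Some ` U)" and ?E = "extended_plane \<Gamma>"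
  define E where "E = {x \<in> ?E. orbit_of \<Gamma> x \<in> ?W}"
  have iff: "Some z \<in> E \<longleftrightarrow> (\<exists>A\<in>\<Union>\<Gamma>. mobius A z \<in> U)" if z: "z \<in> upper_half_plane" for z
  proof
    assume "Some z \<in> E"
    then obtain x where x: "x \<in> S \<union> Some ` U" "orbit_of \<Gamma> (Some z) = orbit_of \<Gamma> x" unfolding E_def by blast
    then obtain A where A: "A \<in> \<Union>\<Gamma>" "x = mobius_ext A (Some z)" using orbit_ofD[OF \<Gamma>, of x "Some z"] by auto
    then have "x = Some (mobius A z)" using mobius_ext_upper_half_plane G.mem_carrier z by simp
    moreover have "Some (mobius A z) \<notin> insert None (Some ` \<real>)"
      using boundary_not_upper_half_plane mobius_in_upper_half_plane G.mem_carrier A z by blast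
    ultimately show "\<exists>A\<in>\<Union>\<Gamma>. mobius A z \<in> U" using x A S cusps_boundary by blast
  next
    assume "\<exists>A\<in>\<Union>\<Gamma>. mobius A z \<in> U"
    then obtain A where A: "A \<in> \<Union>\<Gamma>" "mobius A z \<in> U" by blast
    have "orbit_of \<Gamma> (Some z) = orbit_of \<Gamma> (Some (mobius A z))"
      using orbit_of_upper_half_plane[OF \<Gamma> A(1) z] ..
    with A z show "Some z \<in> E" by (auto simp: E_def extended_plane_def)
  qed
  have "openin (extended_plane_topology \<Gamma>) E"
    unfolding extended_plane_topology_def topology_inverse'[OF istopology_extended_plane]
  proof (intro conjI ballI)
    show "E \<subseteq> ?E" by (auto simp: E_def)
    have "{z \<in> upper_half_plane. Some z \<in> E} = (\<Union>A\<in>\<Union>\<Gamma>. upper_half_plane \<inter> mobius A -` U)"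
    proof (rule Set.set_eqI)
      fix z
      show "z \<in> {z \<in> upper_half_plane. Some z \<in> E} \<longleftrightarrow> z \<in> (\<Union>A\<in>\<Union>\<Gamma>. upper_half_plane \<inter> mobius A -` U)"
        using iff[of z] by (cases "z \<in> upper_half_plane") blast+
    qed
    moreover have "open (upper_half_plane \<inter> mobius A -` U)" if "A \<in> \<Union>\<Gamma>" for A
      using holomorphic_on_imp_continuous_on[OF holomorphic_mobius[OF G.mem_carrier[OF that]]] upper_half_plane(1) U(1)
      by (rule continuous_open_preimage)
    ultimately show "open {z \<in> upper_half_plane. Some z \<in> E}" by (simp only:) (rule open_UN, blast)
    fix s' assume s': "s' \<in> E \<inter> cusps \<Gamma>"
    then obtain x where x: "x \<in> S \<union> Some ` U" "orbit_of \<Gamma> s' = orbit_of \<Gamma> x" unfolding E_def by blast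
    then obtain A where A: "A \<in> \<Union>\<Gamma>" "s' = mobius_ext A x" using orbit_ofD[OF \<Gamma>] by blast
    have "x \<in> S"
    proof (rule ccontr)
      assume "x \<notin> S"
      then obtain z where z: "x = Some z" "z \<in> upper_half_plane" using x(1) U(2) by blast
      then have "s' = Some (mobius A z)" using A mobius_ext_upper_half_plane G.mem_carrier by simp
      then show False
        using s' cusps_boundary boundary_not_upper_half_plane mobius_in_upper_half_plane[OF G.mem_carrier[OF A(1)] z(2)] by blast
    qed
    then obtain r where r: "r > 0" "horoball x r \<subseteq> U" using horo by blast
    have "x \<in> insert None (Some ` \<real>)" using \<open>x \<in> S\<close> S cusps_boundary by blast
    from horoball_mobius_ext[OF G.mem_carrier[OF A(1)] this r(1)]
    obtain r' where r': "r' > 0" "horoball s' r' \<subseteq> mobius A ` horoball x r" using A(2) by blast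
    have "Some z \<in> E" if "z \<in> horoball s' r'" for z
    proof -
      obtain w where w: "w \<in> U" "z = mobius A w" using r'(2) r(2) \<open>z \<in> _\<close> by blast
      then have wH: "w \<in> upper_half_plane" using U(2) by blast
      have "z \<in> upper_half_plane" using w mobius_in_upper_half_plane[OF G.mem_carrier[OF A(1)] wH] by simp
      moreover have "mobius (inv\<^bsub>SL2R\<^esub> A) z \<in> U" using w mobius_inv(1)[OF G.mem_carrier[OF A(1)] wH] by simp
      ultimately show ?thesis using iff G.m_inv_closed[OF A(1)] by blast
    qed
    with r'(1) show "\<exists>r>0. Some ` horoball s' r \<subseteq> E" by blast
  qed
  moreover have "S \<union> Some ` U \<subseteq> ?E" using S U(2) by (auto simp: extended_plane_def)
  ultimately show ?thesis
    unfolding orbit_space_def topology_inverse'[OF istopology_orbit_space] E_def by blast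
qed

text \<open>A substitute for a fundamental domain: images of discs and cusp neighbourhoods of
  prescribed sizes cover the compact orbit space, so finitely many of them do.\<close>

lemma fundamental_cover:
  assumes \<Gamma>: "fuchsian_first_kind \<Gamma>"
    and \<rho>: "\<And>z. z \<in> upper_half_plane \<Longrightarrow> \<rho> z > 0" and \<kappa>: "\<And>s. s \<in> cusps \<Gamma> \<Longrightarrow> \<kappa> s > 0"
  shows "\<exists>Z S. finite Z \<and> Z \<subseteq> upper_half_plane \<and> finite S \<and> S \<subseteq> cusps \<Gamma> \<and> (\<forall>z\<in>upper_half_plane.
    \<exists>A\<in>\<Union>\<Gamma>. (\<exists>x\<in>Z. mobius A z \<in> ball x (\<rho> x)) \<or> (\<exists>s\<in>S. mobius A z \<in> horoball s (\<kappa> s)))"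
proof -
  have sub: "subgroup \<Gamma> PSL2R" and comp: "compact_space (orbit_space \<Gamma>)"
    using \<Gamma> by (auto simp: fuchsian_first_kind_def fuchsian_def)
  interpret G: subgroup "\<Union>\<Gamma>" SL2R using subgroup_Union_PSL2R(1)[OF sub] .
  define W where "W = (\<lambda>x. case x of Inl z \<Rightarrow> orbit_of \<Gamma> ` (Some ` (ball z (\<rho> z) \<inter> upper_half_plane))
    | Inr s \<Rightarrow> orbit_of \<Gamma> ` ({s} \<union> Some ` horoball s (\<kappa> s)))"
  define J where "J = Inl ` upper_half_plane \<union> Inr ` cusps \<Gamma>"
  have openW: "openin (orbit_space \<Gamma>) (W x)" if "x \<in> J" for x
    using that unfolding J_def
  proof
    assume "x \<in> Inl ` upper_half_plane"
    then obtain z where "x = Inl z" by blast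
    then show ?thesis
      using openin_orbit_space[OF sub, of "ball z (\<rho> z) \<inter> upper_half_plane" "{}"] upper_half_plane(1)
      by (simp add: W_def open_Int)
  next
    assume "x \<in> Inr ` cusps \<Gamma>"
    then obtain s where s: "x = Inr s" "s \<in> cusps \<Gamma>" by blast
    have "open (horoball s (\<kappa> s))"
      by (cases s) (auto simp: horoball_def open_halfspace_Im_gt)
    moreover have "horoball s (\<kappa> s) \<subseteq> upper_half_plane"
      using horoball_upper_half_plane[OF subsetD[OF cusps_boundary s(2)] \<kappa>[OF s(2)]] .
    moreover have "\<exists>r>0. horoball s' r \<subseteq> horoball s (\<kappa> s)" if "s' \<in> {s}" for s'
      using that \<kappa>[OF s(2)] by blast
    ultimately show ?thesis
      using openin_orbit_space[OF sub, of "horoball s (\<kappa> s)" "{s}"] s by (simp add: W_def)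
  qed
  have "orbit_of \<Gamma> x \<in> \<Union>(W ` J)" if "x \<in> extended_plane \<Gamma>" for x
    using that unfolding extended_plane_def
  proof
    assume "x \<in> Some ` upper_half_plane"
    then obtain z where "x = Some z" "z \<in> upper_half_plane" by blast
    then have "orbit_of \<Gamma> x \<in> W (Inl z)" "Inl z \<in> J" using \<rho> by (auto simp: W_def J_def)
    then show ?thesis by blast
  next
    assume "x \<in> cusps \<Gamma>"
    then have "orbit_of \<Gamma> x \<in> W (Inr x)" "Inr x \<in> J" by (auto simp: W_def J_def)
    then show ?thesis by blast
  qed
  then have sup: "orbit_of \<Gamma> ` extended_plane \<Gamma> \<subseteq> \<Union>(W ` J)" by blast
  have "W' \<subseteq> orbit_of \<Gamma> ` extended_plane \<Gamma>" if "openin (orbit_space \<Gamma>) W'" for W'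
    using that unfolding orbit_space_def topology_inverse'[OF istopology_orbit_space] by blast
  then have "topspace (orbit_space \<Gamma>) \<subseteq> orbit_of \<Gamma> ` extended_plane \<Gamma>" using openin_topspace by blast
  moreover have "\<Union>(W ` J) \<subseteq> topspace (orbit_space \<Gamma>)" using openW openin_subset by blast
  ultimately have top: "\<Union>(W ` J) = topspace (orbit_space \<Gamma>)" "topspace (orbit_space \<Gamma>) = orbit_of \<Gamma> ` extended_plane \<Gamma>"
    using sup by auto
  have "\<exists>\<F>. finite \<F> \<and> \<F> \<subseteq> W ` J \<and> \<Union>\<F> = topspace (orbit_space \<Gamma>)"
  proof (rule comp[unfolded compact_space, rule_format])
    show "(\<forall>U\<in>W ` J. openin (orbit_space \<Gamma>) U) \<and> \<Union>(W ` J) = topspace (orbit_space \<Gamma>)"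
      using openW by (intro conjI top(1) ballI) (elim imageE, simp only:)
  qed
  then obtain F where F: "finite F" "F \<subseteq> W ` J" "\<Union>F = topspace (orbit_space \<Gamma>)"
    by (elim exE conjE) (rule that)
  obtain J' where J': "J' \<subseteq> J" "finite J'" "F = W ` J'" 
    using finite_subset_image[OF F(1,2)] by (elim exE conjE) (rule that)
  define Z where "Z = Inl -` J'"
  define S where "S = Inr -` J'"
  have fin: "finite Z" "finite S"
    using J'(2) by (auto simp: Z_def S_def intro!: finite_vimageI)
  moreover have "Z \<subseteq> upper_half_plane" "S \<subseteq> cusps \<Gamma>" using J'(1) by (auto simp: Z_def S_def J_def)
  moreover have "\<exists>A\<in>\<Union>\<Gamma>. (\<exists>x\<in>Z. mobius A z \<in> ball x (\<rho> x)) \<or> (\<exists>s\<in>S. mobius A z \<in> horoball s (\<kappa> s))" if z: "z \<in> upper_half_plane" for z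
  proof -
    have "orbit_of \<Gamma> (Some z) \<in> \<Union>(W ` J')" unfolding J'(3)[symmetric] F(3) top(2) using z by (simp add: extended_plane_def)
    then obtain x where x: "x \<in> J'" "orbit_of \<Gamma> (Some z) \<in> W x" by blast
    have key: "\<exists>A\<in>\<Union>\<Gamma>. Some (mobius A z) = y" if "orbit_of \<Gamma> (Some z) = orbit_of \<Gamma> y" for y
      using orbit_ofD[OF sub that[symmetric]] mobius_ext_upper_half_plane[OF _ z] G.mem_carrier by metis
    show ?thesis
    proof (cases x)
      case (Inl w)
      then obtain u where u: "u \<in> ball w (\<rho> w)" "orbit_of \<Gamma> (Some z) = orbit_of \<Gamma> (Some u)"
        using x(2) by (auto simp: W_def)
      obtain A where "A \<in> \<Union>\<Gamma>" "Some (mobius A z) = Some u" using key[OF u(2)] by blast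
      moreover have "w \<in> Z" using x Inl by (simp add: Z_def)
      ultimately show ?thesis using u(1) by auto
    next
      case (Inr s)
      then obtain y where y: "y \<in> {s} \<union> Some ` horoball s (\<kappa> s)" "orbit_of \<Gamma> (Some z) = orbit_of \<Gamma> y"
        using x(2) by (auto simp: W_def)
      obtain A where A: "A \<in> \<Union>\<Gamma>" "Some (mobius A z) = y" using key[OF y(2)] by blast
      have "s \<in> cusps \<Gamma>" using x(1) J'(1) Inr by (auto simp: J_def)
      \<comment> \<open>A point of the upper half plane is never a cusp, so it lies in the horoball
        itself.\<close>
      then have "Some (mobius A z) \<noteq> s"
        using boundary_not_upper_half_plane mobius_in_upper_half_plane[OF G.mem_carrier[OF A(1)] z] cusps_boundary by blast
      then have "mobius A z \<in> horoball s (\<kappa> s)" using A(2) y(1) by auto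
      moreover have "s \<in> S" using x Inr by (simp add: S_def)
      ultimately show ?thesis using A(1) by blast
    qed
  qed
  ultimately show ?thesis by (intro exI[of _ Z] exI[of _ S] conjI ballI)
qed

subsection \<open>Parabolic elements\<close>

lemma translation_simps:
  "translation h $1$1 = 1" "translation h $1$2 = h" "translation h $2$1 = 0" "translation h $2$2 = 1"
  by (simp_all add: translation_def)

lemma translation_SL2R: "translation h \<in> carrier SL2R"
  by (simp add: SL2R_simps translation_simps)

lemma translation_add: "translation h ** translation h' = translation (h + h')"
  by (simp add: matrix_eq_2 matrix_mult_2 translation_simps)

lemma translation_0: "translation 0 = mat 1"
  by (simp add: matrix_eq_2 translation_simps mat_2)

abbreviation parabolic :: "real^2^2 \<Rightarrow> real \<Rightarrow> real^2^2" where
  "parabolic \<sigma> h \<equiv> \<sigma> ** translation h ** inv\<^bsub>SL2R\<^esub> \<sigma>"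

lemma parabolic_SL2R: "\<sigma> \<in> carrier SL2R \<Longrightarrow> parabolic \<sigma> h \<in> carrier SL2R"
  by (intro SL2R_mult translation_SL2R SL2R_inv)

lemma parabolic_mult:
  assumes "\<sigma> \<in> carrier SL2R"
  shows "parabolic \<sigma> h ** parabolic \<sigma> h' = parabolic \<sigma> (h + h')"
proof -
  have "parabolic \<sigma> h ** parabolic \<sigma> h' = \<sigma> ** translation h ** (inv\<^bsub>SL2R\<^esub> \<sigma> ** \<sigma>) ** translation h' ** inv\<^bsub>SL2R\<^esub> \<sigma>"
    by (simp only: matrix_mul_assoc)
  also have "\<dots> = \<sigma> ** (translation h ** translation h') ** inv\<^bsub>SL2R\<^esub> \<sigma>"
    by (simp only: SL2R_inv[OF assms] matrix_mul_rid matrix_mul_assoc)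
  finally show ?thesis by (simp only: translation_add)
qed

lemma parabolic_inv:
  assumes "\<sigma> \<in> carrier SL2R"
  shows "inv\<^bsub>SL2R\<^esub> (parabolic \<sigma> h) = parabolic \<sigma> (- h)"
proof (rule SL2R.inv_equality)
  have "parabolic \<sigma> 0 = mat 1" by (simp add: translation_0 SL2R_inv[OF assms])
  then show "parabolic \<sigma> (- h) \<otimes>\<^bsub>SL2R\<^esub> parabolic \<sigma> h = \<one>\<^bsub>SL2R\<^esub>"
    by (simp add: SL2R_simps(2,3) parabolic_mult[OF assms])
qed (use parabolic_SL2R[OF assms] in auto)

text \<open>A nontrivial element of trace 2 or -2 that fixes s becomes, after s is moved to
  infinity, a translation up to sign. Negation removes the sign, and inversion makes the period
  positive.\<close>

lemma cusp_parabolic: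
  assumes \<Gamma>: "subgroup \<Gamma> PSL2R" and s: "s \<in> cusps \<Gamma>"
  obtains \<sigma> h where "\<sigma> \<in> carrier SL2R" "h > 0" "mobius_ext \<sigma> None = s" "parabolic \<sigma> h \<in> \<Union>\<Gamma>"
proof -
  interpret G: subgroup "\<Union>\<Gamma>" SL2R using subgroup_Union_PSL2R(1)[OF \<Gamma>] .
  obtain A where A: "A \<in> \<Union>\<Gamma>" "A \<noteq> mat 1" "A \<noteq> - mat 1" "\<bar>trace A\<bar> = 2" "mobius_ext A s = s"
    and sb: "s \<in> insert None (Some ` \<real>)" using s by (auto simp: cusps_def)
  have det: "A$1$1 * A$2$2 - A$1$2 * A$2$1 = 1" using G.mem_carrier[OF A(1)] by (simp add: SL2R_simps)
  have tr: "\<bar>A$1$1 + A$2$2\<bar> = 2" using A(4) by (simp add: trace_def sum_2)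
  \<comment> \<open>Applied to the two eigenvalues of A: product 1 and sum 2 or -2 force them to be
    equal.\<close>
  have eps: "\<exists>\<epsilon>. (\<epsilon> = 1 \<or> \<epsilon> = -1) \<and> u = \<epsilon> \<and> v = \<epsilon>" if "u * v = 1" "\<bar>u + v\<bar> = 2" for u v :: real
  proof -
    have "(u - v)\<^sup>2 = (u + v)\<^sup>2 - 4 * (u * v)" by (simp add: power2_eq_square algebra_simps)
    also have "\<dots> = \<bar>u + v\<bar>\<^sup>2 - 4" using that(1) by simp
    finally have "u = v" using that(2) by simp
    with that(2) show ?thesis by auto
  qed
  have "\<exists>\<sigma> k. \<sigma> \<in> carrier SL2R \<and> k \<noteq> 0 \<and> mobius_ext \<sigma> None = s \<and> (A = parabolic \<sigma> k \<or> A = - parabolic \<sigma> k)"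
  proof (cases s)
    case None
    then have c: "A$2$1 = 0" using A(5) by (auto simp: mobius_ext_def split: if_splits)
    then obtain \<epsilon> where e: "\<epsilon> = 1 \<or> \<epsilon> = -1" "A$1$1 = \<epsilon>" "A$2$2 = \<epsilon>"
      using eps[of "A$1$1" "A$2$2"] det tr by auto
    have p: "parabolic (mat 1) k = translation k" for k
      using SL2R.inv_one by (simp add: SL2R_simps(3))
    have "A$1$2 \<noteq> 0" using A(2,3) c e by (auto simp: matrix_eq_2 mat_2)
    moreover have "A = parabolic (mat 1) (\<epsilon> * A$1$2) \<or> A = - parabolic (mat 1) (\<epsilon> * A$1$2)"
      unfolding p using c e by (auto simp: matrix_eq_2 translation_simps)
    ultimately show ?thesis using None e(1)
      by (intro exI[of _ "mat 1"] exI[of _ "\<epsilon> * A$1$2"]) (auto simp: SL2R_simps mat_2 mobius_ext_one)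
  next
    case (Some x)
    with sb obtain t where t: "x = of_real t" by (auto elim: Reals_cases)
    have e: "of_real (A$2$1) * x + of_real (A$2$2) = complex_of_real (A$2$1 * t + A$2$2)"
      "of_real (A$1$1) * x + of_real (A$1$2) = complex_of_real (A$1$1 * t + A$1$2)" by (simp_all add: t)
    have nz: "A$2$1 * t + A$2$2 \<noteq> 0"
    proof
      assume "A$2$1 * t + A$2$2 = 0"
      then have "mobius_ext A s = None" unfolding mobius_ext_def Some option.case e by simp
      with A(5) Some show False by simp
    qed
    then have "mobius_ext A s = Some (of_real ((A$1$1 * t + A$1$2) / (A$2$1 * t + A$2$2)))"
      unfolding mobius_ext_def Some option.case mobius_def e by (simp only: of_real_eq_0_iff if_False of_real_divide)
    then have "of_real ((A$1$1 * t + A$1$2) / (A$2$1 * t + A$2$2)) = complex_of_real t"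
      using A(5) Some t by simp
    then have "(A$1$1 * t + A$1$2) / (A$2$1 * t + A$2$2) = t" by (simp only: of_real_eq_iff)
    then have b: "A$1$2 = (A$2$1 * t + A$2$2) * t - A$1$1 * t" using nz by (simp add: field_simps)
    \<comment> \<open>The eigenvalue on the fixed vector (t, 1), and the other one as read off the
      trace.\<close>
    have "(A$2$1 * t + A$2$2) * (A$1$1 - A$2$1 * t) = 1" using det unfolding b by (simp add: algebra_simps)
    moreover have "\<bar>(A$2$1 * t + A$2$2) + (A$1$1 - A$2$1 * t)\<bar> = 2" using tr by (simp add: algebra_simps)
    ultimately obtain \<epsilon> where \<epsilon>: "\<epsilon> = 1 \<or> \<epsilon> = -1" "A$2$1 * t + A$2$2 = \<epsilon>" "A$1$1 - A$2$1 * t = \<epsilon>"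
      using eps by blast
    \<comment> \<open>\<sigma> moves infinity to t, and \<tau> is its inverse.\<close>
    define \<sigma> :: "real^2^2" where "\<sigma> = vector [vector [t, -1], vector [1, 0]]"
    define \<tau> :: "real^2^2" where "\<tau> = vector [vector [0, 1], vector [-1, t]]"
    have s: "\<sigma>$1$1 = t" "\<sigma>$1$2 = -1" "\<sigma>$2$1 = 1" "\<sigma>$2$2 = 0" "\<tau>$1$1 = 0" "\<tau>$1$2 = 1" "\<tau>$2$1 = -1" "\<tau>$2$2 = t"
      by (simp_all add: \<sigma>_def \<tau>_def)
    have \<sigma>: "\<sigma> \<in> carrier SL2R" "\<tau> \<in> carrier SL2R" by (simp_all add: SL2R_simps s)
    have "inv\<^bsub>SL2R\<^esub> \<sigma> = \<tau>"
      by (rule SL2R.inv_equality[OF _ \<sigma>]) (simp add: SL2R_simps(2,3) matrix_eq_2 matrix_mult_2 mat_2 s)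
    then have p: "parabolic \<sigma> k $1$1 = 1 - k * t" "parabolic \<sigma> k $1$2 = k * t * t"
      "parabolic \<sigma> k $2$1 = - k" "parabolic \<sigma> k $2$2 = 1 + k * t" for k
      by (simp_all add: matrix_mult_2 s translation_simps algebra_simps)
    have c: "A$2$1 \<noteq> 0"
    proof
      assume "A$2$1 = 0"
      then have "A = mat 1 \<or> A = - mat 1" using \<epsilon> b by (auto simp: matrix_eq_2 mat_2)
      with A(2,3) show False by blast
    qed
    have a: "A$1$1 = \<epsilon> + A$2$1 * t" "A$2$2 = \<epsilon> - A$2$1 * t" using \<epsilon> by simp_all
    have "A = parabolic \<sigma> (- \<epsilon> * A$2$1) \<or> A = - parabolic \<sigma> (- \<epsilon> * A$2$1)"
      using \<epsilon>(1) by (auto simp: matrix_eq_2 p a b algebra_simps)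
    moreover have "mobius_ext \<sigma> None = s" by (simp add: mobius_ext_def s Some t)
    ultimately show ?thesis using \<sigma> c \<epsilon>(1) by (intro exI[of _ \<sigma>] exI[of _ "- \<epsilon> * A$2$1"]) auto
  qed
  then obtain \<sigma> k where \<sigma>: "\<sigma> \<in> carrier SL2R" "k \<noteq> 0" "mobius_ext \<sigma> None = s" "A = parabolic \<sigma> k \<or> A = - parabolic \<sigma> k" by blast
  have k: "parabolic \<sigma> k \<in> \<Union>\<Gamma>" using \<sigma>(4) A(1) subgroup_Union_PSL2R(2)[OF \<Gamma>, of A] by auto
  then have "parabolic \<sigma> (- k) \<in> \<Union>\<Gamma>" using G.m_inv_closed[OF k] by (simp only: parabolic_inv[OF \<sigma>(1)])
  note neg = this
  show ?thesis
  proof (cases "k > 0")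
    case True
    show ?thesis by (rule that[OF \<sigma>(1) True \<sigma>(3) k])
  next
    case False
    with \<sigma>(2) have "- k > 0" by simp
    then show ?thesis by (rule that[OF \<sigma>(1) _ \<sigma>(3) neg])
  qed
qed

text \<open>Pigeonhole: among the powers of the parabolic element two lie in the same coset of the
  smaller group, and their quotient is a power that belongs to it.\<close>

lemma parabolic_finite_index:
  assumes \<Gamma>: "subgroup \<Gamma> PSL2R" and \<Gamma>\<^sub>1: "subgroup \<Gamma>\<^sub>1 PSL2R"
    and R: "finite R" "R \<subseteq> \<Union>\<Gamma>" "\<And>A. A \<in> \<Union>\<Gamma> \<Longrightarrow> \<exists>B\<in>\<Union>\<Gamma>\<^sub>1. \<exists>C\<in>R. A = B ** C"
    and \<sigma>: "\<sigma> \<in> carrier SL2R" and h: "h > 0" "parabolic \<sigma> h \<in> \<Union>\<Gamma>"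
  obtains h' where "h' > 0" "parabolic \<sigma> h' \<in> \<Union>\<Gamma>\<^sub>1"
proof -
  interpret G: subgroup "\<Union>\<Gamma>" SL2R using subgroup_Union_PSL2R(1)[OF \<Gamma>] .
  interpret G1: subgroup "\<Union>\<Gamma>\<^sub>1" SL2R using subgroup_Union_PSL2R(1)[OF \<Gamma>\<^sub>1] .
  have p: "parabolic \<sigma> (real n * h) \<in> \<Union>\<Gamma>" for n
  proof (induction n)
    case 0
    have "parabolic \<sigma> (real 0 * h) = mat 1" by (simp add: translation_0 SL2R_inv[OF \<sigma>])
    then show ?case using G.one_closed by (simp only: SL2R_simps(3))
  next
    case (Suc n)
    have "parabolic \<sigma> (real (Suc n) * h) = parabolic \<sigma> h ** parabolic \<sigma> (real n * h)"
      unfolding parabolic_mult[OF \<sigma>] by (simp add: algebra_simps)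
    then show ?case using G.m_closed[OF h(2) Suc] by (simp only: SL2R_simps(2))
  qed
  have "\<forall>n. \<exists>C. C \<in> R \<and> (\<exists>B\<in>\<Union>\<Gamma>\<^sub>1. parabolic \<sigma> (real n * h) = B ** C)" using R(3)[OF p] by blast
  from choice[OF this] obtain C where C: "\<And>n. C n \<in> R" "\<And>n. \<exists>B\<in>\<Union>\<Gamma>\<^sub>1. parabolic \<sigma> (real n * h) = B ** C n" by blast
  have "finite (range C)" using C(1) R(1) by (meson finite_subset image_subsetI)
  then have "\<not> inj C" using finite_imageD infinite_UNIV_nat by blast
  then obtain i j where ij: "C i = C j" "i < j" unfolding inj_def by (metis linorder_neqE_nat)
  obtain Bi Bj where B: "Bi \<in> \<Union>\<Gamma>\<^sub>1" "Bj \<in> \<Union>\<Gamma>\<^sub>1" "parabolic \<sigma> (real i * h) = Bi ** C i" "parabolic \<sigma> (real j * h) = Bj ** C j"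
    using C(2) by meson
  have car: "Bi \<in> carrier SL2R" "Bj \<in> carrier SL2R" "C i \<in> carrier SL2R"
    using B(1,2) G1.mem_carrier G.mem_carrier subsetD[OF R(2) C(1)] by blast+
  have "parabolic \<sigma> (real (j - i) * h) ** (Bi ** C i) = Bj ** C i"
    unfolding B(3)[symmetric] parabolic_mult[OF \<sigma>] using B(4) ij by (simp add: of_nat_diff algebra_simps)
  then have "(parabolic \<sigma> (real (j - i) * h) \<otimes>\<^bsub>SL2R\<^esub> Bi) \<otimes>\<^bsub>SL2R\<^esub> C i = Bj \<otimes>\<^bsub>SL2R\<^esub> C i"
    by (simp only: SL2R_simps(2) matrix_mul_assoc)
  then have "parabolic \<sigma> (real (j - i) * h) \<otimes>\<^bsub>SL2R\<^esub> Bi = Bj"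
    by (rule SL2R.r_cancel) (use car parabolic_SL2R[OF \<sigma>] in auto)
  then have "parabolic \<sigma> (real (j - i) * h) = Bj \<otimes>\<^bsub>SL2R\<^esub> inv\<^bsub>SL2R\<^esub> Bi"
    using car parabolic_SL2R[OF \<sigma>] SL2R.inv_solve_right[of "parabolic \<sigma> (real (j - i) * h)" Bj Bi] by auto
  then have "parabolic \<sigma> (real (j - i) * h) \<in> \<Union>\<Gamma>\<^sub>1"
    using G1.m_closed[OF B(2) G1.m_inv_closed[OF B(1)]] by (simp only:)
  moreover have "real (j - i) * h > 0" using ij h by simp
  ultimately show ?thesis using that by blast
qed

lemma parabolic_conjugate:
  assumes "C \<in> carrier SL2R" "\<sigma> \<in> carrier SL2R"
  shows "parabolic (C ** \<sigma>) h = C ** parabolic \<sigma> h ** inv\<^bsub>SL2R\<^esub> C"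
proof -
  have "inv\<^bsub>SL2R\<^esub> (C ** \<sigma>) = inv\<^bsub>SL2R\<^esub> \<sigma> ** inv\<^bsub>SL2R\<^esub> C"
    using SL2R.inv_mult_group[OF assms] by (simp only: SL2R_simps(2))
  then show ?thesis by (simp only: matrix_mul_assoc)
qed

section \<open>Algebraic dependence of automorphic functions\<close>

definition combination :: "nat \<Rightarrow> (nat \<times> nat \<Rightarrow> complex) \<Rightarrow> (complex \<Rightarrow> complex) \<Rightarrow> (complex \<Rightarrow> complex) \<Rightarrow> complex \<Rightarrow> complex" where
  "combination m c f g z = (\<Sum>(a, b)\<in>{..m} \<times> {..m}. c (a, b) * f z ^ a * g z ^ b)"

text \<open>Condition e is a linear form in c with coefficients \<open>\<psi> e\<close>, fixed
  before c is chosen, so that conditions can be counted against coefficients.\<close>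

definition satisfies :: "nat \<Rightarrow> (nat \<times> nat \<Rightarrow> complex) \<Rightarrow> nat \<Rightarrow> (nat \<Rightarrow> nat \<times> nat \<Rightarrow> complex) \<Rightarrow> bool" where
  "satisfies m c n \<psi> \<longleftrightarrow> (\<forall>e<n. (\<Sum>x\<in>{..m} \<times> {..m}. c x * \<psi> e x) = 0)"

text \<open>The number of conditions grows only linearly with the degree \<open>m\<close>, whereas the number of
  coefficients grows quadratically.\<close>

lemma vanishing_conditions:
  assumes "f meromorphic_on {p}" "g meromorphic_on {p}"
  obtains K where "\<And>m. \<exists>\<psi>. \<forall>c. satisfies m c (K * m + 1) \<psi> \<longrightarrow> (combination m c f g \<longlongrightarrow> 0) (at p)"
proof -
  define F where "F = laurent_expansion f p"
  define G where "G = laurent_expansion g p"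
  have F: "(\<lambda>w. f (p + w)) has_laurent_expansion F" and G: "(\<lambda>w. g (p + w)) has_laurent_expansion G"
    using assms meromorphic_on_imp_has_laurent_expansion by (auto simp: F_def G_def)
  \<comment> \<open>N bounds the pole orders of f and g at p.\<close>
  define N where "N = nat (max 0 (max (- fls_subdegree F) (- fls_subdegree G)))"
  have N: "- int N \<le> fls_subdegree F" "- int N \<le> fls_subdegree G" by (auto simp: N_def)
  have low: "fls_nth (F ^ a * G ^ b) k = 0" if "a \<le> m" "b \<le> m" "k < - int (2 * N * m)" for a b m k
  proof -
    have "- int (N * m) \<le> int a * fls_subdegree F" "- int (N * m) \<le> int b * fls_subdegree G"
      using mult_left_mono[OF N(1), of "int a"] mult_left_mono[OF N(2), of "int b"]
        mult_right_mono[of "int a" "int m" "int N"] mult_right_mono[of "int b" "int m" "int N"] that(1,2)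
      by (auto simp: algebra_simps)
    then have "k < fls_subdegree (F ^ a) + fls_subdegree (G ^ b)"
      using that(3) by (simp add: fls_subdegree_pow algebra_simps)
    then show ?thesis by (rule fls_times_nth_eq0)
  qed
  have "\<exists>\<psi>. \<forall>c. satisfies m c ((2 * N) * m + 1) \<psi> \<longrightarrow> (combination m c f g \<longlongrightarrow> 0) (at p)" for m
  \<comment> \<open>The product of f^a and g^b has no Laurent coefficients below -2 N m. The
    conditions kill the indices from -2 N m up to 0 inclusive, hence 2 N m + 1 of them, and the
    limit becomes 0 rather than merely finite.\<close>
  proof (intro exI[of _ "\<lambda>e (a, b). fls_nth (F ^ a * G ^ b) (int e - int (2 * N * m))"] allI impI)
    fix c
    assume sat: "satisfies m c ((2 * N) * m + 1) (\<lambda>e (a, b). fls_nth (F ^ a * G ^ b) (int e - int (2 * N * m)))"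
    define L where "L = (\<Sum>(a, b)\<in>{..m} \<times> {..m}. fls_const (c (a, b)) * F ^ a * G ^ b)"
    have L: "(\<lambda>w. combination m c f g (p + w)) has_laurent_expansion L"
      unfolding combination_def L_def case_prod_unfold
      by (intro has_laurent_expansion_sum has_laurent_expansion_mult has_laurent_expansion_power F G has_laurent_expansion_const)
    have nth: "fls_nth L k = (\<Sum>x\<in>{..m} \<times> {..m}. c x * fls_nth (F ^ fst x * G ^ snd x) k)" for k
      by (simp add: L_def fls_nth_sum case_prod_unfold mult.assoc)
    have zero: "fls_nth L k = 0" if "k \<le> 0" for k
    proof (cases "k < - int (2 * N * m)")
      case True
      then show ?thesis unfolding nth by (intro sum.neutral ballI) (auto simp: low)
    next
      case False
      define e where "e = nat (k + int (2 * N * m))"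
      have k: "k = int e - int (2 * N * m)" using False unfolding e_def by linarith
      then have "int e \<le> int (2 * N * m)" using \<open>k \<le> 0\<close> by linarith
      then have "e < (2 * N) * m + 1" by (simp only: of_nat_le_iff less_Suc_eq_le Suc_eq_plus1[symmetric])
      note this k
      then show ?thesis using sat unfolding nth satisfies_def by (auto simp: case_prod_unfold)
    qed
    then have "fls_subdegree L \<ge> 0" by (intro fls_subdegree_ge0I) simp
    from has_laurent_expansion_imp_tendsto[OF L this] zero[of 0]
    show "(combination m c f g \<longlongrightarrow> 0) (at p)" by simp
  qed
  with that show ?thesis by blast
qed

lemma combination_analytic:
  assumes "f analytic_on {z}" "g analytic_on {z}"
  shows "combination m c f g analytic_on {z}"
  unfolding combination_def[abs_def] case_prod_unfold using assms by (intro analytic_intros)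

lemma combination_meromorphic:
  assumes "f meromorphic_on A" "g meromorphic_on A"
  shows "combination m c f g meromorphic_on A"
  unfolding combination_def[abs_def] case_prod_unfold using assms by (intro meromorphic_intros)

text \<open>At the cost of linearly many conditions, combinations have no poles on T and are bounded
  on T by their modulus at a point of the upper half plane, which prepares the maximum principle.
  \<open>remove_sings\<close> supplies the values at the poles of f and g.\<close>

definition controlled :: "(complex \<Rightarrow> complex) \<Rightarrow> (complex \<Rightarrow> complex) \<Rightarrow> complex set \<Rightarrow> bool" where
  "controlled f g T \<longleftrightarrow> (\<exists>K. \<forall>m. \<exists>\<psi>. \<forall>c. satisfies m c (K * m + 1) \<psi> \<longrightarrow>
     (\<forall>w\<in>T. \<exists>l. (combination m c f g \<longlongrightarrow> l) (at w)) \<and>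
     (\<exists>w0\<in>upper_half_plane. \<forall>w\<in>T. norm (remove_sings (combination m c f g) w) \<le> norm (remove_sings (combination m c f g) w0)))"

lemma controlledI:
  assumes "\<And>m. \<exists>\<psi>. \<forall>c. satisfies m c (K * m + 1) \<psi> \<longrightarrow> P m c"
    and "\<And>m c w. P m c \<Longrightarrow> w \<in> T \<Longrightarrow> \<exists>l. (combination m c f g \<longlongrightarrow> l) (at w)"
    and "\<And>m c. P m c \<Longrightarrow> \<exists>w0\<in>upper_half_plane. \<forall>w\<in>T.
      norm (remove_sings (combination m c f g) w) \<le> norm (remove_sings (combination m c f g) w0)"
  shows "controlled f g T"
  unfolding controlled_def
proof (rule exI[of _ K], rule allI)
  fix m
  obtain \<psi> where \<psi>: "\<And>c. satisfies m c (K * m + 1) \<psi> \<Longrightarrow> P m c" using assms(1)[of m] by blast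
  show "\<exists>\<psi>. \<forall>c. satisfies m c (K * m + 1) \<psi> \<longrightarrow> (\<forall>w\<in>T. \<exists>l. (combination m c f g \<longlongrightarrow> l) (at w)) \<and>
    (\<exists>w0\<in>upper_half_plane. \<forall>w\<in>T. norm (remove_sings (combination m c f g) w) \<le> norm (remove_sings (combination m c f g) w0))"
    by (intro exI[of _ \<psi>] allI impI conjI ballI assms(2,3) \<psi>)
qed

lemma controlled_subset:
  assumes "controlled f g T" "T' \<subseteq> T"
  shows "controlled f g T'"
proof -
  obtain K where K: "\<forall>m. \<exists>\<psi>. \<forall>c. satisfies m c (K * m + 1) \<psi> \<longrightarrow>
     (\<forall>w\<in>T. \<exists>l. (combination m c f g \<longlongrightarrow> l) (at w)) \<and> (\<exists>w0\<in>upper_half_plane. \<forall>w\<in>T.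
      norm (remove_sings (combination m c f g) w) \<le> norm (remove_sings (combination m c f g) w0))"
    using assms(1) unfolding controlled_def by blast
  show ?thesis by (rule controlledI[OF K[rule_format]]) (use assms(2) in blast)+
qed

section \<open>Controlled neighbourhoods of interior points and of cusps\<close>

context meromorphic_pair
begin

lemma meromorphic: "f meromorphic_on upper_half_plane" "g meromorphic_on upper_half_plane"
  using mero by (auto simp: nicely_meromorphic_on_def)

lemma combination_regular:
  assumes "z \<in> regular_points f g"
  shows "(combination m c f g \<longlongrightarrow> combination m c f g z) (at z)"
  using analytic_at_imp_isCont[OF combination_analytic[OF analytic_regular[OF assms]]] by (rule isContD)

lemma remove_sings_combination_analytic:
  assumes "z \<in> upper_half_plane" "(combination m c f g \<longlongrightarrow> l) (at z)"
  shows "remove_sings (combination m c f g) analytic_on {z}"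
proof (rule remove_sings_analytic_at[OF _ assms(2)])
  have "combination m c f g meromorphic_on {z}"
    using meromorphic_on_subset[OF combination_meromorphic[OF meromorphic]] assms(1) by simp
  then show "isolated_singularity_at (combination m c f g) z" by (simp add: meromorphic_at_iff)
qed

text \<open>On a closed disc whose only possible pole is p, vanishing at p makes the extended
  combination continuous, so its modulus attains a maximum.\<close>

lemma controlled_ball:
  assumes p: "p \<in> upper_half_plane"
  shows "\<exists>r>0. controlled f g (ball p r)"
proof -
  have "eventually (\<lambda>w. w \<in> upper_half_plane \<and> (w \<noteq> p \<longrightarrow> w \<in> regular_points f g)) (nhds p)"
    using eventually_regular[OF p] eventually_nhds_in_open[OF upper_half_plane(1) p]
    by (simp add: eventually_at_filter eventually_conj_iff)
  then obtain r where r: "r > 0" "\<And>w. dist w p < r \<Longrightarrow> w \<in> upper_half_plane \<and> (w \<noteq> p \<longrightarrow> w \<in> regular_points f g)"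
    unfolding eventually_nhds_metric by blast
  have sub: "w \<in> upper_half_plane" "w \<noteq> p \<Longrightarrow> w \<in> regular_points f g" if "w \<in> cball p (r / 2)" for w
    using r(2)[of w] that r(1) by (auto simp: dist_commute)
  obtain K where K: "\<And>m. \<exists>\<psi>. \<forall>c. satisfies m c (K * m + 1) \<psi> \<longrightarrow> (combination m c f g \<longlongrightarrow> 0) (at p)"
    using vanishing_conditions[OF meromorphic_on_subset[OF meromorphic(1)] meromorphic_on_subset[OF meromorphic(2)], of p] p
    by (metis empty_subsetI insert_subset)
  have lim: "\<exists>l. (combination m c f g \<longlongrightarrow> l) (at w)"
    if z: "(combination m c f g \<longlongrightarrow> 0) (at p)" "w \<in> cball p (r/2)" for m c w
  proof (cases "w = p")
    case False
    then show ?thesis using combination_regular[OF sub(2)[OF z(2)]] by blast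
  qed (use z in blast)
  have "controlled f g (ball p (r/2))"
  proof (rule controlledI[OF K])
    fix m c assume z: "(combination m c f g \<longlongrightarrow> 0) (at p)"
    show "\<exists>l. (combination m c f g \<longlongrightarrow> l) (at w)" if "w \<in> ball p (r/2)" for w
      using lim[OF z] that by simp
    let ?h = "remove_sings (combination m c f g)"
    have "isCont ?h w" if w: "w \<in> cball p (r/2)" for w
    proof -
      obtain l where "(combination m c f g \<longlongrightarrow> l) (at w)" using lim[OF z w] by blast
      from remove_sings_combination_analytic[OF sub(1)[OF w] this] show ?thesis by (rule analytic_at_imp_isCont)
    qed
    then have "continuous_on (cball p (r/2)) (\<lambda>w. norm (?h w))"
      by (intro continuous_on_norm continuous_at_imp_continuous_on ballI)
    moreover have "cball p (r/2) \<noteq> {}" using r(1) by auto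
    ultimately obtain w0 where w0: "w0 \<in> cball p (r/2)" "\<forall>w\<in>cball p (r/2). norm (?h w) \<le> norm (?h w0)"
      using continuous_attains_sup[OF compact_cball] by blast
    show "\<exists>w0\<in>upper_half_plane. \<forall>w\<in>ball p (r/2). norm (?h w) \<le> norm (?h w0)"
      by (rule bexI[of _ w0]) (use w0 sub(1) in auto)
  qed
  then show ?thesis using r(1) by (intro exI[of _ "r/2"]) simp
qed

text \<open>In the coordinate q = exp(2 pi \<i> z / h) the cusp is q = 0, and the combination is
  continuous on a closed disc around it. The maximum is attained at some q \<noteq> 0, which comes
  from a point of the upper half plane, or at 0. In the latter case it is zero, because the
  conditions demand vanishing at the cusp, and any point dominates.\<close>

lemma controlled_cusp:
  assumes \<sigma>: "\<sigma> \<in> carrier SL2R" and h: "h > 0"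
    and F: "F meromorphic_on {0}" "\<And>z. Im z > C \<and> Im z > 0 \<Longrightarrow> f (mobius \<sigma> z) = F (exp (2 * of_real pi * \<i> * z / of_real h))"
    and G: "G meromorphic_on {0}" "\<And>z. Im z > C' \<and> Im z > 0 \<Longrightarrow> g (mobius \<sigma> z) = G (exp (2 * of_real pi * \<i> * z / of_real h))"
  shows "\<exists>M>0. controlled f g (mobius \<sigma> ` {z. Im z > M})"
proof -
  define q where "q = (\<lambda>z. exp (2 * of_real pi * \<i> * z / of_real h) :: complex)"
  have norm_q: "norm (q z) = exp (- (2 * pi * Im z / h))" for z by (simp add: q_def)
  define D where "D = max (max C C') 0"
  have "eventually (\<lambda>w. F analytic_on {w} \<and> G analytic_on {w}) (at 0)"
    using F(1) G(1) by (simp add: meromorphic_at_iff eventually_conj_iff isolated_singularity_at_altdef)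
  moreover have "eventually (\<lambda>w. w \<in> ball 0 (exp (- (2 * pi * D / h)))) (at (0 :: complex))"
    by (rule eventually_at_in_open') auto
  ultimately have "eventually (\<lambda>w. F analytic_on {w} \<and> G analytic_on {w} \<and> norm w < exp (- (2 * pi * D / h))) (at 0)"
    by eventually_elim auto
  then obtain d where d: "d > 0" "\<And>w. w \<noteq> 0 \<Longrightarrow> dist w 0 < d \<Longrightarrow> F analytic_on {w} \<and> G analytic_on {w} \<and> norm w < exp (- (2 * pi * D / h))"
    unfolding eventually_at by blast
  \<comment> \<open>Half of d makes room for a closed disc. The bound on the norm of w will force Im
    z > D, where both expansions are valid.\<close>
  define \<epsilon> where "\<epsilon> = d / 2"
  have \<epsilon>: "\<epsilon> > 0" "\<And>w. w \<noteq> 0 \<Longrightarrow> norm w \<le> \<epsilon> \<Longrightarrow> F analytic_on {w} \<and> G analytic_on {w} \<and> norm w < exp (- (2 * pi * D / h))"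
    using d by (auto simp: \<epsilon>_def)
  have Im_D: "Im z > D" if "norm (q z) \<le> \<epsilon>" for z
  proof -
    have "norm (q z) < exp (- (2 * pi * D / h))" using \<epsilon>(2)[of "q z"] that by (simp add: q_def)
    then have "2 * pi * D / h < 2 * pi * Im z / h" unfolding norm_q by simp
    then show ?thesis using h by (simp add: divide_less_cancel)
  qed
  \<comment> \<open>Obtained by solving exp(-2 pi Im z / h) < \<epsilon> for Im z.\<close>
  define M where "M = max 1 (- (h * ln \<epsilon> / (2 * pi)))"
  have M: "norm (q z) \<le> \<epsilon>" if "Im z > M" for z
  proof -
    have "- (h * ln \<epsilon> / (2 * pi)) < Im z" using that by (simp add: M_def)
    then have "- (2 * pi * Im z / h) < ln \<epsilon>" using h by (simp add: field_simps)
    then have "exp (- (2 * pi * Im z / h)) < exp (ln \<epsilon>)" by (simp only: exp_less_cancel_iff)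
    then show ?thesis unfolding norm_q using \<epsilon>(1) by simp
  qed
  obtain K where K: "\<And>m. \<exists>\<psi>. \<forall>c. satisfies m c (K * m + 1) \<psi> \<longrightarrow> (combination m c F G \<longlongrightarrow> 0) (at 0)"
    using vanishing_conditions[OF F(1) G(1)] by blast
  have "controlled f g (mobius \<sigma> ` {z. Im z > M})"
  proof (rule controlledI[OF K])
    fix m c assume z0: "(combination m c F G \<longlongrightarrow> 0) (at 0)"
    let ?h = "combination m c f g" and ?H = "combination m c F G"
    have eq: "?h (mobius \<sigma> z) = ?H (q z)" if "Im z > D" for z
      using F(2)[of z] G(2)[of z] that by (simp add: combination_def q_def D_def)
    have lim: "(?h \<longlongrightarrow> ?H (q z)) (at (mobius \<sigma> z))" if z: "norm (q z) \<le> \<epsilon>" for z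
    proof -
      let ?\<tau> = "inv\<^bsub>SL2R\<^esub> \<sigma>" and ?w = "mobius \<sigma> z"
      have zD: "Im z > D" using Im_D z by blast
      then have zH: "z \<in> upper_half_plane" by (simp add: upper_half_plane_def D_def)
      have wH: "?w \<in> upper_half_plane" using mobius_in_upper_half_plane[OF \<sigma> zH] .
      have tw: "mobius ?\<tau> ?w = z" using mobius_inv(1)[OF \<sigma> zH] .
      have ct: "isCont (mobius ?\<tau>) ?w" using isCont_mobius[OF SL2R_inv(3)[OF \<sigma>] wH] .
      have "?H analytic_on {q z}" using \<epsilon>(2)[of "q z"] z combination_analytic by (simp add: q_def)
      then have "isCont ?H (q (mobius ?\<tau> ?w))" unfolding tw by (rule analytic_at_imp_isCont)
      moreover have "isCont (\<lambda>w. q (mobius ?\<tau> w)) ?w" unfolding q_def by (intro continuous_intros ct) (use h in simp)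
      ultimately have "isCont (\<lambda>w. ?H (q (mobius ?\<tau> w))) ?w" by (rule isCont_o2[rotated])
      then have l: "((\<lambda>w. ?H (q (mobius ?\<tau> w))) \<longlongrightarrow> ?H (q z)) (at ?w)" unfolding isCont_def tw .
      have "open {w. Im w > D}" by (rule open_halfspace_Im_gt)
      then have "eventually (\<lambda>w. mobius ?\<tau> w \<in> {w. Im w > D}) (at ?w)"
        using ct zD unfolding isCont_def by (intro topological_tendstoD) (auto simp: tw)
      moreover have "eventually (\<lambda>w. w \<in> upper_half_plane) (at ?w)"
        using eventually_at_in_open'[OF upper_half_plane(1) wH] .
      ultimately have "eventually (\<lambda>w. ?H (q (mobius ?\<tau> w)) = ?h w) (at ?w)"
      proof eventually_elim
        case (elim w)
        then show ?case using eq[of "mobius ?\<tau> w"] mobius_inv(2)[OF \<sigma> elim(2)] by simp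
      qed
      from tendsto_cong[OF this] l show ?thesis by simp
    qed
    have rs: "remove_sings ?h (mobius \<sigma> z) = ?H (q z)" if "norm (q z) \<le> \<epsilon>" for z
      using lim[OF that] by (rule remove_sings_eqI)
    define P where "P = (\<lambda>w. if w = 0 then 0 else ?H w)"
    have "isCont P w" if "w \<in> cball 0 \<epsilon>" for w
    proof (cases "w = 0")
      case True
      have "(P \<longlongrightarrow> 0) (at 0) \<longleftrightarrow> (?H \<longlongrightarrow> 0) (at 0)"
        by (rule tendsto_cong) (auto simp: P_def eventually_at_filter)
      with z0 True show ?thesis by (simp add: isCont_def P_def)
    next
      case False
      then have "?H analytic_on {w}" using \<epsilon>(2)[of w] that combination_analytic by auto
      then have "isCont ?H w" by (rule analytic_at_imp_isCont)
      moreover have "eventually (\<lambda>w. P w = ?H w) (nhds w)"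
        using t1_space_nhds[OF False] by eventually_elim (simp add: P_def)
      ultimately show ?thesis using isCont_cong by blast
    qed
    then have "continuous_on (cball 0 \<epsilon>) (\<lambda>w. norm (P w))"
      by (intro continuous_on_norm continuous_at_imp_continuous_on) blast
    moreover have "cball (0 :: complex) \<epsilon> \<noteq> {}" using \<epsilon>(1) by auto
    ultimately obtain u where u: "u \<in> cball 0 \<epsilon>" "\<forall>w\<in>cball 0 \<epsilon>. norm (P w) \<le> norm (P u)"
      using continuous_attains_sup[OF compact_cball] by blast
    have bound: "norm (remove_sings ?h (mobius \<sigma> z)) \<le> norm (P u)" if "Im z > M" for z
    proof -
      have "remove_sings ?h (mobius \<sigma> z) = P (q z)" using rs[OF M[OF that]] by (simp add: P_def q_def)
      moreover have "q z \<in> cball 0 \<epsilon>" using M[OF that] by simp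
      ultimately show ?thesis using u(2) by simp
    qed
    have "\<exists>w0\<in>upper_half_plane. norm (P u) \<le> norm (remove_sings ?h w0)"
    proof (cases "u = 0")
      case True
      then show ?thesis using upper_half_plane(4) by (auto simp: P_def)
    next
      case False
      define z where "z = of_real h * Ln u / (2 * of_real pi * \<i>)"
      have qz: "q z = u" using False h by (simp add: q_def z_def)
      then have nz: "norm (q z) \<le> \<epsilon>" using u(1) by simp
      then have "z \<in> upper_half_plane" using Im_D[of z] by (auto simp: upper_half_plane_def D_def)
      then have "mobius \<sigma> z \<in> upper_half_plane" using mobius_in_upper_half_plane[OF \<sigma>] by blast
      moreover have "norm (P u) \<le> norm (remove_sings ?h (mobius \<sigma> z))" using rs[OF nz] False by (simp add: P_def qz)
      ultimately show ?thesis by blast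
    qed
    then obtain w0 where "w0 \<in> upper_half_plane" "norm (P u) \<le> norm (remove_sings ?h w0)" by blast
    note w0 = this
    show "\<exists>w0\<in>upper_half_plane. \<forall>w\<in>mobius \<sigma> ` {z. Im z > M}. norm (remove_sings ?h w) \<le> norm (remove_sings ?h w0)"
    proof (rule bexI[OF _ w0(1)], rule ballI)
      fix w assume "w \<in> mobius \<sigma> ` {z. Im z > M}"
      then obtain z where "w = mobius \<sigma> z" "Im z > M" by blast
      with bound w0(2) show "norm (remove_sings ?h w) \<le> norm (remove_sings ?h w0)" by (auto intro: order_trans)
    qed
    show "\<exists>l. (?h \<longlongrightarrow> l) (at w)" if w: "w \<in> mobius \<sigma> ` {z. Im z > M}" for w
    proof -
      obtain z where "w = mobius \<sigma> z" "Im z > M" using w by blast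
      with lim[OF M] show ?thesis by blast
    qed
  qed
  moreover have "M > 0" by (simp add: M_def)
  ultimately show ?thesis by blast
qed

lemma remove_sings_combination_zero:
  assumes rs: "\<And>z. z \<in> upper_half_plane \<Longrightarrow> remove_sings (combination m c f g) z = 0" and z: "z \<in> regular_points f g"
  shows "combination m c f g z = 0"
  using remove_sings_eqI[OF combination_regular[OF z]] rs[of z] z by (simp add: regular_points_def)

end

text \<open>A combination all of whose poles cancel extends to a bounded holomorphic function that attains the
  maximum of its modulus; being zero at one point, it vanishes.\<close>

lemma (in meromorphic_pair) controlled_cover_imp_relation:
  assumes G: "subgroup G SL2R" and inv: "\<And>A z. A \<in> G \<Longrightarrow> z \<in> upper_half_plane \<Longrightarrow> f (mobius A z) = f z \<and> g (mobius A z) = g z"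
    and T: "finite \<T>" "\<And>T. T \<in> \<T> \<Longrightarrow> controlled f g T"
    and cover: "\<And>z. z \<in> upper_half_plane \<Longrightarrow> \<exists>A\<in>G. \<exists>T\<in>\<T>. \<exists>w\<in>T. w \<in> upper_half_plane \<and> z = mobius A w"
  shows "\<exists>m c. (\<exists>a\<le>m. \<exists>b\<le>m. c (a, b) \<noteq> 0) \<and> (\<forall>z\<in>regular_points f g. combination m c f g z = 0)"
proof -
  interpret G: subgroup G SL2R by (rule G)
  have i: "\<i> \<in> upper_half_plane" by (simp add: upper_half_plane_def)
  \<comment> \<open>Vanishing at the base point \<i> is imposed in addition to the conditions of the
    pieces; it will identify the constant given by the maximum principle as 0.\<close>
  obtain K0 where K0: "\<And>m. \<exists>\<psi>. \<forall>c. satisfies m c (K0 * m + 1) \<psi> \<longrightarrow> (combination m c f g \<longlongrightarrow> 0) (at \<i>)"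
    using vanishing_conditions[OF meromorphic_on_subset[OF meromorphic(1)] meromorphic_on_subset[OF meromorphic(2)], of \<i>] i
    by (metis empty_subsetI insert_subset)
  let ?good = "\<lambda>T m c. (\<forall>w\<in>T. \<exists>l. (combination m c f g \<longlongrightarrow> l) (at w)) \<and> (\<exists>w0\<in>upper_half_plane. \<forall>w\<in>T.
      norm (remove_sings (combination m c f g) w) \<le> norm (remove_sings (combination m c f g) w0))"
  have "\<forall>T. \<exists>K. T \<in> \<T> \<longrightarrow> (\<forall>m. \<exists>\<psi>. \<forall>c. satisfies m c (K * m + 1) \<psi> \<longrightarrow> ?good T m c)"
    using T(2) unfolding controlled_def by blast
  from choice[OF this] obtain K where K: "\<And>T m. T \<in> \<T> \<Longrightarrow> \<exists>\<psi>. \<forall>c. satisfies m c (K T * m + 1) \<psi> \<longrightarrow> ?good T m c" by blast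
  \<comment> \<open>Large enough that the K0 m + 1 conditions at \<i> and the K T m + 1 conditions
    of each piece T together stay below the (m + 1)^2 coefficients.\<close>
  define m where "m = K0 + (\<Sum>T\<in>\<T>. K T) + card \<T> + 1"
  obtain \<psi>0 where \<psi>0: "\<And>c. satisfies m c (K0 * m + 1) \<psi>0 \<Longrightarrow> (combination m c f g \<longlongrightarrow> 0) (at \<i>)"
    using K0[of m] by blast
  have "\<forall>T. \<exists>\<psi>. T \<in> \<T> \<longrightarrow> (\<forall>c. satisfies m c (K T * m + 1) \<psi> \<longrightarrow> ?good T m c)" using K[of _ m] by blast
  from choice[OF this] obtain \<psi> where \<psi>: "\<And>T c. T \<in> \<T> \<Longrightarrow> satisfies m c (K T * m + 1) (\<psi> T) \<Longrightarrow> ?good T m c" by blast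
  define E where "E = Inl ` {..<K0 * m + 1} \<union> Inr ` (SIGMA T:\<T>. {..<K T * m + 1})"
  define v where "v = (\<lambda>x e (u :: unit). case e of Inl k \<Rightarrow> \<psi>0 k x | Inr (T, k) \<Rightarrow> \<psi> T k x)"
  have finE: "finite E" using T(1) by (auto simp: E_def)
  have "card E \<le> (K0 * m + 1) + (\<Sum>T\<in>\<T>. K T * m + 1)"
    unfolding E_def using T(1) by (intro order_trans[OF card_Un_le] add_mono) (auto simp: card_image card_SigmaI)
  also have "\<dots> = (K0 + (\<Sum>T\<in>\<T>. K T)) * m + card \<T> + 1"
    unfolding sum.distrib sum_distrib_right[symmetric] by (simp add: algebra_simps)
  also have "\<dots> < (m + 1) * (m + 1)"
  proof -
    have "K0 + (\<Sum>T\<in>\<T>. K T) \<le> m" "card \<T> + 1 \<le> m" by (simp_all add: m_def)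
    then have "(K0 + (\<Sum>T\<in>\<T>. K T)) * m + (card \<T> + 1) \<le> m * m + m" by (intro add_mono mult_right_mono) auto
    then show ?thesis by (simp add: algebra_simps)
  qed
  also have "\<dots> = card ({..m} \<times> {..m})" by (simp add: card_cartesian_product)
  finally have card: "card E < card ({..m} \<times> {..m})" .
  \<comment> \<open>Functions on a one-point set are complex numbers, so division-free elimination
    yields ordinary linear algebra.\<close>
  interpret const: function_domain "UNIV :: unit set" "UNIV :: (unit \<Rightarrow> complex) set"
    by standard auto
  obtain c' where c': "\<exists>x\<in>{..m} \<times> {..m}. \<exists>u\<in>UNIV. c' x u \<noteq> (0 :: complex)"
    "\<forall>e\<in>E. \<forall>u\<in>UNIV. (\<Sum>x\<in>{..m} \<times> {..m}. c' x u * v x e u) = 0"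
    using const.linear_dependence[OF finE _ card, of v] by auto
  define c where "c = (\<lambda>x. c' x ())"
  have lin: "(\<Sum>x\<in>{..m} \<times> {..m}. c x * v x e ()) = 0" if "e \<in> E" for e
    using c'(2) that by (simp add: c_def)
  have "satisfies m c (K0 * m + 1) \<psi>0"
    unfolding satisfies_def using lin[of "Inl _"] by (auto simp: v_def E_def)
  then have lim_i: "(combination m c f g \<longlongrightarrow> 0) (at \<i>)" by (rule \<psi>0)
  have good: "?good T m c" if "T \<in> \<T>" for T
  proof (rule \<psi>[OF that])
    show "satisfies m c (K T * m + 1) (\<psi> T)"
      unfolding satisfies_def
    proof (intro allI impI)
      fix e assume "e < K T * m + 1"
      then have "Inr (T, e) \<in> E" using that by (auto simp: E_def)
      from lin[OF this] show "(\<Sum>x\<in>{..m} \<times> {..m}. c x * \<psi> T e x) = 0" by (simp add: v_def)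
    qed
  qed
  let ?h = "combination m c f g"
  let ?H = "remove_sings ?h"
  \<comment> \<open>Invariance carries the limit at w to z = A w, so control on the pieces extends
    to the whole upper half plane.\<close>
  have transfer: "\<exists>l. (?h \<longlongrightarrow> l) (at z) \<and> ?H z = l \<and> ?H w = l"
    if h: "A \<in> G" "T \<in> \<T>" "w \<in> T" "w \<in> upper_half_plane" "z = mobius A w" for A T w z
  proof -
    obtain l where l: "(?h \<longlongrightarrow> l) (at w)" using good h by blast
    have A: "A \<in> carrier SL2R" using h(1) G.mem_carrier by blast
    let ?B = "inv\<^bsub>SL2R\<^esub> A"
    have z: "z \<in> upper_half_plane" "mobius ?B z = w"
      using mobius_in_upper_half_plane[OF A h(4)] mobius_inv(1)[OF A h(4)] h(5) by simp_all
    have "filterlim (mobius ?B) (at w) (at z)" using filterlim_mobius[OF SL2R_inv(3)[OF A] z(1)] z(2) by simp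
    from filterlim_compose[OF l this] have L: "((\<lambda>x. ?h (mobius ?B x)) \<longlongrightarrow> l) (at z)" .
    have "eventually (\<lambda>x. ?h (mobius ?B x) = ?h x) (at z)"
      using eventually_at_in_open'[OF upper_half_plane(1) z(1)]
      by eventually_elim (simp add: combination_def inv[OF G.m_inv_closed[OF h(1)]])
    from iffD1[OF tendsto_cong[OF this] L] have z': "(?h \<longlongrightarrow> l) (at z)" .
    show ?thesis by (intro exI[of _ l] conjI z' remove_sings_eqI[OF z'] remove_sings_eqI[OF l])
  qed
  have "?H analytic_on {z}" if z: "z \<in> upper_half_plane" for z
  proof -
    obtain A T w where "A \<in> G" "T \<in> \<T>" "w \<in> T" "w \<in> upper_half_plane" "z = mobius A w" using cover[OF z] by blast
    from transfer[OF this] obtain l where "(?h \<longlongrightarrow> l) (at z)" by (elim exE conjE) (rule that)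
    then show ?thesis by (rule remove_sings_combination_analytic[OF z])
  qed
  then have "?H analytic_on upper_half_plane" by (simp add: analytic_on_analytic_at[of _ upper_half_plane])
  then have hol: "?H holomorphic_on upper_half_plane" by (rule analytic_imp_holomorphic)
  have "\<forall>T. \<exists>w0. T \<in> \<T> \<longrightarrow> w0 \<in> upper_half_plane \<and> (\<forall>w\<in>T. norm (?H w) \<le> norm (?H w0))" using good by blast
  from choice[OF this] obtain w0 where w0: "\<And>T. T \<in> \<T> \<Longrightarrow> w0 T \<in> upper_half_plane"
    "\<And>T w. T \<in> \<T> \<Longrightarrow> w \<in> T \<Longrightarrow> norm (?H w) \<le> norm (?H (w0 T))" by blast
  have "\<T> \<noteq> {}" using cover[OF i] by blast
  then have "\<exists>T0\<in>\<T>. \<forall>T\<in>\<T>. norm (?H (w0 T)) \<le> norm (?H (w0 T0))"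
  proof -
    let ?N = "(\<lambda>T. norm (?H (w0 T))) ` \<T>"
    have N: "finite ?N" "?N \<noteq> {}" using T(1) \<open>\<T> \<noteq> {}\<close> by simp_all
    obtain T0 where "T0 \<in> \<T>" "Max ?N = norm (?H (w0 T0))" using Max_in[OF N] by blast
    then show ?thesis using Max_ge[OF N(1)] by (intro bexI[of _ T0]) auto
  qed
  then obtain T0 where T0: "T0 \<in> \<T>" "\<And>T. T \<in> \<T> \<Longrightarrow> norm (?H (w0 T)) \<le> norm (?H (w0 T0))" by blast
  have max: "norm (?H z) \<le> norm (?H (w0 T0))" if z: "z \<in> upper_half_plane" for z
  proof -
    obtain A T w where *: "A \<in> G" "T \<in> \<T>" "w \<in> T" "w \<in> upper_half_plane" "z = mobius A w" using cover[OF z] by blast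
    from transfer[OF *] have "?H z = ?H w" by (elim exE conjE) simp
    also have "norm \<dots> \<le> norm (?H (w0 T))" using w0(2) * by blast
    also have "\<dots> \<le> norm (?H (w0 T0))" using T0(2) * by blast
    finally show ?thesis .
  qed
  have "?H constant_on upper_half_plane"
    using maximum_modulus_principle[OF hol upper_half_plane(1,2,1) order.refl w0(1)[OF T0(1)] max] .
  moreover have "?H \<i> = 0" using lim_i by (rule remove_sings_eqI)
  ultimately have "?H z = 0" if "z \<in> upper_half_plane" for z using that i by (auto simp: constant_on_def)
  then have "\<forall>z\<in>regular_points f g. ?h z = 0" using remove_sings_combination_zero by blast
  moreover have "\<exists>a\<le>m. \<exists>b\<le>m. c (a, b) \<noteq> 0" using c'(1) by (auto simp: c_def)
  ultimately show ?thesis by blast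
qed

text \<open>Compactness is given for \<Gamma>, but invariance of both functions only for
  \<open>\<Gamma>\<^sub>1\<close>. The finite cover for \<Gamma> is therefore moved by finitely many
  coset representatives C; at a cusp C s the smaller group still has a period.\<close>

lemma automorphic_functions_dependent:
  assumes \<Gamma>: "fuchsian_first_kind \<Gamma>" and fi: "finite_index_subgroup PSL2R \<Gamma>\<^sub>1 \<Gamma>"
    and j: "uniformizing_function \<Gamma>\<^sub>1 j" "uniformizing_function \<Gamma>\<^sub>1 j\<^sub>1"
  shows "\<exists>m c. (\<exists>a\<le>m. \<exists>b\<le>m. c (a, b) \<noteq> 0) \<and> (\<forall>z\<in>regular_points j j\<^sub>1. combination m c j j\<^sub>1 z = 0)"
proof -
  have sub: "subgroup \<Gamma> PSL2R" using \<Gamma> by (simp add: fuchsian_first_kind_def fuchsian_def)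
  have sub1: "subgroup \<Gamma>\<^sub>1 PSL2R" using group.cover_of_finite_index(1)[OF group_PSL2R sub fi] .
  interpret G: subgroup "\<Union>\<Gamma>" SL2R using subgroup_Union_PSL2R(1)[OF sub] .
  interpret meromorphic_pair j j\<^sub>1 
    using j by (simp add: meromorphic_pair_def uniformizing_function_def)
  obtain R where R': "finite R" "R \<subseteq> \<Union>\<Gamma>" "\<forall>A\<in>\<Union>\<Gamma>. \<exists>B\<in>\<Union>\<Gamma>\<^sub>1. \<exists>C\<in>R. A = B ** C"
    using finite_index_matrices[OF sub fi] by (elim exE conjE) (rule that)
  note R = R'(1,2) bspec[OF R'(3)]
  have RC: "C \<in> carrier SL2R" if "C \<in> R" for C using G.mem_carrier[OF subsetD[OF R(2) that]] .
  have "\<forall>p. \<exists>r. p \<in> upper_half_plane \<longrightarrow> r > 0 \<and> controlled j j\<^sub>1 (ball p r)" using controlled_ball by blast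
  from choice[OF this] obtain r where r: "\<And>p. p \<in> upper_half_plane \<Longrightarrow> r p > 0"
    "\<And>p. p \<in> upper_half_plane \<Longrightarrow> controlled j j\<^sub>1 (ball p (r p))" by blast
  \<comment> \<open>The disc is so small that every representative C maps it into a controlled disc
    around C x.\<close>
  have "\<exists>\<rho>>0. \<forall>w\<in>ball x \<rho>. \<forall>C\<in>R. mobius C w \<in> ball (mobius C x) (r (mobius C x))" if x: "x \<in> upper_half_plane" for x
  proof -
    have "eventually (\<lambda>w. mobius C w \<in> ball (mobius C x) (r (mobius C x))) (nhds x)" if C: "C \<in> R" for C
    proof -
      have l: "filterlim (mobius C) (nhds (mobius C x)) (nhds x)"
        using isCont_mobius[OF RC[OF C] x] unfolding isCont_def tendsto_at_iff_tendsto_nhds .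
      have "eventually (\<lambda>w. w \<in> ball (mobius C x) (r (mobius C x))) (nhds (mobius C x))"
        using r(1)[OF mobius_in_upper_half_plane[OF RC[OF C] x]] by (intro eventually_nhds_in_open) auto
      from eventually_compose_filterlim[OF this l] show ?thesis .
    qed
    then have "eventually (\<lambda>w. \<forall>C\<in>R. mobius C w \<in> ball (mobius C x) (r (mobius C x))) (nhds x)"
      using R(1) by (intro eventually_ball_finite) auto
    then show ?thesis unfolding eventually_nhds_metric by (auto simp: dist_commute)
  qed
  then have "\<forall>x. \<exists>\<rho>. x \<in> upper_half_plane \<longrightarrow> \<rho> > 0 \<and> (\<forall>w\<in>ball x \<rho>. \<forall>C\<in>R. mobius C w \<in> ball (mobius C x) (r (mobius C x)))"
    by blast
  from choice[OF this] obtain \<rho> where \<rho>: "\<And>x. x \<in> upper_half_plane \<Longrightarrow> \<rho> x > 0"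
    "\<And>x w C. x \<in> upper_half_plane \<Longrightarrow> w \<in> ball x (\<rho> x) \<Longrightarrow> C \<in> R \<Longrightarrow> mobius C w \<in> ball (mobius C x) (r (mobius C x))" by blast
  have cusp_piece: "\<exists>\<sigma> M. \<sigma> \<in> carrier SL2R \<and> mobius_ext \<sigma> None = s \<and> M > 0 \<and>
      (\<forall>C\<in>R. controlled j j\<^sub>1 (mobius (C ** \<sigma>) ` {z. Im z > M}))" if s: "s \<in> cusps \<Gamma>" for s
  proof -
    obtain \<sigma> h where \<sigma>: "\<sigma> \<in> carrier SL2R" "h > 0" "mobius_ext \<sigma> None = s" "parabolic \<sigma> h \<in> \<Union>\<Gamma>"
      by (rule cusp_parabolic[OF sub s])
    have "\<exists>M>0. controlled j j\<^sub>1 (mobius (C ** \<sigma>) ` {z. Im z > M})" if C: "C \<in> R" for C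
    proof -
      have C\<sigma>: "C ** \<sigma> \<in> carrier SL2R" using SL2R_mult RC[OF C] \<sigma>(1) by blast
      have "C \<in> \<Union>\<Gamma>" using subsetD[OF R(2) C] .
      from G.m_closed[OF G.m_closed[OF this \<sigma>(4)] G.m_inv_closed[OF this]]
      have "parabolic (C ** \<sigma>) h \<in> \<Union>\<Gamma>" unfolding parabolic_conjugate[OF RC[OF C] \<sigma>(1)] by (simp only: SL2R_simps(2))
      then obtain h' where h': "h' > 0" "parabolic (C ** \<sigma>) h' \<in> \<Union>\<Gamma>\<^sub>1"
        using parabolic_finite_index[OF sub sub1 R C\<sigma> \<sigma>(2)] by blast
      have mc: "meromorphic_at_cusps \<Gamma>\<^sub>1 j" "meromorphic_at_cusps \<Gamma>\<^sub>1 j\<^sub>1"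
        using j by (simp_all only: uniformizing_function_def)
      obtain F c where F: "F meromorphic_on {0}" "\<And>z. Im z > c \<and> Im z > 0 \<Longrightarrow>
          j (mobius (C ** \<sigma>) z) = F (exp (2 * of_real pi * \<i> * z / of_real h'))"
        using mc(1)[unfolded meromorphic_at_cusps_def, THEN bspec, OF C\<sigma>, rule_format, OF h'] by blast
      obtain F' c' where F': "F' meromorphic_on {0}" "\<And>z. Im z > c' \<and> Im z > 0 \<Longrightarrow>
          j\<^sub>1 (mobius (C ** \<sigma>) z) = F' (exp (2 * of_real pi * \<i> * z / of_real h'))"
        using mc(2)[unfolded meromorphic_at_cusps_def, THEN bspec, OF C\<sigma>, rule_format, OF h'] by blast
      show ?thesis by (rule controlled_cusp[OF C\<sigma> h'(1) F F'])
    qed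
    then have "\<forall>C. \<exists>M. C \<in> R \<longrightarrow> M > 0 \<and> controlled j j\<^sub>1 (mobius (C ** \<sigma>) ` {z. Im z > M})" by blast
    from choice[OF this] obtain M where M: "\<And>C. C \<in> R \<Longrightarrow> M C > 0"
      "\<And>C. C \<in> R \<Longrightarrow> controlled j j\<^sub>1 (mobius (C ** \<sigma>) ` {z. Im z > M C})" by blast
    \<comment> \<open>A height that is sufficient for all representatives at once.\<close>
    define M0 where "M0 = 1 + (\<Sum>C\<in>R. M C)"
    have M0: "M C \<le> M0" if "C \<in> R" for C
      using member_le_sum[OF that, of M] M(1) R(1) by (force simp: M0_def less_imp_le)
    have "0 \<le> (\<Sum>C\<in>R. M C)" using less_imp_le[OF M(1)] by (rule sum_nonneg)
    then have "M0 > 0" by (simp add: M0_def)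
    moreover have "controlled j j\<^sub>1 (mobius (C ** \<sigma>) ` {z. Im z > M0})" if C: "C \<in> R" for C
    proof (rule controlled_subset[OF M(2)[OF C]])
      show "mobius (C ** \<sigma>) ` {z. Im z > M0} \<subseteq> mobius (C ** \<sigma>) ` {z. Im z > M C}"
        using M0[OF C] by (intro image_mono) auto
    qed
    ultimately show ?thesis by (intro exI[of _ \<sigma>] exI[of _ M0] conjI ballI \<sigma>(1,3))
  qed
  then have "\<forall>s. \<exists>\<sigma>. s \<in> cusps \<Gamma> \<longrightarrow> (\<exists>M. \<sigma> \<in> carrier SL2R \<and> mobius_ext \<sigma> None = s \<and> M > 0 \<and>
      (\<forall>C\<in>R. controlled j j\<^sub>1 (mobius (C ** \<sigma>) ` {z. Im z > M})))" by blast
  from choice[OF this] obtain \<sigma> where "\<forall>s. \<exists>M. s \<in> cusps \<Gamma> \<longrightarrow> \<sigma> s \<in> carrier SL2R \<and> mobius_ext (\<sigma> s) None = s \<and> M > 0 \<and>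
      (\<forall>C\<in>R. controlled j j\<^sub>1 (mobius (C ** \<sigma> s) ` {z. Im z > M}))" by blast
  from choice[OF this] obtain M where \<sigma>: "\<And>s. s \<in> cusps \<Gamma> \<Longrightarrow> \<sigma> s \<in> carrier SL2R"
    "\<And>s. s \<in> cusps \<Gamma> \<Longrightarrow> mobius_ext (\<sigma> s) None = s" "\<And>s. s \<in> cusps \<Gamma> \<Longrightarrow> M s > 0"
    "\<And>s C. s \<in> cusps \<Gamma> \<Longrightarrow> C \<in> R \<Longrightarrow> controlled j j\<^sub>1 (mobius (C ** \<sigma> s) ` {z. Im z > M s})" by blast
  have "\<exists>\<kappa>>0. horoball s \<kappa> \<subseteq> mobius (\<sigma> s) ` {z. Im z > M s}" if s: "s \<in> cusps \<Gamma>" for s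
    using horoball_mobius_ext[OF \<sigma>(1)[OF s], of None "M s"] \<sigma>(2,3)[OF s] by (simp add: horoball_def)
  then have "\<forall>s. \<exists>\<kappa>. s \<in> cusps \<Gamma> \<longrightarrow> \<kappa> > 0 \<and> horoball s \<kappa> \<subseteq> mobius (\<sigma> s) ` {z. Im z > M s}" by blast
  from choice[OF this] obtain \<kappa> where \<kappa>: "\<And>s. s \<in> cusps \<Gamma> \<Longrightarrow> \<kappa> s > 0"
    "\<And>s. s \<in> cusps \<Gamma> \<Longrightarrow> horoball s (\<kappa> s) \<subseteq> mobius (\<sigma> s) ` {z. Im z > M s}" by blast
  have "\<exists>Z S. finite Z \<and> Z \<subseteq> upper_half_plane \<and> finite S \<and> S \<subseteq> cusps \<Gamma> \<and> (\<forall>z\<in>upper_half_plane.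
    \<exists>A\<in>\<Union>\<Gamma>. (\<exists>x\<in>Z. mobius A z \<in> ball x (\<rho> x)) \<or> (\<exists>s\<in>S. mobius A z \<in> horoball s (\<kappa> s)))"
    using \<rho>(1) \<kappa>(1) by (rule fundamental_cover[OF \<Gamma>])
  then obtain Z S where ZS: "finite Z" "Z \<subseteq> upper_half_plane" "finite S" "S \<subseteq> cusps \<Gamma>" and
    cover: "\<forall>z\<in>upper_half_plane. \<exists>A\<in>\<Union>\<Gamma>. (\<exists>x\<in>Z. mobius A z \<in> ball x (\<rho> x)) \<or> (\<exists>s\<in>S. mobius A z \<in> horoball s (\<kappa> s))"
    by (elim exE conjE) (rule that)
  define \<T> where "\<T> = (\<lambda>(x, C). ball (mobius C x) (r (mobius C x))) ` (Z \<times> R) \<union>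
    (\<lambda>(s, C). mobius (C ** \<sigma> s) ` {z. Im z > M s}) ` (S \<times> R)"
  show ?thesis
  proof (rule controlled_cover_imp_relation[OF subgroup_Union_PSL2R(1)[OF sub1]])
    show "j (mobius A z) = j z \<and> j\<^sub>1 (mobius A z) = j\<^sub>1 z" if "A \<in> \<Union>\<Gamma>\<^sub>1" "z \<in> upper_half_plane" for A z
    proof -
      have 1: "\<forall>A\<in>\<Union>\<Gamma>\<^sub>1. \<forall>z\<in>upper_half_plane. j (mobius A z) = j z"
        using j(1) unfolding uniformizing_function_def by (elim conjE)
      have 2: "\<forall>A\<in>\<Union>\<Gamma>\<^sub>1. \<forall>z\<in>upper_half_plane. j\<^sub>1 (mobius A z) = j\<^sub>1 z"
        using j(2) unfolding uniformizing_function_def by (elim conjE)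
      show ?thesis using 1[THEN bspec, OF that(1), THEN bspec, OF that(2)] 2[THEN bspec, OF that(1), THEN bspec, OF that(2)] ..
    qed
    show "finite \<T>" unfolding \<T>_def using ZS(1,3) R(1) by (intro finite_UnI finite_imageI finite_cartesian_product)
    show "controlled j j\<^sub>1 T" if "T \<in> \<T>" for T
      using that unfolding \<T>_def
    proof (elim UnE imageE)
      fix xC assume "T = (\<lambda>(x, C). ball (mobius C x) (r (mobius C x))) xC" "xC \<in> Z \<times> R"
      then show ?thesis using r(2) mobius_in_upper_half_plane[OF RC] ZS(2) by auto
    next
      fix sC assume "T = (\<lambda>(s, C). mobius (C ** \<sigma> s) ` {z. Im z > M s}) sC" "sC \<in> S \<times> R"
      then show ?thesis using \<sigma>(4) ZS(4) by auto
    qed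
    fix z assume z: "z \<in> upper_half_plane"
    obtain A where A: "A \<in> \<Union>\<Gamma>" "(\<exists>x\<in>Z. mobius A z \<in> ball x (\<rho> x)) \<or> (\<exists>s\<in>S. mobius A z \<in> horoball s (\<kappa> s))"
      using bspec[OF cover z] by (elim bexE) (rule that)
    have Ac: "A \<in> carrier SL2R" using G.mem_carrier[OF A(1)] .
    \<comment> \<open>A moves z into the cover. Writing the inverse of A as B C gives z = B (C (A
      z)) with B in the smaller group and C (A z) in a moved piece.\<close>
    obtain B C where BC: "B \<in> \<Union>\<Gamma>\<^sub>1" "C \<in> R" "inv\<^bsub>SL2R\<^esub> A = B ** C" 
      using R(3)[OF G.m_inv_closed[OF A(1)]] by (elim bexE) (rule that)
    have Bc: "B \<in> carrier SL2R" using subgroup.mem_carrier[OF subgroup_Union_PSL2R(1)[OF sub1] BC(1)] .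
    let ?w = "mobius A z"
    have wH: "?w \<in> upper_half_plane" using mobius_in_upper_half_plane[OF Ac z] .
    have CwH: "mobius C ?w \<in> upper_half_plane" using mobius_in_upper_half_plane[OF RC[OF BC(2)] wH] .
    have zeq: "z = mobius B (mobius C ?w)"
      using mobius_inv(1)[OF Ac z] mobius_mult[OF Bc RC[OF BC(2)] wH] by (simp only: BC(3))
    have T: "\<exists>T\<in>\<T>. mobius C ?w \<in> T"
      using A(2)
    proof
      assume "\<exists>x\<in>Z. ?w \<in> ball x (\<rho> x)"
      then obtain x where x: "x \<in> Z" "?w \<in> ball x (\<rho> x)" by blast
      then have "mobius C ?w \<in> ball (mobius C x) (r (mobius C x))" using \<rho>(2) ZS(2) BC(2) by blast
      moreover have "ball (mobius C x) (r (mobius C x)) \<in> \<T>"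
        unfolding \<T>_def using x(1) BC(2) by (intro UnI1 image_eqI[of _ _ "(x, C)"]) simp_all
      ultimately show ?thesis by (rule bexI[where P = "\<lambda>T. mobius C ?w \<in> T"])
    next
      assume "\<exists>s\<in>S. ?w \<in> horoball s (\<kappa> s)"
      then obtain s where s: "s \<in> S" "?w \<in> horoball s (\<kappa> s)" by blast
      then have sc: "s \<in> cusps \<Gamma>" using ZS(4) by blast
      then obtain u where u: "Im u > M s" "?w = mobius (\<sigma> s) u" using \<kappa>(2) s(2) by blast
      have "u \<in> upper_half_plane" using u(1) \<sigma>(3)[OF sc] by (simp add: upper_half_plane_def)
      then have "mobius C ?w = mobius (C ** \<sigma> s) u"
        unfolding u(2) using mobius_mult[OF RC[OF BC(2)] \<sigma>(1)[OF sc]] by simp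
      then have "mobius C ?w \<in> mobius (C ** \<sigma> s) ` {z. Im z > M s}" using u(1) by blast
      moreover have "mobius (C ** \<sigma> s) ` {z. Im z > M s} \<in> \<T>"
        unfolding \<T>_def using s(1) BC(2) by (intro UnI2 image_eqI[of _ _ "(s, C)"]) simp_all
      ultimately show ?thesis by (rule bexI[where P = "\<lambda>T. mobius C ?w \<in> T"])
    qed
    from T obtain T where "T \<in> \<T>" "mobius C ?w \<in> T" by (elim bexE)
    then show "\<exists>A\<in>\<Union>\<Gamma>\<^sub>1. \<exists>T\<in>\<T>. \<exists>w\<in>T. w \<in> upper_half_plane \<and> z = mobius A w"
      by (intro bexI[OF _ BC(1)] bexI[of _ T] bexI[of _ "mobius C ?w"] conjI CwH zeq)
  qed
qed

section \<open>Transfer of the Ax-Lindemann-Weierstrass property\<close>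

text \<open>By contraposition: a relation for f along t is exchanged for one for g along the same t,
  which is independent for both groups because the commensurators agree.\<close>

lemma ax_lindemann_weierstrass_transfer:
  assumes fg: "meromorphic_pair f g" and F: "F \<noteq> 0" "\<forall>z\<in>regular_points f g. eval2 F (f z) (g z) = 0"
    and comm: "commensurator \<Gamma> = commensurator \<Gamma>'" and alw: "ax_lindemann_weierstrass \<Gamma>' g"
  shows "ax_lindemann_weierstrass \<Gamma> f"
  unfolding ax_lindemann_weierstrass_def
proof (intro allI impI, elim conjE)
  fix N V n t P
  assume V: "irreducible_variety N V" and ind: "geodesically_independent \<Gamma> N V n t" and PV: "P \<in> V"
    and P: "\<forall>i<n. regular_at (t i) P \<and> value_at (t i) P \<in> upper_half_plane"
  interpret variety N V by unfold_locales (rule V)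
  interpret irreducible_points V by (rule irreducible_variety_points[OF V])
  let ?D = "\<lambda>f. {Q \<in> V. \<forall>i<n. regular_at (t i) Q \<and> value_at (t i) Q \<in> upper_half_plane \<and> \<not> is_pole f (value_at (t i) Q)}"
  let ?f = "\<lambda>f (i, k) Q. (deriv ^^ k) f (value_at (t i) Q)"
  show "alg_independent_near N V P (?D f) ({..<n} \<times> {..<3}) (?f f)"
  proof (rule ccontr)
    assume "\<not> ?thesis"
    then obtain U h where U: "openin (top_of_set V) U" "P \<in> U" and h: "h \<in> polyfun" "nonzero_on V h" and
      rel: "\<And>\<rho>. (\<lambda>j. \<rho> (Inl j)) \<in> U \<inter> ?D f \<Longrightarrow>
        (\<And>i. i \<in> {..<n} \<times> {..<3} \<Longrightarrow> \<rho> (Inr i) = ?f f i (\<lambda>j. \<rho> (Inl j))) \<Longrightarrow> h \<rho> = 0"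
      by (rule polyfun_relation_of_dependent) blast
    \<comment> \<open>The conditions shared by the domains for f and for g; avoidance of the poles
      is part of \<open>jet_slots\<close>.\<close>
    define U' where "U' = {Q \<in> U. \<forall>i<n. regular_at (t i) Q \<and> value_at (t i) Q \<in> upper_half_plane}"
    define \<tau> where "\<tau> = (\<lambda>i. value_at (t i))"
    have UV: "U \<subseteq> V" using openin_imp_subset[OF U(1)] .
    have "\<exists>h'. h' \<in> polyfun \<and> nonzero_on V h' \<and>
      (\<forall>\<rho>. (\<lambda>j. \<rho> (Inl j)) \<in> U' \<longrightarrow> (\<forall>i<n. jet_slots \<tau> g i \<rho>) \<longrightarrow> h' \<rho> = 0)"
    proof (rule exchange_all_jets[OF fg F _ _ h])
      show "U' \<subseteq> V" using UV by (auto simp: U'_def)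
      show "\<tau> i Q \<in> upper_half_plane" if "Q \<in> U'" "i < n" for Q i using that by (simp add: U'_def \<tau>_def)
      fix \<rho> :: "nat + nat \<times> nat \<Rightarrow> complex"
      assume \<rho>: "(\<lambda>j. \<rho> (Inl j)) \<in> U'" "\<And>i. i < n \<Longrightarrow> jet_slots \<tau> f i \<rho>"
      show "h \<rho> = 0"
      proof (rule rel)
        show "(\<lambda>j. \<rho> (Inl j)) \<in> U \<inter> ?D f"
          using \<rho> UV by (auto simp: U'_def jet_slots_def Let_def \<tau>_def)
        fix i assume "i \<in> {..<n} \<times> {..<3 :: nat}"
        then show "\<rho> (Inr i) = ?f f i (\<lambda>j. \<rho> (Inl j))"
          using \<rho>(2) by (auto simp: jet_slots_def Let_def \<tau>_def)
      qed
    qed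
    then obtain h' where h': "h' \<in> polyfun" "nonzero_on V h'" "\<And>\<rho>. (\<lambda>j. \<rho> (Inl j)) \<in> U' \<Longrightarrow>
      (\<And>i. i < n \<Longrightarrow> jet_slots \<tau> g i \<rho>) \<Longrightarrow> h' \<rho> = 0" by blast
    have "\<not> alg_independent_near N V P (?D g) ({..<n} \<times> {..<3}) (?f g)"
    proof (rule dependent_of_polyfun_relation[OF U h'(1,2)])
      fix \<rho> :: "nat + nat \<times> nat \<Rightarrow> complex"
      assume \<rho>: "(\<lambda>j. \<rho> (Inl j)) \<in> U \<inter> ?D g"
        "\<And>i. i \<in> {..<n} \<times> {..<3} \<Longrightarrow> \<rho> (Inr i) = ?f g i (\<lambda>j. \<rho> (Inl j))"
      show "h' \<rho> = 0"
      proof (rule h'(3))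
        show "(\<lambda>j. \<rho> (Inl j)) \<in> U'" using \<rho>(1) by (simp add: U'_def)
        fix i assume "i < n"
        then show "jet_slots \<tau> g i \<rho>"
          using \<rho>(1) \<rho>(2)[of "(i, _)"] by (simp add: jet_slots_def Let_def \<tau>_def)
      qed
    qed
    moreover have "geodesically_independent \<Gamma>' N V n t"
      using ind comm by (simp add: geodesically_independent_def)
    ultimately show False
      using alw V PV P unfolding ax_lindemann_weierstrass_def by blast
  qed
qed

lemma bivariate_polynomial:
  fixes c :: "nat \<times> nat \<Rightarrow> complex"
  assumes "a \<le> m" "b \<le> m" "c (a, b) \<noteq> 0"
  obtains F where "F \<noteq> 0" "\<And>x y. eval2 F x y = (\<Sum>(a, b)\<in>{..m} \<times> {..m}. c (a, b) * x ^ a * y ^ b)"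
proof -
  define F where "F = (\<Sum>a\<le>m. Polynomial.monom (\<Sum>b\<le>m. Polynomial.monom (c (a, b)) b) a)"
  have "Polynomial.coeff (Polynomial.coeff F a) b = c (a, b)"
    using assms by (simp add: F_def Polynomial.coeff_sum)
  with assms have "F \<noteq> 0" by auto
  moreover have "eval2 F x y = (\<Sum>(a, b)\<in>{..m} \<times> {..m}. c (a, b) * x ^ a * y ^ b)" for x y
    by (simp add: F_def eval2_def poly_sum poly_monom poly_power sum.cartesian_product[symmetric] sum_distrib_left mult_ac)
  ultimately show ?thesis using that by blast
qed

text \<open>Allows \<open>j\<close> and \<open>j\<^sub>1\<close> to be treated as automorphic
  functions for one group.\<close>

lemma uniformizing_function_subgroup:
  assumes "uniformizing_function \<Gamma> j" "\<Gamma>\<^sub>1 \<subseteq> \<Gamma>"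
  shows "uniformizing_function \<Gamma>\<^sub>1 j"
  using assms Union_mono[OF assms(2)] unfolding uniformizing_function_def meromorphic_at_cusps_def by blast

theorem proposition4p24:
  fixes \<Gamma> \<Gamma>\<^sub>1 :: "(real^2^2) set set" and j j\<^sub>1 :: "complex \<Rightarrow> complex"
  assumes "fuchsian_first_kind \<Gamma>"
    and "finite_index_subgroup PSL2R \<Gamma>\<^sub>1 \<Gamma>"
    and "uniformizing_function \<Gamma> j"
    and "uniformizing_function \<Gamma>\<^sub>1 j\<^sub>1"
  shows "ax_lindemann_weierstrass \<Gamma> j \<longleftrightarrow> ax_lindemann_weierstrass \<Gamma>\<^sub>1 j\<^sub>1"
proof -
  have \<Gamma>: "subgroup \<Gamma> PSL2R" using assms(1) by (simp add: fuchsian_first_kind_def fuchsian_def)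
  have sub: "\<Gamma>\<^sub>1 \<subseteq> \<Gamma>" using group.cover_of_finite_index(2)[OF group_PSL2R \<Gamma> assms(2)] .
  have pair: "meromorphic_pair j j\<^sub>1" "meromorphic_pair j\<^sub>1 j"
    using assms(3,4) by (auto simp: meromorphic_pair_def uniformizing_function_def)
  obtain m c a b where c: "a \<le> m" "b \<le> m" "c (a, b) \<noteq> 0" and
    rel: "\<And>z. z \<in> regular_points j j\<^sub>1 \<Longrightarrow> (\<Sum>(a, b)\<in>{..m} \<times> {..m}. c (a, b) * j z ^ a * j\<^sub>1 z ^ b) = 0"
    using automorphic_functions_dependent[OF assms(1,2) uniformizing_function_subgroup[OF assms(3) sub] assms(4)]
    unfolding combination_def by blast
  obtain F where F: "F \<noteq> 0" "\<And>x y. eval2 F x y = (\<Sum>(a, b)\<in>{..m} \<times> {..m}. c (a, b) * x ^ a * y ^ b)"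
    using bivariate_polynomial[of a m b c] c by blast
  \<comment> \<open>The same relation with the variables exchanged, for the transfer in the opposite
    direction.\<close>
  obtain F' where F': "F' \<noteq> 0" "\<And>x y. eval2 F' x y = (\<Sum>(a, b)\<in>{..m} \<times> {..m}. c (b, a) * x ^ a * y ^ b)"
    using bivariate_polynomial[of b m a "\<lambda>(a, b). c (b, a)"] c by auto
  have "eval2 F' x y = eval2 F y x" for x y
    unfolding F F' sum.cartesian_product[symmetric] by (subst sum.swap) (simp add: mult_ac)
  moreover have "regular_points j\<^sub>1 j = regular_points j j\<^sub>1" by (auto simp: regular_points_def)
  ultimately have "\<forall>z\<in>regular_points j j\<^sub>1. eval2 F (j z) (j\<^sub>1 z) = 0" "\<forall>z\<in>regular_points j\<^sub>1 j. eval2 F' (j\<^sub>1 z) (j z) = 0"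
    using rel F(2) by auto
  then show ?thesis
    using ax_lindemann_weierstrass_transfer[OF pair(1) F(1)] ax_lindemann_weierstrass_transfer[OF pair(2) F'(1)]
      commensurator_finite_index[OF \<Gamma> assms(2)] by metis
qed

end
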